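(* Let $H$ be a Hilbert space, and let $A$ be a self-adjoint nonnegative operator on $H$ with dense domain $D(A)$. Let $g\in L^{2}((0,T),H)$ for every $T>0$, and let $u\in C^{0}([0,+\infty),D(A^{1/2}))$ be a global solution of $u'(t)+Au(t)=g(t)$ on $[0,+\infty)$ (in the strong sense specified in the context). Assume that (i) the spectrum of $A$ is a finite set or an increasing sequence of eigenvalues; (ii) $\lim_{t\to+\infty}|u(t)|_{D(A^{1/2})}=0$; (iii) there exist $p>0$, $q>0$ and $K_{0}\geq 0$ such that $$|g(t)|\leq K_{0}\left(|u(t)|^{1+p}+|A^{1/2}u(t)|^{1+q}\right)\qquad\forall t\geq 0.$$ Then one and only one of the following statements applies. (1) (Null solution) $u(t)=0$ for every $t\geq 0$. (2) (Slow solutions) There exist positive constants $M_{1}$ and $M_{2}$ such that $$|u(t)|\geq\frac{M_{1}}{(1+t)^{1/p}}\qquad\text{and}\qquad |A^{1/2}u(t)|\leq M_{2}|u(t)|^{1+p}\qquad\forall t\geq 0.$$ (3) (Spectral fast solutions) There exist an eigenvalue $\lambda>0$ of $A$ and a corresponding eigenvector $v_{0}\neq 0$ such that $$\lim_{t\to+\infty}\left|u(t)-v_{0}e^{-\lambda t}\right|_{D(A^{1/2})}e^{\gamma t}=0$$ for every $\gamma<\min\{\beta,(1+p)\lambda,(1+q)\lambda\}$, where $\beta=+\infty$ if the spectrum of $A$ is finite and $\lambda$ is its maximum, and $\beta$ is the smallest eigenvalue of $A$ larger than $\lambda$ otherwise.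
   Context: $|x|$ and $\langle x,y\rangle$ denote the norm and scalar product of $H$. Nonnegative means $\langle Au,u\rangle\geq 0$ for all $u\in D(A)$; the powers $A^{\alpha}$ ($\alpha\geq0$) are defined by spectral calculus, and $D(A^{\alpha})$ carries the norm $|u|_{D(A^{\alpha})}=(|u|^{2}+|A^{\alpha}u|^{2})^{1/2}$. A solution of $u'(t)+Au(t)=g(t)$ on $[0,+\infty)$ means a strong solution: for almost every $t>0$, $u'(t)$ exists, $u(t)\in D(A)$ and the equation holds; moreover, for every $T>0$, $u\in C^{0}([0,T],D(A^{1/2}))\cap W^{1,2}((0,T),H)\cap L^{2}((0,T),D(A))$, and $t\mapsto|A^{1/2}u(t)|^{2}$ is absolutely continuous on $[0,T]$. *)

theory Defs
  imports "HOL-Analysis.Analysis"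
begin

section \<open>Unbounded self-adjoint operators\<close>

text \<open>
  An unbounded operator on a real Hilbert space \<open>'h\<close> is a pair of a domain \<open>D\<close> and a function
  \<open>A\<close>; the values of \<open>A\<close> outside \<open>D\<close> are irrelevant.
\<close>

definition linear_operator :: "'h::real_inner set \<Rightarrow> ('h \<Rightarrow> 'h) \<Rightarrow> bool" where
  "linear_operator D A \<longleftrightarrow>
     subspace D \<and>
     (\<forall>u\<in>D. \<forall>v\<in>D. A (u + v) = A u + A v) \<and>
     (\<forall>c. \<forall>u\<in>D. A (c *\<^sub>R u) = c *\<^sub>R A u)"

text \<open>\<open>adjoint_graph D A\<close> consists of the pairs \<open>(v, A\<^sup>* v)\<close>; it is single-valued for dense \<open>D\<close>.\<close>

definition adjoint_graph :: "'h::real_inner set \<Rightarrow> ('h \<Rightarrow> 'h) \<Rightarrow> ('h \<times> 'h) set" where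
  "adjoint_graph D A = {(v, w). \<forall>u\<in>D. A u \<bullet> v = u \<bullet> w}"

definition self_adjoint_operator :: "'h::real_inner set \<Rightarrow> ('h \<Rightarrow> 'h) \<Rightarrow> bool" where
  "self_adjoint_operator D A \<longleftrightarrow>
     linear_operator D A \<and> closure D = UNIV \<and> adjoint_graph D A = (\<lambda>u. (u, A u)) ` D"

definition nonnegative_operator :: "'h::real_inner set \<Rightarrow> ('h \<Rightarrow> 'h) \<Rightarrow> bool" where
  "nonnegative_operator D A \<longleftrightarrow> (\<forall>u\<in>D. A u \<bullet> u \<ge> 0)"

definition is_eigenvector ::
    "'h::real_inner set \<Rightarrow> ('h \<Rightarrow> 'h) \<Rightarrow> real \<Rightarrow> 'h \<Rightarrow> bool" where
  "is_eigenvector D A lam v \<longleftrightarrow> v \<in> D \<and> v \<noteq> 0 \<and> A v = lam *\<^sub>R v"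

definition is_eigenvalue :: "'h::real_inner set \<Rightarrow> ('h \<Rightarrow> 'h) \<Rightarrow> real \<Rightarrow> bool" where
  "is_eigenvalue D A lam \<longleftrightarrow> (\<exists>v. is_eigenvector D A lam v)"

text \<open>
  Only real spectral parameters are considered: the spectrum of a self-adjoint operator (that is,
  of its complexification, when the scalars are real) is contained in the real line.
\<close>

definition resolvent_set :: "'h::real_inner set \<Rightarrow> ('h \<Rightarrow> 'h) \<Rightarrow> real set" where
  "resolvent_set D A =
     {lam. \<exists>R. bounded_linear R \<and>
             (\<forall>u\<in>D. R (A u - lam *\<^sub>R u) = u) \<and>
             (\<forall>v. R v \<in> D \<and> A (R v) - lam *\<^sub>R R v = v)}"

definition spectrum :: "'h::real_inner set \<Rightarrow> ('h \<Rightarrow> 'h) \<Rightarrow> real set" where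
  "spectrum D A = - resolvent_set D A"


section \<open>Spectral calculus and powers\<close>

text \<open>
  Projection-valued measures on the Borel sets of the real line. The identities
  \<open>E {} = 0\<close> and \<open>E (S \<inter> T) = E S \<circ> E T\<close> follow from the conditions below.
\<close>

definition projection_valued_measure :: "(real set \<Rightarrow> 'h::real_inner \<Rightarrow> 'h) \<Rightarrow> bool" where
  "projection_valued_measure E \<longleftrightarrow>
     (\<forall>S\<in>sets borel. linear (E S) \<and> (\<forall>u. E S (E S u) = E S u) \<and>
                     (\<forall>u v. E S u \<bullet> v = u \<bullet> E S v)) \<and>
     (\<forall>u. E UNIV u = u) \<and>
     (\<forall>F. range F \<subseteq> sets borel \<longrightarrow> disjoint_family F \<longrightarrow>
          (\<forall>u. (\<lambda>n. E (F n) u) sums E (\<Union>n::nat. F n) u))"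

definition spectral_measure ::
    "(real set \<Rightarrow> 'h::real_inner \<Rightarrow> 'h) \<Rightarrow> 'h \<Rightarrow> real measure" where
  "spectral_measure E u = measure_of UNIV (sets borel) (\<lambda>S. ennreal (E S u \<bullet> u))"

definition spectral_integral_dom ::
    "(real set \<Rightarrow> 'h::real_inner \<Rightarrow> 'h) \<Rightarrow> (real \<Rightarrow> real) \<Rightarrow> 'h set" where
  "spectral_integral_dom E f = {u. integrable (spectral_measure E u) (\<lambda>x. (f x)\<^sup>2)}"

text \<open>
  \<open>spectral_integral E f\<close> is the operator \<open>\<integral> f(x) dE(x)\<close>, given weakly by
  \<open>\<langle>(\<integral> f dE) u, w\<rangle> = \<integral> f(x) d\<langle>E(x) u, w\<rangle>\<close>; the signed measure
  \<open>S \<mapsto> \<langle>E(S) u, w\<rangle>\<close> is expressed by polarization as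
  \<open>(spectral_measure E (u + w) - spectral_measure E (u - w)) / 4\<close>.
\<close>

definition spectral_integral ::
    "(real set \<Rightarrow> 'h::real_inner \<Rightarrow> 'h) \<Rightarrow> (real \<Rightarrow> real) \<Rightarrow> 'h \<Rightarrow> 'h" where
  "spectral_integral E f u =
     (THE v. \<forall>w\<in>spectral_integral_dom E f.
        v \<bullet> w = ((LINT x|spectral_measure E (u + w). f x)
                - (LINT x|spectral_measure E (u - w). f x)) / 4)"

definition is_spectral_resolution ::
    "'h::real_inner set \<Rightarrow> ('h \<Rightarrow> 'h) \<Rightarrow> (real set \<Rightarrow> 'h \<Rightarrow> 'h) \<Rightarrow> bool" where
  "is_spectral_resolution D A E \<longleftrightarrow>
     projection_valued_measure E \<and>
     spectral_integral_dom E (\<lambda>x. x) = D \<and>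
     (\<forall>u\<in>D. spectral_integral E (\<lambda>x. x) u = A u)"

text \<open>
  For self-adjoint operators on a Hilbert space, the spectral theorem provides existence, and
  uniqueness on the Borel sets, the only sets that matter.
\<close>

definition spectral_resolution ::
    "'h::real_inner set \<Rightarrow> ('h \<Rightarrow> 'h) \<Rightarrow> real set \<Rightarrow> 'h \<Rightarrow> 'h" where
  "spectral_resolution D A = (SOME E. is_spectral_resolution D A E)"

text \<open>
  The powers \<open>A\<^sup>\<alpha>\<close>, \<open>\<alpha> \<ge> 0\<close>, of a nonnegative self-adjoint operator. The case distinction is there
  because \<open>0 powr 0 = 0\<close>. The spectral measures live on \<open>[0, \<infinity>)\<close>, so that the values of the
  integrand on negative numbers do not matter.
\<close>

definition power_fun :: "real \<Rightarrow> real \<Rightarrow> real" where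
  "power_fun \<alpha> x = (if \<alpha> = 0 then 1 else x powr \<alpha>)"

definition dom_power :: "'h::real_inner set \<Rightarrow> ('h \<Rightarrow> 'h) \<Rightarrow> real \<Rightarrow> 'h set" where
  "dom_power D A \<alpha> = spectral_integral_dom (spectral_resolution D A) (power_fun \<alpha>)"

definition op_power :: "'h::real_inner set \<Rightarrow> ('h \<Rightarrow> 'h) \<Rightarrow> real \<Rightarrow> 'h \<Rightarrow> 'h" where
  "op_power D A \<alpha> = spectral_integral (spectral_resolution D A) (power_fun \<alpha>)"

definition dom_power_norm :: "'h::real_inner set \<Rightarrow> ('h \<Rightarrow> 'h) \<Rightarrow> real \<Rightarrow> 'h \<Rightarrow> real" where
  "dom_power_norm D A \<alpha> u = sqrt ((norm u)\<^sup>2 + (norm (op_power D A \<alpha> u))\<^sup>2)"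


section \<open>Function spaces\<close>

text \<open>
  \<open>measurable_on\<close> is almost everywhere approximability by continuous functions, which on the line
  is strong (Bochner) measurability. The Bochner integral of the library is not used for vector
  valued functions because it is restricted to second countable codomains.
\<close>

definition L2_on :: "real set \<Rightarrow> (real \<Rightarrow> 'b::real_normed_vector) \<Rightarrow> bool" where
  "L2_on S f \<longleftrightarrow> f measurable_on S \<and> set_integrable lebesgue S (\<lambda>t. (norm (f t))\<^sup>2)"

text \<open>
  \<open>v\<close> is the weak derivative of \<open>u\<close> on \<open>(0, T)\<close>, that is \<open>\<integral> \<phi>' u = - \<integral> \<phi> v\<close> for all \<open>C\<^sup>1\<close> functions
  \<open>\<phi>\<close> with compact support in \<open>(0, T)\<close>. This identity in \<open>'h\<close> is tested against all \<open>w\<close>, so that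
  only integrals of real functions occur.
\<close>

definition has_weak_derivative_on ::
    "(real \<Rightarrow> 'h::real_inner) \<Rightarrow> (real \<Rightarrow> 'h) \<Rightarrow> real \<Rightarrow> bool" where
  "has_weak_derivative_on u v T \<longleftrightarrow>
     (\<forall>\<phi> :: real \<Rightarrow> real. \<forall>a b.
        \<phi> C1_differentiable_on UNIV \<longrightarrow> 0 < a \<longrightarrow> a < b \<longrightarrow> b < T \<longrightarrow> (\<forall>t. t \<notin> {a..b} \<longrightarrow> \<phi> t = 0) \<longrightarrow>
        (\<forall>w. (LINT t:{0<..<T}|lebesgue. deriv \<phi> t * (u t \<bullet> w))
              = - (LINT t:{0<..<T}|lebesgue. \<phi> t * (v t \<bullet> w))))"

definition W12_on :: "real \<Rightarrow> (real \<Rightarrow> 'h::real_inner) \<Rightarrow> bool" where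
  "W12_on T u \<longleftrightarrow>
     L2_on {0<..<T} u \<and> (\<exists>v. L2_on {0<..<T} v \<and> has_weak_derivative_on u v T)"

text \<open>
  Continuity into \<open>D(A\<^sup>\<alpha>)\<close>, and below square integrability into \<open>D(A)\<close>: both spaces are identified
  with the graph of the operator. The norm of the product type is the graph norm.
\<close>

definition continuous_into_dom_power ::
    "'h::real_inner set \<Rightarrow> ('h \<Rightarrow> 'h) \<Rightarrow> real \<Rightarrow> real set \<Rightarrow> (real \<Rightarrow> 'h) \<Rightarrow> bool" where
  "continuous_into_dom_power D A \<alpha> I u \<longleftrightarrow>
     (\<forall>t\<in>I. u t \<in> dom_power D A \<alpha>) \<and> continuous_on I (\<lambda>t. (u t, op_power D A \<alpha> (u t)))"

definition L2_into_dom ::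
    "'h::real_inner set \<Rightarrow> ('h \<Rightarrow> 'h) \<Rightarrow> real set \<Rightarrow> (real \<Rightarrow> 'h) \<Rightarrow> bool" where
  "L2_into_dom D A S u \<longleftrightarrow>
     (AE t in lebesgue. t \<in> S \<longrightarrow> u t \<in> D) \<and> L2_on S (\<lambda>t. (u t, A (u t)))"

definition abs_continuous_on :: "real \<Rightarrow> real \<Rightarrow> (real \<Rightarrow> real) \<Rightarrow> bool" where
  "abs_continuous_on a b f \<longleftrightarrow>
     (\<forall>\<epsilon>>0. \<exists>\<delta>>0. \<forall>(n::nat) x y.
        (\<forall>i<n. a \<le> x i \<and> x i \<le> y i \<and> y i \<le> b) \<longrightarrow>
        (\<forall>i<n. \<forall>j<n. i \<noteq> j \<longrightarrow> y i \<le> x j \<or> y j \<le> x i) \<longrightarrow>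
        (\<Sum>i<n. y i - x i) < \<delta> \<longrightarrow> (\<Sum>i<n. \<bar>f (y i) - f (x i)\<bar>) < \<epsilon>)"


section \<open>Strong solutions\<close>

text \<open>Functions on \<open>[0, \<infinity>)\<close> are total functions on the reals whose values at \<open>t < 0\<close> are irrelevant.\<close>

definition strong_solution ::
    "'h::real_inner set \<Rightarrow> ('h \<Rightarrow> 'h) \<Rightarrow> (real \<Rightarrow> 'h) \<Rightarrow> (real \<Rightarrow> 'h) \<Rightarrow> bool" where
  "strong_solution D A g u \<longleftrightarrow>
     (AE t in lebesgue. t > 0 \<longrightarrow>
        (\<exists>u'. (u has_vector_derivative u') (at t) \<and> u t \<in> D \<and> u' + A (u t) = g t)) \<and>
     (\<forall>T>0.
        continuous_into_dom_power D A (1/2) {0..T} u \<and>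
        W12_on T u \<and>
        L2_into_dom D A {0<..<T} u \<and>
        abs_continuous_on 0 T (\<lambda>t. (norm (op_power D A (1/2) (u t)))\<^sup>2))"


section \<open>The three asymptotic regimes\<close>

definition null_solution :: "(real \<Rightarrow> 'h::real_inner) \<Rightarrow> bool" where
  "null_solution u \<longleftrightarrow> (\<forall>t\<ge>0. u t = 0)"

definition slow_solution ::
    "'h::real_inner set \<Rightarrow> ('h \<Rightarrow> 'h) \<Rightarrow> real \<Rightarrow> (real \<Rightarrow> 'h) \<Rightarrow> bool" where
  "slow_solution D A p u \<longleftrightarrow>
     (\<exists>M\<^sub>1>0. \<exists>M\<^sub>2>0. \<forall>t\<ge>0.
        norm (u t) \<ge> M\<^sub>1 / (1 + t) powr (1 / p) \<and>
        norm (op_power D A (1/2) (u t)) \<le> M\<^sub>2 * norm (u t) powr (1 + p))"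

definition next_eigenvalue :: "'h::real_inner set \<Rightarrow> ('h \<Rightarrow> 'h) \<Rightarrow> real \<Rightarrow> ereal" where
  "next_eigenvalue D A lam =
     (if finite (spectrum D A) \<and> lam = Max (spectrum D A) then \<infinity>
      else ereal (LEAST \<mu>. is_eigenvalue D A \<mu> \<and> \<mu> > lam))"

definition spectral_fast_solution ::
    "'h::real_inner set \<Rightarrow> ('h \<Rightarrow> 'h) \<Rightarrow> real \<Rightarrow> real \<Rightarrow> (real \<Rightarrow> 'h) \<Rightarrow> bool" where
  "spectral_fast_solution D A p q u \<longleftrightarrow>
     (\<exists>lam v\<^sub>0. lam > 0 \<and> is_eigenvector D A lam v\<^sub>0 \<and>
        (\<forall>\<gamma>::real.
           ereal \<gamma> < min (next_eigenvalue D A lam) (min (ereal ((1 + p) * lam)) (ereal ((1 + q) * lam))) \<longrightarrow>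
           ((\<lambda>t. dom_power_norm D A (1/2) (u t - exp (- lam * t) *\<^sub>R v\<^sub>0) * exp (\<gamma> * t)) \<longlongrightarrow> 0) at_top))"

end

theory Submission
  imports Defs
begin

text \<open>
  The operator has a discrete spectrum, so the space splits into eigenspaces with orthogonal
  projections \<open>P n\<close> and eigenvalues \<open>e n\<close> (\<open>P_sums\<close>), and everything can be expressed by the modes
  \<open>P n (u t)\<close>. Let \<open>y = \<parallel>u\<parallel>\<^sup>2\<close> and \<open>z = \<parallel>A\<^sup>1\<^sup>/\<^sup>2 u\<parallel>\<^sup>2\<close>. Apart from an estimate for single modes
  (\<open>mode_increment\<close>), the equation enters only through one family of differential inequalities:
  for a weight \<open>c\<close> and \<open>\<theta> > 0\<close>, the sum of the \<open>c n \<parallel>P n u\<parallel>\<^sup>2\<close> grows at most at the rate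
  given by the weight \<open>c\<^sup>2 / \<theta> - 2 c e\<close> plus \<open>\<theta> \<parallel>g\<parallel>\<^sup>2\<close> (\<open>energy_inequality\<close>). Choosing
  \<open>c = e - m\<close> controls the Dirichlet quotient \<open>z / y\<close>: it satisfies a linear differential
  inequality whose forcing term is small because \<open>\<parallel>g\<parallel>\<^sup>2 \<le> \<eta> (y + z)\<close> with \<open>\<eta> \<rightarrow> 0\<close>.

  On bounded intervals this bounds \<open>z / y\<close>, so a solution vanishes identically or nowhere
  (\<open>null_or_nowhere_zero\<close>). Let \<open>e1 = e 1 > 0\<close>. Since there is no spectrum in
  \<open>(0, e1)\<close>, the quotient cannot cross a small level \<open>\<kappa>\<close> upwards at late times
  (\<open>dirichlet_quotient_stays_small\<close>), and there are two cases.

  If \<open>z \<le> \<kappa> y\<close> at some late time, then this persists; the solution is dominated by its component in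
  the kernel of \<open>A\<close>, and comparison with \<open>M y\<^sup>1\<^sup>+\<^sup>p\<close> yields \<open>z \<le> M y\<^sup>1\<^sup>+\<^sup>p\<close>. Then \<open>y\<close> decreases at most
  at the rate \<open>y\<^sup>1\<^sup>+\<^sup>p\<^sup>/\<^sup>2\<close>, which gives the lower bound for slow solutions
  (\<open>small_dirichlet_quotient_imp_slow\<close>).

  If \<open>z > \<kappa> y\<close> at all late times, the solution decays exponentially. Let \<open>\<lambda>\<close> be the supremum of the
  rates \<open>\<gamma>\<close> with \<open>u = O(exp (- \<gamma> t))\<close>. It is finite: the forcing term is now integrable, so that
  \<open>z / y\<close> is bounded for all times (\<open>decay_rates_bdd_above\<close>). Because \<open>g\<close> is superlinear, it decays
  faster than \<open>exp (- \<lambda> t)\<close>; hence \<open>exp (e n t) P n (u t)\<close> converges for \<open>e n \<le> \<lambda>\<close>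
  (\<open>mode_limit\<close>), the limit being \<open>0\<close> for \<open>e n < \<lambda>\<close>, while the modes above \<open>\<lambda>\<close> decay faster
  (\<open>high_modes\<close>). If all limits vanished, the rate \<open>\<lambda>\<close> could be improved. So \<open>\<lambda>\<close> is an eigenvalue
  with a nonzero limit \<open>v\<close>, and the remainder \<open>u - exp (- \<lambda> t) v\<close> decays at the asserted rates
  (\<open>spectral_fast\<close>).

  Two preparations are needed. The powers of \<open>A\<close> are defined by an arbitrarily chosen
  spectral resolution, so its existence and uniqueness have to be established
  (\<open>diagonal_pvm_is_spectral_resolution\<close>, \<open>spectral_resolution_unique\<close>). And the differential
  inequalities hold only almost everywhere; they are integrated by a fundamental theorem of
  calculus for functions with dominated increments (\<open>ftc_dominated\<close>).
\<close>


section \<open>Orthogonal projections in Hilbert space\<close>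

lemma norm_diff_squared:
  fixes x y :: "'h::real_inner"
  shows "(norm (x - y))\<^sup>2 = (norm x)\<^sup>2 - 2 * (x \<bullet> y) + (norm y)\<^sup>2"
  by (simp add: power2_norm_eq_inner inner_diff_left inner_diff_right inner_commute algebra_simps)

text \<open>
  By the parallelogram law, a minimising sequence for the distance from \<open>x\<close> to \<open>M\<close> is a Cauchy
  sequence; its limit is the foot of the perpendicular.
\<close>

lemma exists_orthogonal_decomposition:
  fixes M :: "'h::{real_inner, complete_space} set"
  assumes M: "subspace M" "closed M"
  shows "\<exists>m\<in>M. \<forall>z\<in>M. (x - m) \<bullet> z = 0"
proof -
  define d where "d = infdist x M"
  have ne: "M \<noteq> {}" using subspace_0[OF M(1)] by auto
  have d0: "d \<ge> 0" by (simp add: d_def infdist_nonneg)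
  have dle: "d \<le> norm (x - z)" if "z \<in> M" for z
    using infdist_le[OF that, of x] by (simp add: d_def dist_norm)
  have "\<exists>m\<in>M. (norm (x - m))\<^sup>2 < d\<^sup>2 + 1 / Suc k" for k
  proof -
    have "sqrt (d\<^sup>2 + 1 / Suc k) > d"
      using d0 by (intro real_less_rsqrt) auto
    then obtain m where "m \<in> M" "dist x m < sqrt (d\<^sup>2 + 1 / Suc k)"
      unfolding d_def using cINF_less_iff[of M "dist x"] ne
      by (metis bdd_below_image_dist infdist_notempty)
    then have "(norm (x - m))\<^sup>2 < (sqrt (d\<^sup>2 + 1 / Suc k))\<^sup>2"
      by (intro power_strict_mono) (auto simp: dist_norm)
    then show ?thesis using \<open>m \<in> M\<close> by (auto simp: real_sqrt_pow2)
  qed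
  then obtain m where m: "\<And>k. m k \<in> M" "\<And>k. (norm (x - m k))\<^sup>2 < d\<^sup>2 + 1 / Suc k"
    by metis
  have close: "(norm (m k - m l))\<^sup>2 \<le> 2 / Suc k + 2 / Suc l" for k l
  proof -
    have "(1/2) *\<^sub>R (m k + m l) \<in> M"
      using m(1) M(1) by (intro subspace_scale subspace_add) auto
    then have "d\<^sup>2 \<le> (norm (x - (1/2) *\<^sub>R (m k + m l)))\<^sup>2"
      using dle d0 by (intro power_mono) auto
    moreover have "(norm (m k - m l))\<^sup>2 = 2 * (norm (x - m k))\<^sup>2 + 2 * (norm (x - m l))\<^sup>2
        - 4 * (norm (x - (1/2) *\<^sub>R (m k + m l)))\<^sup>2"
      by (simp add: power2_norm_eq_inner inner_diff_left inner_diff_right inner_add_left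
          inner_add_right inner_commute algebra_simps)
    moreover have "2 / real (Suc j) = 2 * (1 / Suc j)" for j by simp
    ultimately show ?thesis using m(2)[of k] m(2)[of l] by linarith
  qed
  have "Cauchy m"
  proof (rule metric_CauchyI)
    fix \<epsilon> :: real assume e: "\<epsilon> > 0"
    obtain N :: nat where N: "4 / \<epsilon>\<^sup>2 < N" using reals_Archimedean2 by blast
    show "\<exists>N. \<forall>k\<ge>N. \<forall>l\<ge>N. dist (m k) (m l) < \<epsilon>"
    proof (intro exI allI impI)
      fix k l assume kl: "k \<ge> N" "l \<ge> N"
      have b: "2 / Suc j < \<epsilon>\<^sup>2 / 2" if "j \<ge> N" for j
      proof -
        have "4 / \<epsilon>\<^sup>2 < Suc j" using N that by linarith
        then show ?thesis using e by (simp add: field_simps)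
      qed
      have "(norm (m k - m l))\<^sup>2 < \<epsilon>\<^sup>2"
        using close[of k l] b[OF kl(1)] b[OF kl(2)] by linarith
      then show "dist (m k) (m l) < \<epsilon>"
        using e by (simp add: dist_norm power2_less_imp_less)
    qed
  qed
  then obtain p where p: "m \<longlonglongrightarrow> p" using Cauchy_convergent convergent_def by blast
  have pM: "p \<in> M" using closed_sequentially[OF M(2)] m(1) p by blast
  have "(\<lambda>k. (norm (x - m k))\<^sup>2) \<longlonglongrightarrow> (norm (x - p))\<^sup>2" by (intro tendsto_intros p)
  moreover have "(\<lambda>k. d\<^sup>2 + 1 / Suc k) \<longlonglongrightarrow> d\<^sup>2 + 0"
    by (intro tendsto_intros LIMSEQ_Suc[OF lim_1_over_n])
  ultimately have pd: "(norm (x - p))\<^sup>2 \<le> d\<^sup>2"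
    using m(2) by (intro LIMSEQ_le) (auto intro: less_imp_le)
  have "(x - p) \<bullet> z = 0" if z: "z \<in> M" for z
  proof (rule ccontr)
    assume nz: "(x - p) \<bullet> z \<noteq> 0"
    then have z0: "z \<bullet> z > 0" by auto
    \<comment> \<open>The value of \<open>t\<close> that minimises the distance from \<open>x\<close> to \<open>p + t z\<close>.\<close>
    define t where "t = ((x - p) \<bullet> z) / (z \<bullet> z)"
    have "p + t *\<^sub>R z \<in> M" using pM z M(1) by (intro subspace_add subspace_scale)
    then have "d\<^sup>2 \<le> (norm (x - (p + t *\<^sub>R z)))\<^sup>2" using dle d0 by (intro power_mono) auto
    also have "\<dots> = (norm (x - p))\<^sup>2 - 2 * t * ((x - p) \<bullet> z) + t\<^sup>2 * (z \<bullet> z)"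
      unfolding diff_diff_eq[symmetric] norm_diff_squared[of "x - p" "t *\<^sub>R z"]
      by (simp add: power_mult_distrib power2_norm_eq_inner[of z])
    also have "\<dots> = (norm (x - p))\<^sup>2 - ((x - p) \<bullet> z)\<^sup>2 / (z \<bullet> z)"
      using z0 by (simp add: t_def field_simps power2_eq_square)
    finally have "((x - p) \<bullet> z)\<^sup>2 / (z \<bullet> z) \<le> 0" using pd by simp
    then show False using z0 nz by (simp add: field_simps)
  qed
  then show ?thesis using pM by blast
qed

lemma subspace_closure:
  fixes M :: "'h::real_normed_vector set"
  assumes "subspace M"
  shows "subspace (closure M)"
proof (rule subspaceI)
  show "0 \<in> closure M" using subspace_0[OF assms] closure_subset by blast
  fix x y assume "x \<in> closure M" "y \<in> closure M"
  then obtain f g where fg: "\<forall>n::nat. f n \<in> M" "f \<longlonglongrightarrow> x" "\<forall>n::nat. g n \<in> M" "g \<longlonglongrightarrow> y"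
    unfolding closure_sequential by auto
  have "(\<lambda>n. f n + g n) \<longlonglongrightarrow> x + y" using fg by (intro tendsto_add)
  moreover have "\<forall>n. f n + g n \<in> M" using fg subspace_add[OF assms] by simp
  ultimately show "x + y \<in> closure M"
    unfolding closure_sequential by (intro exI[of _ "\<lambda>n. f n + g n"] conjI)
next
  fix c x assume "x \<in> closure M"
  then obtain f where f: "\<forall>n::nat. f n \<in> M" "f \<longlonglongrightarrow> x"
    unfolding closure_sequential by auto
  have "(\<lambda>n. c *\<^sub>R f n) \<longlonglongrightarrow> c *\<^sub>R x" using f by (intro tendsto_scaleR tendsto_const)
  moreover have "\<forall>n. c *\<^sub>R f n \<in> M" using f subspace_scale[OF assms] by simp
  ultimately show "c *\<^sub>R x \<in> closure M"
    unfolding closure_sequential by (intro exI[of _ "\<lambda>n. c *\<^sub>R f n"] conjI)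
qed

definition orthogonal_projection :: "'h::{real_inner, complete_space} set \<Rightarrow> 'h \<Rightarrow> 'h" where
  "orthogonal_projection M x = (SOME m. m \<in> M \<and> (\<forall>z\<in>M. (x - m) \<bullet> z = 0))"

context
  fixes M :: "'h::{real_inner, complete_space} set"
  assumes M: "subspace M" "closed M"
begin

lemma orthogonal_projection_in: "orthogonal_projection M x \<in> M"
  and orthogonal_projection_orthogonal: "z \<in> M \<Longrightarrow> (x - orthogonal_projection M x) \<bullet> z = 0"
  using someI_ex[of "\<lambda>m. m \<in> M \<and> (\<forall>z\<in>M. (x - m) \<bullet> z = 0)"]
    exists_orthogonal_decomposition[OF M, of x]
  unfolding orthogonal_projection_def by blast+

lemma orthogonal_projection_eqI:
  assumes "m \<in> M" "\<And>z. z \<in> M \<Longrightarrow> (x - m) \<bullet> z = 0"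
  shows "orthogonal_projection M x = m"
proof -
  let ?p = "orthogonal_projection M x"
  have d: "?p - m \<in> M" using assms(1) orthogonal_projection_in subspace_diff[OF M(1)] by blast
  have "(?p - m) \<bullet> (?p - m) = (x - m) \<bullet> (?p - m) - (x - ?p) \<bullet> (?p - m)"
    by (simp add: inner_diff_left)
  also have "\<dots> = 0" using assms(2)[OF d] orthogonal_projection_orthogonal[OF d] by simp
  finally show ?thesis by simp
qed

lemma orthogonal_projection_fixes: "x \<in> M \<Longrightarrow> orthogonal_projection M x = x"
  by (rule orthogonal_projection_eqI) auto

lemma orthogonal_projection_symmetric:
  "orthogonal_projection M x \<bullet> y = x \<bullet> orthogonal_projection M y"
proof -
  have "(x - orthogonal_projection M x) \<bullet> orthogonal_projection M y = 0"
    "(y - orthogonal_projection M y) \<bullet> orthogonal_projection M x = 0"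
    using orthogonal_projection_orthogonal orthogonal_projection_in by blast+
  then show ?thesis
    using inner_commute[of y "orthogonal_projection M x"]
      inner_commute[of "orthogonal_projection M x" "orthogonal_projection M y"]
    by (simp add: inner_diff_left)
qed

lemma norm_orthogonal_projection_le: "norm (orthogonal_projection M x) \<le> norm x"
proof -
  let ?p = "orthogonal_projection M x"
  have "(x - ?p) \<bullet> ?p = 0" using orthogonal_projection_orthogonal orthogonal_projection_in by blast
  then have "(norm ?p)\<^sup>2 = x \<bullet> ?p" by (simp add: inner_diff_left power2_norm_eq_inner)
  also have "\<dots> \<le> norm x * norm ?p" by (rule norm_cauchy_schwarz)
  finally have "norm ?p * norm ?p \<le> norm x * norm ?p" by (simp add: power2_eq_square)
  then show ?thesis by (metis mult_right_le_imp_le norm_ge_zero order_le_less)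
qed

lemma bounded_linear_orthogonal_projection: "bounded_linear (orthogonal_projection M)"
proof (rule bounded_linear_intro[where K = 1])
  show "orthogonal_projection M (x + y) = orthogonal_projection M x + orthogonal_projection M y" for x y
    by (rule orthogonal_projection_eqI)
      (use orthogonal_projection_orthogonal[of _ x] orthogonal_projection_orthogonal[of _ y]
        in \<open>auto intro: subspace_add[OF M(1)] orthogonal_projection_in
          simp: inner_diff_left inner_add_left\<close>)
  show "orthogonal_projection M (r *\<^sub>R x) = r *\<^sub>R orthogonal_projection M x" for r x
    by (rule orthogonal_projection_eqI)
      (use orthogonal_projection_orthogonal[of _ x]
        in \<open>auto intro: subspace_scale[OF M(1)] orthogonal_projection_in simp: inner_diff_left\<close>)
  show "norm (orthogonal_projection M x) \<le> norm x * 1" for x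
    using norm_orthogonal_projection_le by simp
qed

end

section \<open>Self-adjoint operators and their resolvents\<close>

locale self_adjoint =
  fixes D :: "'h::{real_inner, complete_space} set" and A :: "'h \<Rightarrow> 'h"
  assumes self_adjoint_operator: "self_adjoint_operator D A"
begin

lemma subspace_D: "subspace D"
  and A_add: "u \<in> D \<Longrightarrow> v \<in> D \<Longrightarrow> A (u + v) = A u + A v"
  and A_scale: "u \<in> D \<Longrightarrow> A (c *\<^sub>R u) = c *\<^sub>R A u"
  and closure_D: "closure D = UNIV"
  using self_adjoint_operator
  by (auto simp: self_adjoint_operator_def linear_operator_def)

lemma A_diff: "u \<in> D \<Longrightarrow> v \<in> D \<Longrightarrow> A (u - v) = A u - A v"
  using A_add[of u "(-1) *\<^sub>R v"] A_scale[of v "-1"] subspace_scale[OF subspace_D, of v "-1"] by simp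

lemma A_zero: "A 0 = 0"
  using A_scale[of 0 0] subspace_0[OF subspace_D] by simp

lemma A_symmetric: "u \<in> D \<Longrightarrow> v \<in> D \<Longrightarrow> A u \<bullet> v = u \<bullet> A v"
  using self_adjoint_operator
  unfolding self_adjoint_operator_def adjoint_graph_def by blast

lemma adjoint_pair_in_graph:
  assumes "\<And>u. u \<in> D \<Longrightarrow> A u \<bullet> v = u \<bullet> w"
  shows "v \<in> D" "A v = w"
proof -
  have "(v, w) \<in> (\<lambda>u. (u, A u)) ` D"
    using self_adjoint_operator assms
    unfolding self_adjoint_operator_def adjoint_graph_def by blast
  then show "v \<in> D" "A v = w" by auto
qed

lemma orthogonal_D_imp_zero:
  assumes "\<And>u. u \<in> D \<Longrightarrow> u \<bullet> w = 0"
  shows "w = 0"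
proof -
  have "closed {u. u \<bullet> w = 0}" by (intro closed_Collect_eq continuous_intros)
  then have "closure D \<subseteq> {u. u \<bullet> w = 0}" using assms by (intro closure_minimal) auto
  then have "w \<in> {u. u \<bullet> w = 0}" using closure_D by blast
  then show ?thesis by simp
qed

lemma closed_graph:
  assumes "\<And>n. x n \<in> D" "x \<longlonglongrightarrow> l" "(\<lambda>n. A (x n)) \<longlonglongrightarrow> m"
  shows "l \<in> D" "A l = m"
proof -
  have "A u \<bullet> l = u \<bullet> m" if "u \<in> D" for u
  proof (rule LIMSEQ_unique)
    show "(\<lambda>n. A u \<bullet> x n) \<longlonglongrightarrow> A u \<bullet> l" by (intro tendsto_intros assms)
    have "(\<lambda>n. u \<bullet> A (x n)) \<longlonglongrightarrow> u \<bullet> m" by (intro tendsto_intros assms)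
    then show "(\<lambda>n. A u \<bullet> x n) \<longlonglongrightarrow> u \<bullet> m" using A_symmetric[OF that assms(1)] by simp
  qed
  then show "l \<in> D" "A l = m" using adjoint_pair_in_graph by blast+
qed

text \<open>
  The range of \<open>A - c\<close> is closed because the graph of \<open>A\<close> is. It is dense, since a vector
  orthogonal to it belongs to the domain of the adjoint, which is \<open>A\<close>, and is an eigenvector for
  \<open>c\<close>, contrary to the lower bound.
\<close>

lemma bounded_below_imp_resolvent:
  assumes d: "d > 0" and below: "\<And>u. u \<in> D \<Longrightarrow> d * norm u \<le> norm (A u - c *\<^sub>R u)"
  shows "c \<in> resolvent_set D A"
proof -
  define B where "B u = A u - c *\<^sub>R u" for u
  have B_add: "B (u + v) = B u + B v" and B_diff: "B (u - v) = B u - B v"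
    if "u \<in> D" "v \<in> D" for u v
    using that by (auto simp: B_def A_add A_diff algebra_simps)
  have B_scale: "B (a *\<^sub>R u) = a *\<^sub>R B u" if "u \<in> D" for u a
    using that by (auto simp: B_def A_scale algebra_simps)
  have inj: "u = v" if "u \<in> D" "v \<in> D" "B u = B v" for u v
    using below[of "u - v"] that subspace_diff[OF subspace_D] B_diff[of u v] d
    by (simp add: B_def mult_le_0_iff)
  have sub: "subspace (B ` D)"
  proof (rule subspaceI)
    show "0 \<in> B ` D" using A_zero subspace_0[OF subspace_D] by (force simp: B_def image_iff)
    fix x y assume "x \<in> B ` D" "y \<in> B ` D"
    then show "x + y \<in> B ` D"
      using subspace_add[OF subspace_D] by (auto simp: B_add[symmetric])
  next
    fix a x assume "x \<in> B ` D"
    then show "a *\<^sub>R x \<in> B ` D"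
      using subspace_scale[OF subspace_D] by (auto simp: B_scale[symmetric])
  qed
  have clo: "closed (B ` D)"
    unfolding closed_sequential_limits
  proof (intro allI impI)
    fix y l assume yl: "(\<forall>n. y n \<in> B ` D) \<and> y \<longlonglongrightarrow> l"
    then have "\<forall>n. \<exists>z. z \<in> D \<and> y n = B z" by blast
    then obtain x where x: "\<And>n. x n \<in> D" "\<And>n. y n = B (x n)" by metis
    have "Cauchy x"
    proof (rule metric_CauchyI)
      fix e :: real assume e: "e > 0"
      have "Cauchy y" using yl LIMSEQ_imp_Cauchy by blast
      then obtain N where N: "\<And>m n. m \<ge> N \<Longrightarrow> n \<ge> N \<Longrightarrow> dist (y m) (y n) < d * e"
        using e d unfolding Cauchy_def by (meson mult_pos_pos)
      show "\<exists>N. \<forall>m\<ge>N. \<forall>n\<ge>N. dist (x m) (x n) < e"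
      proof (intro exI allI impI)
        fix m n assume mn: "m \<ge> N" "n \<ge> N"
        have "d * norm (x m - x n) \<le> norm (B (x m - x n))"
          using below[of "x m - x n"] subspace_diff[OF subspace_D] x(1) by (simp add: B_def)
        also have "\<dots> = dist (y m) (y n)" using x B_diff by (simp add: dist_norm)
        also have "\<dots> < d * e" using N mn by blast
        finally show "dist (x m) (x n) < e" using d by (simp add: dist_norm)
      qed
    qed
    then obtain p where p: "x \<longlonglongrightarrow> p" using Cauchy_convergent convergent_def by blast
    have "(\<lambda>n. y n + c *\<^sub>R x n) \<longlonglongrightarrow> l + c *\<^sub>R p" using yl p by (intro tendsto_intros) auto
    moreover have "y n + c *\<^sub>R x n = A (x n)" for n by (simp add: x B_def)
    ultimately have "(\<lambda>n. A (x n)) \<longlonglongrightarrow> l + c *\<^sub>R p" by simp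
    from closed_graph[OF x(1) p this] have "p \<in> D" "l = B p" by (auto simp: B_def)
    then show "l \<in> B ` D" by blast
  qed
  have surj: "\<exists>u\<in>D. B u = v" for v
  proof -
    obtain m where m: "m \<in> B ` D" "\<And>z. z \<in> B ` D \<Longrightarrow> (v - m) \<bullet> z = 0"
      using exists_orthogonal_decomposition[OF sub clo, of v] by blast
    have "A u \<bullet> (v - m) = u \<bullet> (c *\<^sub>R (v - m))" if "u \<in> D" for u
      using m(2)[of "B u"] that by (simp add: B_def inner_diff_right inner_commute)
    from adjoint_pair_in_graph[OF this] have "v - m \<in> D" "B (v - m) = 0" by (auto simp: B_def)
    then have "v - m = 0" using below[of "v - m"] d by (simp add: B_def mult_le_0_iff)
    then show ?thesis using m(1) by auto
  qed
  then obtain R where R: "\<And>v. R v \<in> D" "\<And>v. B (R v) = v" by metis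
  have RB: "R (B u) = u" if "u \<in> D" for u using inj[of "R (B u)" u] R that by auto
  have "bounded_linear R"
  proof (rule bounded_linear_intro[where K = "1 / d"])
    show "R (x + y) = R x + R y" for x y
      using inj[of "R (x + y)" "R x + R y"] R B_add subspace_add[OF subspace_D] by auto
    show "R (r *\<^sub>R x) = r *\<^sub>R R x" for r x
      using inj[of "R (r *\<^sub>R x)" "r *\<^sub>R R x"] R B_scale subspace_scale[OF subspace_D] by auto
    show "norm (R x) \<le> norm x * (1 / d)" for x
      using below[of "R x"] R d by (simp add: B_def field_simps)
  qed
  then show ?thesis
    unfolding resolvent_set_def using R RB by (auto simp: B_def)
qed

lemma resolvent_set_bounded_below:
  assumes "c \<in> resolvent_set D A"
  shows "\<exists>d>0. \<forall>u\<in>D. d * norm u \<le> norm (A u - c *\<^sub>R u)"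
proof -
  obtain R where R: "bounded_linear R" "\<And>u. u \<in> D \<Longrightarrow> R (A u - c *\<^sub>R u) = u"
    using assms unfolding resolvent_set_def by blast
  obtain K where K: "K > 0" "\<And>x. norm (R x) \<le> norm x * K"
    using bounded_linear.pos_bounded[OF R(1)] by blast
  have "(1 / K) * norm u \<le> norm (A u - c *\<^sub>R u)" if "u \<in> D" for u
    using K(2)[of "A u - c *\<^sub>R u"] R(2)[OF that] K(1) by (simp add: field_simps)
  then show ?thesis using K(1) by (intro exI[of _ "1 / K"]) auto
qed

text \<open>
  Let \<open>\<rho> = \<parallel>R\<parallel>\<close> for the resolvent \<open>R\<close> at \<open>c\<close>. Then \<open>(\<rho>\<^sup>2 - R\<^sup>2) x\<close> is small for almost maximising
  unit vectors \<open>x\<close>. Hence \<open>\<rho> - R\<close> and \<open>\<rho> + R\<close> cannot both be bounded below, so one of the points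
  \<open>c \<plusminus> 1 / \<rho>\<close> lies in the spectrum. This gives the optimal resolvent bound without a functional
  calculus.
\<close>

lemma gap_imp_bounded_below:
  assumes d: "d > 0" and gap: "{c - d <..< c + d} \<subseteq> resolvent_set D A" and u: "u \<in> D"
  shows "d * norm u \<le> norm (A u - c *\<^sub>R u)"
proof (rule ccontr)
  assume contra: "\<not> ?thesis"
  have "c \<in> resolvent_set D A" using gap d by auto
  then obtain R where blR: "bounded_linear R" and RB: "\<And>u. u \<in> D \<Longrightarrow> R (A u - c *\<^sub>R u) = u"
    and RD: "\<And>v. R v \<in> D" and BR: "\<And>v. A (R v) - c *\<^sub>R R v = v"
    unfolding resolvent_set_def by blast
  interpret R: bounded_linear R by fact
  define \<rho> where "\<rho> = onorm R"
  have nR: "norm (R x) \<le> \<rho> * norm x" for x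
    unfolding \<rho>_def by (rule onorm[OF blR])
  have symR: "R x \<bullet> y = x \<bullet> R y" for x y
  proof -
    have "R x \<bullet> (A (R y) - c *\<^sub>R R y) = (A (R x) - c *\<^sub>R R x) \<bullet> R y"
      using A_symmetric[OF RD RD, of x y] by (simp add: inner_diff_left inner_diff_right)
    then show ?thesis by (simp only: BR)
  qed
  have "norm u \<le> \<rho> * norm (A u - c *\<^sub>R u)" using nR[of "A u - c *\<^sub>R u"] RB[OF u] by simp
  moreover have "norm (A u - c *\<^sub>R u) < d * norm u" using contra by simp
  moreover have u0: "norm u > 0" using contra by (cases "u = 0") auto
  ultimately have \<rho>d: "1 < \<rho> * d"
  proof -
    have \<rho>0: "\<rho> > 0"
      using \<open>norm u \<le> \<rho> * _\<close> u0 by (smt (verit) mult_nonpos_nonneg norm_ge_zero)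
    have "norm u < \<rho> * (d * norm u)"
      using \<open>norm u \<le> \<rho> * _\<close> \<open>norm (A u - c *\<^sub>R u) < d * norm u\<close> \<rho>0
      by (meson mult_strict_left_mono order_le_less_trans)
    then show ?thesis using u0 by simp
  qed
  have \<rho>0: "\<rho> > 0" using \<rho>d d by (smt (verit) mult_nonpos_nonneg)
  have inv\<rho>: "1 / \<rho> < d" using \<rho>d \<rho>0 by (simp add: field_simps)
  have below: "\<exists>k>0. \<forall>x. k * norm x \<le> norm (\<rho> *\<^sub>R x - s *\<^sub>R R x)" if s: "s = 1 \<or> s = -1" for s
  proof -
    have "c + s / \<rho> \<in> resolvent_set D A" 
    proof (rule subsetD[OF gap])
      have "1 / \<rho> > 0" using \<rho>0 by simp
      moreover have "s / \<rho> = 1 / \<rho> \<or> s / \<rho> = - (1 / \<rho>)" using s by auto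
      ultimately show "c + s / \<rho> \<in> {c - d<..<c + d}"
        using inv\<rho> unfolding greaterThanLessThan_iff by linarith
    qed
    then obtain \<delta> where \<delta>: "\<delta> > 0" "\<And>u. u \<in> D \<Longrightarrow> \<delta> * norm u \<le> norm (A u - (c + s / \<rho>) *\<^sub>R u)"
      using resolvent_set_bounded_below by blast
    have ss: "s * s = 1" "\<bar>s\<bar> = 1" using s by auto
    \<comment> \<open>From \<open>\<parallel>x\<parallel> \<le> (1 + 1 / (\<delta> \<rho>)) \<parallel>z\<parallel>\<close> for \<open>z = x - (s / \<rho>) R x\<close>.\<close>
    define k where "k = \<rho> / (1 + 1 / (\<delta> * \<rho>))"
    have k: "k > 0" using \<rho>0 \<delta>(1) by (simp add: k_def add_pos_pos)
    have "k * norm x \<le> norm (\<rho> *\<^sub>R x - s *\<^sub>R R x)" for x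
    proof -
      define z where "z = x - (s / \<rho>) *\<^sub>R R x"
      have "A (R x) - (c + s / \<rho>) *\<^sub>R R x = (A (R x) - c *\<^sub>R R x) - (s / \<rho>) *\<^sub>R R x"
        by (simp add: algebra_simps)
      also have "\<dots> = z" by (simp add: BR z_def)
      finally have "\<delta> * norm (R x) \<le> norm z" using \<delta>(2)[OF RD[of x]] by simp
      then have "norm (R x) \<le> norm z / \<delta>" using \<delta>(1) by (simp add: field_simps)
      moreover have "norm x \<le> norm z + norm ((s / \<rho>) *\<^sub>R R x)"
        unfolding z_def by (metis norm_triangle_sub add.commute)
      moreover have "norm ((s / \<rho>) *\<^sub>R R x) = norm (R x) / \<rho>" using \<rho>0 ss by simp
      ultimately have "norm x \<le> norm z + (norm z / \<delta>) / \<rho>"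
        using \<rho>0 by (smt (verit) divide_right_mono)
      also have "\<dots> = (1 + 1 / (\<delta> * \<rho>)) * norm z" by (simp add: field_simps)
      finally have "k * norm x \<le> k * ((1 + 1 / (\<delta> * \<rho>)) * norm z)"
        using k by (intro mult_left_mono) auto
      also have "\<dots> = \<rho> * norm z" 
      proof -
        have "1 + 1 / (\<delta> * \<rho>) > 0" using \<delta>(1) \<rho>0 by (simp add: add_pos_pos)
        then show ?thesis by (simp add: k_def)
      qed
      also have "\<dots> = norm (\<rho> *\<^sub>R z)" using \<rho>0 by simp
      also have "\<rho> *\<^sub>R z = \<rho> *\<^sub>R x - s *\<^sub>R R x" using \<rho>0 by (simp add: z_def algebra_simps)
      finally show ?thesis .
    qed
    then show ?thesis using k by blast
  qed
  obtain k1 k2 where k1: "k1 > 0" "\<And>x. k1 * norm x \<le> norm (\<rho> *\<^sub>R x - R x)"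
    and k2: "k2 > 0" "\<And>x. k2 * norm x \<le> norm (\<rho> *\<^sub>R x + R x)"
    using below[of 1] below[of "-1"] by auto
  define k where "k = k1 * k2"
  have k: "k > 0" using k1 k2 by (simp add: k_def)
  have low: "(k * norm x)\<^sup>2 \<le> \<rho>\<^sup>2 * (\<rho>\<^sup>2 * (norm x)\<^sup>2 - (norm (R x))\<^sup>2)" for x
  proof -
    have "k * norm x = k1 * (k2 * norm x)" by (simp add: k_def)
    also have "\<dots> \<le> k1 * norm (\<rho> *\<^sub>R x + R x)" using k1 k2(2)[of x] by (intro mult_left_mono) auto
    also have "\<dots> \<le> norm (\<rho> *\<^sub>R (\<rho> *\<^sub>R x + R x) - R (\<rho> *\<^sub>R x + R x))" by (rule k1)
    also have "\<rho> *\<^sub>R (\<rho> *\<^sub>R x + R x) - R (\<rho> *\<^sub>R x + R x) = \<rho>\<^sup>2 *\<^sub>R x - R (R x)"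
      by (simp add: R.add R.scaleR algebra_simps power2_eq_square)
    finally have "(k * norm x)\<^sup>2 \<le> (norm (\<rho>\<^sup>2 *\<^sub>R x - R (R x)))\<^sup>2"
      using k by (intro power_mono) auto
    also have "\<dots> = \<rho>^4 * (norm x)\<^sup>2 - 2 * \<rho>\<^sup>2 * (norm (R x))\<^sup>2 + (norm (R (R x)))\<^sup>2"
      using symR[of x "R x"] unfolding norm_diff_squared
      by (simp add: power_mult_distrib power2_norm_eq_inner[of "R x"] flip: power_mult)
    also have "(norm (R (R x)))\<^sup>2 \<le> (\<rho> * norm (R x))\<^sup>2" by (intro power_mono nR) auto
    finally show ?thesis by (simp add: power_mult_distrib algebra_simps power2_eq_square power4_eq_xxxx)
  qed
  have "norm (R x) \<le> sqrt (\<rho>\<^sup>2 - k\<^sup>2 / \<rho>\<^sup>2) * norm x" for x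
  proof -
    have "(norm (R x))\<^sup>2 \<le> (\<rho>\<^sup>2 - k\<^sup>2 / \<rho>\<^sup>2) * (norm x)\<^sup>2"
      using low[of x] \<rho>0 by (simp add: field_simps power_mult_distrib)
    then have "sqrt ((norm (R x))\<^sup>2) \<le> sqrt ((\<rho>\<^sup>2 - k\<^sup>2 / \<rho>\<^sup>2) * (norm x)\<^sup>2)"
      by (rule real_sqrt_le_mono)
    then show ?thesis by (simp add: real_sqrt_mult)
  qed
  moreover from this[of u] have "0 \<le> sqrt (\<rho>\<^sup>2 - k\<^sup>2 / \<rho>\<^sup>2)"
    using u0 norm_ge_zero[of "R u"] by (meson mult_le_cancel_right1 order.trans zero_le_mult_iff not_less)
  ultimately have "onorm R \<le> sqrt (\<rho>\<^sup>2 - k\<^sup>2 / \<rho>\<^sup>2)" by (intro onorm_bound)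
  then have "\<rho> \<le> sqrt (\<rho>\<^sup>2 - k\<^sup>2 / \<rho>\<^sup>2)" by (simp add: \<rho>_def)
  also have "\<dots> < sqrt (\<rho>\<^sup>2)" using k \<rho>0 by (intro real_sqrt_less_mono) simp
  finally show False using \<rho>0 by simp
qed

end


section \<open>Eigenspace decomposition for a discrete spectrum\<close>

text \<open>
  The sequence \<open>e\<close> may also take values outside the spectrum; at these the eigenspace is trivial and the
  projection vanishes. This treats finite and infinite spectra alike. With \<open>e 0 = 0\<close>, the
  nonnegativity of \<open>A\<close> is the start of the induction over the eigenspaces.
\<close>

locale discrete_operator = self_adjoint +
  fixes e :: "nat \<Rightarrow> real"
  assumes nonnegative: "nonnegative_operator D A"
    and e_mono: "strict_mono e" and e_0: "e 0 = 0" and e_top: "filterlim e at_top sequentially"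
    and spectrum_e: "spectrum D A \<subseteq> range e"
begin

definition eigenspace :: "nat \<Rightarrow> 'a set" where
  "eigenspace n = {x \<in> D. A x = e n *\<^sub>R x}"

definition P :: "nat \<Rightarrow> 'a \<Rightarrow> 'a" where
  "P n = orthogonal_projection (eigenspace n)"

lemma e_nonneg: "e n \<ge> 0"
  using strict_mono_mono[OF e_mono, THEN monoD, of 0 n] e_0 by simp

lemma subspace_eigenspace: "subspace (eigenspace n)"
  unfolding eigenspace_def
  by (rule subspaceI)
    (auto simp: A_zero A_add A_scale algebra_simps subspace_0[OF subspace_D]
      intro: subspace_add[OF subspace_D] subspace_scale[OF subspace_D])

lemma closed_eigenspace: "closed (eigenspace n)"
  unfolding closed_sequential_limits
proof (intro allI impI)
  fix x l assume x: "(\<forall>k. x k \<in> eigenspace n) \<and> x \<longlonglongrightarrow> l"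
  then have "(\<lambda>k. e n *\<^sub>R x k) \<longlonglongrightarrow> e n *\<^sub>R l" by (intro tendsto_intros) auto
  then have "(\<lambda>k. A (x k)) \<longlonglongrightarrow> e n *\<^sub>R l" using x by (simp add: eigenspace_def)
  then show "l \<in> eigenspace n"
    using closed_graph[of x l "e n *\<^sub>R l"] x by (auto simp: eigenspace_def)
qed

lemma bounded_linear_P: "bounded_linear (P n)"
  and P_in_eigenspace: "P n x \<in> eigenspace n"
  and P_symmetric: "P n x \<bullet> y = x \<bullet> P n y"
  and P_fixes: "x \<in> eigenspace n \<Longrightarrow> P n x = x"
  unfolding P_def
  by (rule bounded_linear_orthogonal_projection orthogonal_projection_in
    orthogonal_projection_symmetric orthogonal_projection_fixes,
    (rule subspace_eigenspace closed_eigenspace | assumption)+)+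

lemma P_in_D: "P n x \<in> D" and A_P: "A (P n x) = e n *\<^sub>R P n x"
  using P_in_eigenspace[of n x] by (auto simp: eigenspace_def)

lemma e_inj: "e m = e n \<longleftrightarrow> m = n"
  using e_mono by (simp add: strict_mono_eq)

lemma e_le_iff: "e m \<le> e n \<longleftrightarrow> m \<le> n"
  using e_mono by (simp add: strict_mono_less_eq)

lemma P_P: "P m (P n x) = (if m = n then P n x else 0)"
proof (cases "m = n")
  case False
  have "P n x \<bullet> y = 0" if y: "y \<in> eigenspace m" for y
  proof -
    have "e n * (P n x \<bullet> y) = e m * (P n x \<bullet> y)"
      using A_symmetric[OF P_in_D, of y n x] y by (simp add: eigenspace_def A_P)
    then show ?thesis using False e_inj by auto
  qed
  then have "P m (P n x) = 0"
    unfolding P_def[of m]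
    by (intro orthogonal_projection_eqI subspace_eigenspace closed_eigenspace)
      (auto intro: subspace_0[OF subspace_eigenspace])
  then show ?thesis using False by simp
qed (simp add: P_fixes P_in_eigenspace)

lemma P_A: "x \<in> D \<Longrightarrow> P n (A x) = e n *\<^sub>R P n x"
proof -
  assume x: "x \<in> D"
  have "P n (A x) \<bullet> y = (e n *\<^sub>R P n x) \<bullet> y" for y
    using A_symmetric[OF x P_in_D, of n y] by (simp add: P_symmetric A_P)
  then show ?thesis by (metis vector_eq_rdot)
qed

text \<open>
  Working with \<open>R = (A + 1)\<^sup>-\<^sup>1\<close> avoids the domain of \<open>A\<close>; the eigenvalues of \<open>R\<close> are the \<open>r n\<close>
  below, which decrease to \<open>0\<close>.
\<close>

definition R :: "'a \<Rightarrow> 'a" where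
  "R = (SOME R. bounded_linear R \<and> (\<forall>u\<in>D. R (A u + u) = u) \<and> (\<forall>v. R v \<in> D \<and> A (R v) + R v = v))"

lemma bounded_linear_R: "bounded_linear R" and R_left: "u \<in> D \<Longrightarrow> R (A u + u) = u"
  and R_in_D: "R v \<in> D" and R_right: "A (R v) = v - R v"
proof -
  have "-1 \<in> resolvent_set D A"
  proof (rule bounded_below_imp_resolvent[of 1])
    fix u assume u: "u \<in> D"
    have "norm u * norm u \<le> (A u - (- 1) *\<^sub>R u) \<bullet> u"
      using nonnegative u by (simp add: nonnegative_operator_def inner_add_left dot_square_norm power2_eq_square)
    also have "\<dots> \<le> norm (A u - (- 1) *\<^sub>R u) * norm u" by (rule norm_cauchy_schwarz)
    finally show "1 * norm u \<le> norm (A u - (- 1) *\<^sub>R u)"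
      by (cases "u = 0") auto
  qed simp
  then have "\<exists>R. bounded_linear R \<and> (\<forall>u\<in>D. R (A u + u) = u) \<and> (\<forall>v. R v \<in> D \<and> A (R v) + R v = v)"
    unfolding resolvent_set_def by simp
  from someI_ex[OF this, folded R_def]
  show "bounded_linear R" "u \<in> D \<Longrightarrow> R (A u + u) = u" "R v \<in> D" "A (R v) = v - R v"
    by (auto simp: eq_diff_eq)
qed

interpretation R: bounded_linear R by (rule bounded_linear_R)
sublocale P: bounded_linear "P n" for n by (rule bounded_linear_P)

lemma R_symmetric: "R x \<bullet> y = x \<bullet> R y"
  using A_symmetric[OF R_in_D R_in_D, of x y] by (simp add: R_right inner_diff_left inner_diff_right)

lemma R_nonneg: "R x \<bullet> x \<ge> (norm (R x))\<^sup>2"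
proof -
  have "0 \<le> A (R x) \<bullet> R x" using nonnegative R_in_D[of x] by (simp add: nonnegative_operator_def)
  then show ?thesis
    by (simp add: R_right inner_diff_left power2_norm_eq_inner inner_commute[of x "R x"])
qed

definition r :: "nat \<Rightarrow> real" where "r n = 1 / (1 + e n)"

lemma r_pos: "r n > 0" using e_nonneg[of n] by (simp add: r_def)

lemma r_decreasing: "r (Suc n) < r n"
  using e_nonneg[of n] e_mono by (simp add: r_def strict_mono_Suc_iff frac_less2)

lemma R_P: "R (P n x) = r n *\<^sub>R P n x"
proof -
  have "P n x = R (A (P n x) + P n x)" by (rule R_left[OF P_in_D, symmetric])
  also have "A (P n x) + P n x = (1 + e n) *\<^sub>R P n x" by (simp add: A_P algebra_simps)
  finally have "P n x = (1 + e n) *\<^sub>R R (P n x)" unfolding R.scaleR .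
  then have "r n *\<^sub>R P n x = r n *\<^sub>R ((1 + e n) *\<^sub>R R (P n x))" by (rule arg_cong)
  then show ?thesis using e_nonneg[of n] by (simp add: r_def)
qed

lemma P_R: "P n (R x) = r n *\<^sub>R P n x"
proof -
  have "P n (R x) \<bullet> y = (r n *\<^sub>R P n x) \<bullet> y" for y
    by (simp add: P_symmetric R_symmetric R_P)
  then show ?thesis by (metis vector_eq_rdot)
qed

lemma eigenspace_via_R: "R x = r n *\<^sub>R x \<Longrightarrow> x \<in> eigenspace n"
proof -
  assume *: "R x = r n *\<^sub>R x"
  have x: "x = (1 + e n) *\<^sub>R R x" using e_nonneg[of n] by (simp add: * r_def)
  have xD: "x \<in> D" by (subst x) (intro subspace_scale[OF subspace_D] R_in_D)
  have "A x = (1 + e n) *\<^sub>R A (R x)" by (subst x) (simp only: A_scale R_in_D)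
  also have "\<dots> = (1 + e n) *\<^sub>R x - x" unfolding R_right scaleR_diff_right using x by simp
  finally show ?thesis using xD by (simp add: eigenspace_def algebra_simps)
qed

text \<open>
  The lower bound at the midpoint \<open>c\<close> of the gap \<open>(e n, e (n + 1))\<close> says that
  \<open>\<langle>(A - e n) u, (A - e (n + 1)) u\<rangle> \<ge> 0\<close> once squared; the claim is the case \<open>u = R x\<close>.
\<close>

lemma gap_R: "(r n *\<^sub>R x - R x) \<bullet> (r (Suc n) *\<^sub>R x - R x) \<ge> 0"
proof -
  define c where "c = (e n + e (Suc n)) / 2"
  define d where "d = (e (Suc n) - e n) / 2"
  define u where "u = R x"
  have lt: "e n < e (Suc n)" using e_mono by (simp add: strict_mono_Suc_iff)
  have "{c - d <..< c + d} \<subseteq> resolvent_set D A"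
  proof -
    have "e k \<notin> {c - d <..< c + d}" for k
    proof -
      have "k \<le> n \<or> Suc n \<le> k" by auto
      then have "e k \<le> e n \<or> e (Suc n) \<le> e k"
        using strict_mono_mono[OF e_mono] by (auto dest: monoD)
      then show ?thesis by (auto simp: c_def d_def field_simps)
    qed
    then show ?thesis using spectrum_e unfolding spectrum_def by blast
  qed
  then have "d * norm u \<le> norm (A u - c *\<^sub>R u)"
    using lt by (intro gap_imp_bounded_below) (auto simp: d_def u_def R_in_D)
  then have "(d * norm u)\<^sup>2 \<le> (norm (A u - c *\<^sub>R u))\<^sup>2"
    using lt by (intro power_mono) (auto simp: d_def)
  then have "0 \<le> (norm (A u))\<^sup>2 - 2 * c * (A u \<bullet> u) + (c\<^sup>2 - d\<^sup>2) * (norm u)\<^sup>2"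
    by (simp add: norm_diff_squared power_mult_distrib algebra_simps)
  also have "c\<^sup>2 - d\<^sup>2 = e n * e (Suc n)" by (simp add: c_def d_def power2_eq_square field_simps)
  also have "(norm (A u))\<^sup>2 - 2 * c * (A u \<bullet> u) + e n * e (Suc n) * (norm u)\<^sup>2
      = (A u - e n *\<^sub>R u) \<bullet> (A u - e (Suc n) *\<^sub>R u)"
    by (simp add: c_def power2_norm_eq_inner inner_diff_left inner_diff_right inner_commute
        algebra_simps add_divide_distrib)
  finally have "0 \<le> (A u - e n *\<^sub>R u) \<bullet> (A u - e (Suc n) *\<^sub>R u)" .
  moreover have "A u - e k *\<^sub>R u = (1 + e k) *\<^sub>R (r k *\<^sub>R x - R x)" for k
    using e_nonneg[of k] by (simp add: u_def R_right r_def algebra_simps)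
  ultimately have "0 \<le> ((1 + e n) * (1 + e (Suc n))) * ((r n *\<^sub>R x - R x) \<bullet> (r (Suc n) *\<^sub>R x - R x))"
    by (simp only: inner_scaleR_left inner_scaleR_right mult_ac)
  moreover have "(1 + e n) * (1 + e (Suc n)) > 0"
    using e_nonneg[of n] e_nonneg[of "Suc n"] by (intro mult_pos_pos) auto
  ultimately show ?thesis by (simp add: zero_le_mult_iff)
qed

text \<open>
  Going up one gap: on the orthogonal complement of the first \<open>n\<close> eigenspaces the operator
  \<open>S = r\<^sub>n - R\<close> is nonnegative and satisfies \<open>\<parallel>S z\<parallel>\<^sup>2 \<ge> d \<langle>S z, z\<rangle>\<close> by the spectral gap. The
  Cauchy-Schwarz inequality for the form \<open>\<langle>S x, y\<rangle>\<close> turns this into \<open>\<langle>S x, x\<rangle> \<ge> d \<parallel>x\<parallel>\<^sup>2\<close> for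
  \<open>x\<close> in the closed range of \<open>S\<close>, the complement of the next eigenspace.
\<close>

lemma R_le_on_complement:
  assumes "\<And>i. i < n \<Longrightarrow> P i x = 0"
  shows "R x \<bullet> x \<le> r n * (norm x)\<^sup>2"
  using assms
proof (induction n arbitrary: x)
  case 0
  have "(norm (R x))\<^sup>2 \<le> norm (R x) * norm x" using R_nonneg[of x] norm_cauchy_schwarz[of "R x" x] by simp
  then have "norm (R x) \<le> norm x" by (cases "R x = 0") (auto simp: power2_eq_square)
  then have "norm (R x) * norm x \<le> (norm x)\<^sup>2" by (simp add: power2_eq_square mult_right_mono)
  then show ?case using norm_cauchy_schwarz[of "R x" x] by (simp add: r_def e_0)
next
  case (Suc n)
  define N where "N = {x. \<forall>i<n. P i x = 0}"
  define S where "S x = r n *\<^sub>R x - R x" for x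
  define d where "d = r n - r (Suc n)"
  have d: "d > 0" using r_decreasing by (simp add: d_def)
  have blS: "bounded_linear S" unfolding S_def
    by (intro bounded_linear_intros bounded_linear_R)
  interpret S: bounded_linear S by fact
  have subN: "subspace N" unfolding N_def by (rule subspaceI) (auto simp: P.add P.scaleR P.zero)
  have symS: "S x \<bullet> y = x \<bullet> S y" for x y
    by (simp add: S_def inner_diff_left inner_diff_right R_symmetric)
  have SN: "S x \<in> N" if "x \<in> N" for x
    using that by (simp add: N_def S_def P.diff P.scaleR P_R)
  have posS: "S x \<bullet> x \<ge> 0" if "x \<in> N" for x
    using Suc.IH[of x] that by (simp add: N_def S_def inner_diff_left power2_norm_eq_inner)
  have gapS: "d * (S x \<bullet> x) \<le> (norm (S x))\<^sup>2" for x
  proof -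
    have "r (Suc n) *\<^sub>R x - R x = S x - d *\<^sub>R x" by (simp add: S_def d_def algebra_simps)
    with gap_R[of n x] show ?thesis
      by (simp add: S_def[symmetric] inner_diff_right power2_norm_eq_inner)
  qed
  \<comment> \<open>The Cauchy-Schwarz inequality for the form \<open>\<langle>S x, y\<rangle>\<close>, which is nonnegative on \<open>N\<close> only.\<close>
  have CS: "(S x \<bullet> y)\<^sup>2 \<le> (S x \<bullet> x) * (S y \<bullet> y)" if x: "x \<in> N" and y: "y \<in> N" for x y
  proof (cases "S y \<bullet> y = 0")
    case False
    then have pos: "S y \<bullet> y > 0" using posS[OF y] by simp
    define t where "t = (S x \<bullet> y) / (S y \<bullet> y)"
    have "x - t *\<^sub>R y \<in> N" using x y subN by (intro subspace_diff subspace_scale)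
    then have "0 \<le> S (x - t *\<^sub>R y) \<bullet> (x - t *\<^sub>R y)" by (rule posS)
    also have "\<dots> = S x \<bullet> x - 2 * t * (S x \<bullet> y) + t * t * (S y \<bullet> y)"
      using symS[of y x] by (simp add: S.diff S.scaleR inner_diff_left inner_diff_right inner_commute algebra_simps)
    also have "\<dots> = S x \<bullet> x - (S x \<bullet> y)\<^sup>2 / (S y \<bullet> y)"
      using pos by (simp add: t_def power2_eq_square field_simps)
    finally show ?thesis using pos by (simp add: field_simps)
  next
    case True
    then have "S y = 0"
    proof -
      have "0 \<le> S (S y - t *\<^sub>R y) \<bullet> (S y - t *\<^sub>R y)" for t
        using y subN SN by (intro posS subspace_diff subspace_scale) auto
      moreover have "S (S y - t *\<^sub>R y) \<bullet> (S y - t *\<^sub>R y) = S (S y) \<bullet> S y - 2 * t * (norm (S y))\<^sup>2" for t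
        using True symS[of "S y" y]
        by (simp add: S.diff S.scaleR inner_diff_left inner_diff_right power2_norm_eq_inner algebra_simps)
      ultimately have "0 \<le> S (S y) \<bullet> S y - 2 * t * (norm (S y))\<^sup>2" for t by metis
      from this[of "(S (S y) \<bullet> S y + 1) / (2 * (norm (S y))\<^sup>2)"] show ?thesis
        by (cases "S y = 0") auto
    qed
    then show ?thesis using symS[of x y] by simp
  qed
  have onrange: "d * (norm x)\<^sup>2 \<le> S x \<bullet> x" if "x \<in> S ` N" for x
  proof -
    obtain z where z: "z \<in> N" "x = S z" using \<open>x \<in> S ` N\<close> by blast
    have "(norm x)\<^sup>2 * (d * (norm x)\<^sup>2) = d * (S z \<bullet> x)\<^sup>2"
      using z by (simp add: power2_norm_eq_inner power2_eq_square[of "S z \<bullet> S z"])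
    also have "\<dots> \<le> d * ((S z \<bullet> z) * (S x \<bullet> x))"
      using CS[of z x] z SN d by (intro mult_left_mono) auto
    also have "\<dots> \<le> (norm x)\<^sup>2 * (S x \<bullet> x)"
      using mult_right_mono[OF gapS[of z] posS[OF SN[OF z(1)]]] z(2) by (simp add: mult.assoc)
    finally have "(norm x)\<^sup>2 * (d * (norm x)\<^sup>2) \<le> (norm x)\<^sup>2 * (S x \<bullet> x)" .
    then show ?thesis by (cases "x = 0") auto
  qed
  have onclosure: "d * (norm x)\<^sup>2 \<le> S x \<bullet> x" if "x \<in> closure (S ` N)" for x
  proof -
    have "closed {x. d * (norm x)\<^sup>2 \<le> S x \<bullet> x}"
      by (intro closed_Collect_le continuous_intros S.continuous_on)
    then have "closure (S ` N) \<subseteq> {x. d * (norm x)\<^sup>2 \<le> S x \<bullet> x}"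
      using onrange by (intro closure_minimal) auto
    then show ?thesis using that by blast
  qed
  have closed_N: "closed N"
    unfolding N_def
    by (intro closed_Collect_all closed_Collect_imp closed_Collect_eq continuous_intros P.continuous_on)
      auto
  define C where "C = closure (S ` N)"
  have "subspace (S ` N)" by (intro linear_subspace_image S.linear subN)
  then have C: "subspace C" "closed C" by (auto simp: C_def intro: subspace_closure)
  have CN: "C \<subseteq> N" unfolding C_def using SN closed_N by (intro closure_minimal) auto
  \<comment> \<open>The part \<open>x''\<close> of \<open>x\<close> orthogonal to the range of \<open>S\<close> lies in the kernel of \<open>S\<close>, the eigenspace
    for \<open>e n\<close>; but \<open>x\<close> is orthogonal to that eigenspace.\<close>
  define x' where "x' = orthogonal_projection C x"
  define x'' where "x'' = x - x'"
  have xN: "x \<in> N" using Suc.prems by (auto simp: N_def)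
  have x'C: "x' \<in> C" unfolding x'_def by (rule orthogonal_projection_in[OF C])
  have x''N: "x'' \<in> N" using xN x'C CN subN unfolding x''_def by (blast intro: subspace_diff)
  have orth: "x'' \<bullet> z = 0" if "z \<in> C" for z
    using orthogonal_projection_orthogonal[OF C that, of x] by (simp add: x''_def x'_def)
  have "x'' \<bullet> S (S x'') = 0" 
  proof (rule orth)
    show "S (S x'') \<in> C" unfolding C_def using SN[OF x''N] by (intro subsetD[OF closure_subset] imageI)
  qed
  then have "S x'' = 0" using symS[of x'' "S x''"] by simp
  then have "x'' \<in> eigenspace n" by (intro eigenspace_via_R) (simp add: S_def)
  then have "x \<bullet> x'' = 0"
    using Suc.prems[of n] P_symmetric[of n x x''] by (simp add: P_fixes)
  moreover have "x' \<bullet> x'' = 0" using orth[OF x'C] by (simp add: inner_commute)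
  ultimately have "x'' \<bullet> x'' = 0" by (simp add: x''_def inner_diff_left)
  then have "x \<in> C" using x'C by (simp add: x''_def)
  then have "d * (norm x)\<^sup>2 \<le> S x \<bullet> x" using onclosure by (simp add: C_def)
  then show ?case by (simp add: S_def d_def inner_diff_left power2_norm_eq_inner algebra_simps)
qed

text \<open>
  The bound for the form implies one for the norm: expand \<open>\<langle>R w, w\<rangle> \<ge> 0\<close> for \<open>w = R x - r\<^sub>n x\<close>, and use
  that \<open>R x\<close> is orthogonal to the first eigenspaces as well.
\<close>

lemma norm_R_le_on_complement:
  assumes "\<And>i. i < n \<Longrightarrow> P i x = 0"
  shows "norm (R x) \<le> r n * norm x"
proof -
  have 1: "R x \<bullet> x \<le> r n * (norm x)\<^sup>2" by (rule R_le_on_complement[OF assms])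
  have 2: "R (R x) \<bullet> R x \<le> r n * (norm (R x))\<^sup>2"
    by (rule R_le_on_complement) (simp add: P_R assms)
  have "0 \<le> R (R x - r n *\<^sub>R x) \<bullet> (R x - r n *\<^sub>R x)"
    using R_nonneg[of "R x - r n *\<^sub>R x"] by (meson order.trans zero_le_power2)
  also have "\<dots> = R (R x) \<bullet> R x - 2 * r n * (norm (R x))\<^sup>2 + (r n)\<^sup>2 * (R x \<bullet> x)"
    using R_symmetric[of "R x" x]
    by (simp add: R.diff R.scaleR inner_diff_left inner_diff_right power2_norm_eq_inner[of "R x"]
        algebra_simps power2_eq_square[of "r n"])
  also have "\<dots> \<le> r n * (norm (R x))\<^sup>2 - 2 * r n * (norm (R x))\<^sup>2 + (r n)\<^sup>2 * (r n * (norm x)\<^sup>2)"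
    using 1 2 by (intro add_mono diff_right_mono mult_left_mono) auto
  finally have "r n * (norm (R x))\<^sup>2 \<le> r n * (r n * norm x)\<^sup>2"
    by (simp add: power_mult_distrib power2_eq_square algebra_simps)
  then have "(norm (R x))\<^sup>2 \<le> (r n * norm x)\<^sup>2" using r_pos[of n] by simp
  then show ?thesis by (rule power2_le_imp_le) (use r_pos[of n] in simp)
qed

text \<open>
  For \<open>x = R z\<close> the remainder after \<open>n\<close> terms is \<open>R\<close> applied to a vector of norm at most \<open>\<parallel>z\<parallel>\<close>
  orthogonal to the first \<open>n\<close> eigenspaces, hence at most \<open>r\<^sub>n \<parallel>z\<parallel>\<close>. Such \<open>x\<close> fill the dense
  domain \<open>D\<close>, and the remainders depend on \<open>x\<close> contractively.
\<close>

lemma P_sums: "(\<lambda>n. P n x) sums x"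
proof -
  define Q where "Q n x = (\<Sum>i<n. P i x)" for n x
  have PQ: "P i (x - Q n x) = 0" if "i < n" for i n x
  proof -
    have "P i (Q n x) = (\<Sum>j<n. if i = j then P j x else 0)"
      by (simp add: Q_def P.sum P_P)
    also have "\<dots> = P i x" using that by simp
    finally show ?thesis by (simp add: P.diff)
  qed
  have contr: "norm (x - Q n x) \<le> norm x" for n x
  proof -
    have "(x - Q n x) \<bullet> Q n x = (\<Sum>i<n. P i (x - Q n x) \<bullet> x)"
      by (simp add: Q_def inner_sum_right P_symmetric)
    also have "\<dots> = 0" by (simp add: PQ)
    finally have "x \<bullet> Q n x = (norm (Q n x))\<^sup>2"
      unfolding inner_diff_left power2_norm_eq_inner by linarith
    then have "(norm (x - Q n x))\<^sup>2 = (norm x)\<^sup>2 - (norm (Q n x))\<^sup>2"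
      unfolding norm_diff_squared by linarith
    then have "(norm (x - Q n x))\<^sup>2 \<le> (norm x)\<^sup>2" using zero_le_power2[of "norm (Q n x)"] by linarith
    then show ?thesis by (rule power2_le_imp_le) simp
  qed
  have r_lim: "r \<longlonglongrightarrow> 0"
    unfolding r_def
    by (intro real_tendsto_divide_at_top[OF tendsto_const] filterlim_tendsto_add_at_top[OF tendsto_const e_top])
  have limD: "(\<lambda>n. x - Q n x) \<longlonglongrightarrow> 0" if "x \<in> D" for x
  proof -
    define z where "z = A x + x"
    have xz: "x = R z" using R_left[OF that] by (simp add: z_def)
    have le: "norm (x - Q n x) \<le> r n * norm z" for n
    proof -
      have "x - Q n x = R (z - Q n z)" by (simp add: xz Q_def P_R R_P R.diff R.sum)
      also have "norm \<dots> \<le> r n * norm (z - Q n z)" by (rule norm_R_le_on_complement) (rule PQ)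
      also have "\<dots> \<le> r n * norm z" using contr r_pos[of n] by (intro mult_left_mono) auto
      finally show ?thesis .
    qed
    have "(\<lambda>n. r n * norm z) \<longlonglongrightarrow> 0" by (rule tendsto_mult_left_zero[OF r_lim])
    then show ?thesis by (rule Lim_null_comparison[OF always_eventually[OF allI[OF le]]])
  qed
  have "(\<lambda>n. x - Q n x) \<longlonglongrightarrow> 0"
  proof (rule LIMSEQ_I)
    fix \<epsilon> :: real assume \<epsilon>: "\<epsilon> > 0"
    have "x \<in> closure D" using closure_D by simp
    then obtain w where w: "w \<in> D" "dist w x < \<epsilon> / 2"
      unfolding closure_approachable using \<epsilon> by (meson half_gt_zero)
    obtain n0 where n0: "\<And>n. n \<ge> n0 \<Longrightarrow> norm (w - Q n w) < \<epsilon> / 2"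
      using LIMSEQ_D[OF limD[OF w(1)], of "\<epsilon> / 2"] \<epsilon> by auto
    have "norm (x - Q n x - 0) < \<epsilon>" if "n \<ge> n0" for n
    proof -
      have "x - Q n x = ((x - w) - Q n (x - w)) + (w - Q n w)"
        by (simp add: Q_def P.diff sum_subtractf)
      then have "norm (x - Q n x) \<le> norm ((x - w) - Q n (x - w)) + norm (w - Q n w)"
        by (metis norm_triangle_ineq)
      moreover have "norm ((x - w) - Q n (x - w)) < \<epsilon> / 2"
        using contr[of "x - w" n] w(2) by (simp add: dist_norm norm_minus_commute)
      ultimately show ?thesis using n0[OF that] by simp
    qed
    then show "\<exists>no. \<forall>n\<ge>no. norm (x - Q n x - 0) < \<epsilon>" by blast
  qed
  then have "(\<lambda>n. x - (x - Q n x)) \<longlonglongrightarrow> x - 0" by (intro tendsto_intros)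
  then show ?thesis by (simp add: sums_def Q_def)
qed

end


section \<open>Projection-valued measures\<close>

locale pvm =
  fixes E :: "real set \<Rightarrow> 'h::real_inner \<Rightarrow> 'h"
  assumes pvm: "projection_valued_measure E"
begin

lemma linear_E: "S \<in> sets borel \<Longrightarrow> linear (E S)"
  and E_idem: "S \<in> sets borel \<Longrightarrow> E S (E S u) = E S u"
  and E_symmetric: "S \<in> sets borel \<Longrightarrow> E S u \<bullet> v = u \<bullet> E S v"
  and E_UNIV: "E UNIV u = u"
  and E_sums: "range F \<subseteq> sets borel \<Longrightarrow> disjoint_family F \<Longrightarrow> (\<lambda>n. E (F n) u) sums E (\<Union>n::nat. F n) u"
  using pvm unfolding projection_valued_measure_def by blast+

lemma E_empty: "E {} u = 0"
proof -
  have "(\<lambda>n::nat. E {} u) sums E (\<Union>n::nat. {}) u"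
    by (rule E_sums) (auto simp: disjoint_family_on_def)
  then show ?thesis using sums_summable summable_const_iff by blast
qed

lemma E_Un:
  assumes "S \<in> sets borel" "T \<in> sets borel" "S \<inter> T = {}"
  shows "E (S \<union> T) u = E S u + E T u"
proof -
  have "(\<lambda>n. E (binaryset S T n) u) sums E (\<Union>n. binaryset S T n) u"
    using assms by (intro E_sums)
      (auto simp: range_binaryset_eq disjoint_family_on_def binaryset_def)
  moreover have "(\<lambda>n. E (binaryset S T n) u) sums (E S u + E T u)"
    by (rule binaryset_sums) (rule E_empty)
  ultimately show ?thesis by (simp add: UN_binaryset_eq sums_unique2)
qed

lemma E_inner_self: "S \<in> sets borel \<Longrightarrow> E S u \<bullet> u = (norm (E S u))\<^sup>2"
  by (metis E_idem E_symmetric power2_norm_eq_inner)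

lemma norm_E_le: "S \<in> sets borel \<Longrightarrow> norm (E S u) \<le> norm u"
proof -
  assume S: "S \<in> sets borel"
  have "norm (E S u) * norm (E S u) \<le> norm (E S u) * norm u"
    using E_inner_self[OF S, of u] norm_cauchy_schwarz[of "E S u" u] by (simp add: power2_eq_square)
  then show ?thesis by (cases "E S u = 0") auto
qed

lemma bounded_linear_E: "S \<in> sets borel \<Longrightarrow> bounded_linear (E S)"
  using norm_E_le linear_E
  by (intro bounded_linear_intro[where K = 1]) (auto simp: linear_add linear_scale)

text \<open>
  For \<open>z\<close> in the range of \<open>E T\<close>, additivity gives \<open>\<parallel>E S z\<parallel>\<^sup>2 + \<parallel>z\<parallel>\<^sup>2 = \<parallel>E (S \<union> T) z\<parallel>\<^sup>2 \<le> \<parallel>z\<parallel>\<^sup>2\<close>.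
\<close>

lemma E_disjoint:
  assumes S: "S \<in> sets borel" and T: "T \<in> sets borel" and "S \<inter> T = {}"
  shows "E S (E T x) = 0"
proof -
  define z where "z = E T x"
  have z: "E T z = z" using E_idem[OF T] by (simp add: z_def)
  have ST: "S \<union> T \<in> sets borel" using S T by auto
  have "E (S \<union> T) z \<bullet> z = E S z \<bullet> z + z \<bullet> z"
    using E_Un[OF assms] z by (simp add: inner_add_left)
  then have "(norm (E S z))\<^sup>2 + (norm z)\<^sup>2 = (norm (E (S \<union> T) z))\<^sup>2"
    using E_inner_self[OF ST] E_inner_self[OF S] by (simp add: power2_norm_eq_inner[of z])
  also have "\<dots> \<le> (norm z)\<^sup>2" using norm_E_le[OF ST] by (intro power_mono) auto
  finally show ?thesis by (simp add: z_def)
qed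

lemma E_Int:
  assumes S: "S \<in> sets borel" and T: "T \<in> sets borel"
  shows "E S (E T x) = E (S \<inter> T) x"
proof -
  have "E S (E T x) = E (S \<inter> T) (E T x) + E (S - T) (E T x)"
    using E_Un[of "S \<inter> T" "S - T" "E T x"] S T by (simp add: Int_Diff_Un Int_Diff_disjoint)
  also have "E (S - T) (E T x) = 0" using S T by (intro E_disjoint) auto
  also have "E (S \<inter> T) (E T x) = E (S \<inter> T) x"
  proof -
    have "x = E T x + E (- T) x" using E_Un[of T "- T" x] T E_UNIV by simp
    then have "E (S \<inter> T) x = E (S \<inter> T) (E T x) + E (S \<inter> T) (E (- T) x)"
      using linear_add[OF linear_E, of "S \<inter> T" "E T x" "E (- T) x"] S T by simp
    also have "E (S \<inter> T) (E (- T) x) = 0" using S T by (intro E_disjoint) auto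
    finally show ?thesis by simp
  qed
  finally show ?thesis by simp
qed

subsection \<open>The scalar spectral measures\<close>

lemma sets_spectral_measure [measurable_cong, simp]: "sets (spectral_measure E u) = sets borel"
  and space_spectral_measure [simp]: "space (spectral_measure E u) = UNIV"
  unfolding spectral_measure_def
  using sets.sigma_sets_eq[of "borel :: real measure"] by (simp_all add: sets_measure_of_conv space_measure_of_conv)

lemma emeasure_spectral_measure:
  assumes "S \<in> sets borel"
  shows "emeasure (spectral_measure E u) S = ennreal (E S u \<bullet> u)"
proof (rule emeasure_measure_of[OF spectral_measure_def])
  show "positive (sets (spectral_measure E u)) (\<lambda>S. ennreal (E S u \<bullet> u))"
    by (simp add: positive_def E_empty)
  show "countably_additive (sets (spectral_measure E u)) (\<lambda>S. ennreal (E S u \<bullet> u))"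
  proof (rule countably_additiveI)
    fix F :: "nat \<Rightarrow> real set"
    assume F: "range F \<subseteq> sets (spectral_measure E u)" "disjoint_family F"
    then have "(\<lambda>n. E (F n) u) sums E (\<Union>n. F n) u" by (intro E_sums) auto
    then have s: "(\<lambda>n. E (F n) u \<bullet> u) sums (E (\<Union>n. F n) u \<bullet> u)"
      by (rule bounded_linear.sums[OF bounded_linear_inner_left])
    have "E (F n) u \<bullet> u \<ge> 0" for n using E_inner_self[of "F n" u] F by auto
    then show "(\<Sum>n. ennreal (E (F n) u \<bullet> u)) = ennreal (E (\<Union>n. F n) u \<bullet> u)"
      using s by (simp add: suminf_ennreal2 sums_summable sums_unique[symmetric])
  qed
qed (use assms in auto)

lemma finite_measure_spectral_measure: "finite_measure (spectral_measure E u)"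
  by (rule finite_measureI) (simp add: emeasure_spectral_measure)

lemma measure_spectral_measure:
  "S \<in> sets borel \<Longrightarrow> measure (spectral_measure E u) S = E S u \<bullet> u"
  by (simp add: measure_def emeasure_spectral_measure E_inner_self)

text \<open>
  The vectors that test a spectral integral on a set \<open>B\<close> are combinations of \<open>E B v\<close> and
  \<open>E (- B) v\<close>; their spectral measures have a density with respect to that of \<open>v\<close>.
\<close>

lemma spectral_measure_split:
  assumes B: "B \<in> sets borel"
  shows "spectral_measure E (a *\<^sub>R E B v + b *\<^sub>R E (- B) v)
    = density (spectral_measure E v) (\<lambda>t. ennreal (a\<^sup>2 * indicator B t + b\<^sup>2 * indicator (- B) t))"
    (is "spectral_measure E ?x = density ?M ?g")
proof (rule measure_eqI)
  fix S assume "S \<in> sets (spectral_measure E ?x)"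
  then have S: "S \<in> sets borel" by simp
  have "E S ?x = a *\<^sub>R E (S \<inter> B) v + b *\<^sub>R E (S \<inter> - B) v"
    using linear_E[OF S] E_Int[OF S, of B] E_Int[OF S, of "- B"] B by (simp add: linear_add linear_scale)
  then have "E S ?x \<bullet> E S ?x = a\<^sup>2 * (E (S \<inter> B) v \<bullet> E (S \<inter> B) v) + b\<^sup>2 * (E (S \<inter> - B) v \<bullet> E (S \<inter> - B) v)
      + 2 * a * b * (E (S \<inter> B) v \<bullet> E (S \<inter> - B) v)"
    by (simp add: inner_add_left inner_add_right inner_commute power2_eq_square algebra_simps)
  also have "E (S \<inter> B) v \<bullet> E (S \<inter> - B) v = 0"
  proof -
    have "E (S \<inter> B) v \<bullet> E (S \<inter> - B) v = v \<bullet> E (S \<inter> B) (E (S \<inter> - B) v)"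
      using S B by (intro E_symmetric) auto
    also have "\<dots> = 0" using E_disjoint[of "S \<inter> B" "S \<inter> - B" v] S B by auto
    finally show ?thesis .
  qed
  finally have eq: "E S ?x \<bullet> ?x = a\<^sup>2 * (E (S \<inter> B) v \<bullet> v) + b\<^sup>2 * (E (S \<inter> - B) v \<bullet> v)"
    using S B E_inner_self[of S ?x] E_inner_self[of "S \<inter> B" v] E_inner_self[of "S \<inter> - B" v]
    by (simp add: power2_norm_eq_inner)
  have nn: "0 \<le> E (S \<inter> B) v \<bullet> v" "0 \<le> E (S \<inter> - B) v \<bullet> v"
    using S B E_inner_self[of "S \<inter> B" v] E_inner_self[of "S \<inter> - B" v] by auto
  have "emeasure (density ?M ?g) S = (\<integral>\<^sup>+t. ?g t * indicator S t \<partial>?M)"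
    using S B by (intro emeasure_density) auto
  also have "\<dots> = (\<integral>\<^sup>+t. ennreal (a\<^sup>2) * indicator (S \<inter> B) t + ennreal (b\<^sup>2) * indicator (S \<inter> - B) t \<partial>?M)"
    by (intro nn_integral_cong) (auto split: split_indicator)
  also have "\<dots> = ennreal (a\<^sup>2) * emeasure ?M (S \<inter> B) + ennreal (b\<^sup>2) * emeasure ?M (S \<inter> - B)"
    using S B by (subst nn_integral_add) (auto simp: nn_integral_cmult_indicator)
  also have "\<dots> = ennreal (E S ?x \<bullet> ?x)"
    using S B nn by (simp add: eq emeasure_spectral_measure ennreal_mult'' ennreal_plus)
  finally show "emeasure (spectral_measure E ?x) S = emeasure (density ?M ?g) S"
    using S by (simp add: emeasure_spectral_measure)
qed simp

lemma
  fixes f :: "real \<Rightarrow> real"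
  assumes B: "B \<in> sets borel" and f: "f \<in> borel_measurable borel"
  shows integral_spectral_measure_split:
    "(LINT t|spectral_measure E (a *\<^sub>R E B v + b *\<^sub>R E (- B) v). f t)
      = (LINT t|spectral_measure E v. (a\<^sup>2 * indicator B t + b\<^sup>2 * indicator (- B) t) * f t)" (is ?thesis1)
    and integrable_spectral_measure_split:
    "integrable (spectral_measure E v) f \<Longrightarrow> integrable (spectral_measure E (a *\<^sub>R E B v + b *\<^sub>R E (- B) v)) f"
proof -
  have [measurable]: "B \<in> sets borel" "f \<in> borel_measurable borel" by fact+
  show ?thesis1
    unfolding spectral_measure_split[OF B] by (subst integral_density) auto
  assume i: "integrable (spectral_measure E v) f"
  have "integrable (spectral_measure E v) (\<lambda>t. (a\<^sup>2 * indicator B t + b\<^sup>2 * indicator (- B) t) * f t)"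
  proof (rule Bochner_Integration.integrable_bound[OF integrable_mult_right[OF i, of "max (a\<^sup>2) (b\<^sup>2)"]])
    show "AE t in spectral_measure E v. norm ((a\<^sup>2 * indicator B t + b\<^sup>2 * indicator (- B) t) * f t)
        \<le> norm (max (a\<^sup>2) (b\<^sup>2) * f t)"
      by (intro AE_I2) (auto simp: abs_mult intro!: mult_right_mono split: split_indicator)
  qed measurable
  then show "integrable (spectral_measure E (a *\<^sub>R E B v + b *\<^sub>R E (- B) v)) f"
    unfolding spectral_measure_split[OF B] by (subst integrable_density) auto
qed

subsection \<open>Existence of the spectral integral\<close>

definition simple_integral_op :: "(real \<Rightarrow> real) \<Rightarrow> 'h \<Rightarrow> 'h" where
  "simple_integral_op f u = (\<Sum>c\<in>range f. c *\<^sub>R E (f -` {c}) u)"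

context
  fixes f :: "real \<Rightarrow> real"
  assumes f: "simple_function borel f"
begin

lemma simple_finite: "finite (range f)"
  and simple_vimage: "f -` {c} \<in> sets borel"
  using simple_functionD[OF f] by auto

lemma simple_expand: "f t = (\<Sum>c\<in>range f. c * indicator (f -` {c}) t)"
proof -
  have "(\<Sum>c\<in>range f. c * indicator (f -` {c}) t) = (\<Sum>c\<in>range f. if c = f t then c else 0)"
    by (intro sum.cong) auto
  then show ?thesis using simple_finite by (simp add: sum.delta')
qed

lemma integral_simple: "(LINT t|spectral_measure E u. f t) = (\<Sum>c\<in>range f. c * (E (f -` {c}) u \<bullet> u))"
proof -
  interpret finite_measure "spectral_measure E u" by (rule finite_measure_spectral_measure)
  have "(LINT t|spectral_measure E u. f t)
      = (LINT t|spectral_measure E u. (\<Sum>c\<in>range f. c * indicator (f -` {c}) t))"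
    by (subst (1) simple_expand) (rule refl)
  also have "\<dots> = (\<Sum>c\<in>range f. LINT t|spectral_measure E u. c * indicator (f -` {c}) t)"
    using simple_vimage by (intro Bochner_Integration.integral_sum integrable_mult_right integrable_real_indicator)
      (auto simp: emeasure_spectral_measure)
  also have "\<dots> = (\<Sum>c\<in>range f. c * (E (f -` {c}) u \<bullet> u))"
    using simple_vimage by (simp add: measure_spectral_measure)
  finally show ?thesis .
qed

lemma simple_integral_op_inner:
  "simple_integral_op f u \<bullet> w
    = ((LINT t|spectral_measure E (u + w). f t) - (LINT t|spectral_measure E (u - w). f t)) / 4"
proof -
  have "E S (u + w) \<bullet> (u + w) - E S (u - w) \<bullet> (u - w) = 4 * (E S u \<bullet> w)" if "S \<in> sets borel" for S
    using E_symmetric[OF that, of w u] linear_E[OF that]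
    by (simp add: linear_add linear_diff inner_add_left inner_add_right inner_diff_left
        inner_diff_right inner_commute)
  then have "(\<Sum>c\<in>range f. c * (E (f -` {c}) (u + w) \<bullet> (u + w))) - (\<Sum>c\<in>range f. c * (E (f -` {c}) (u - w) \<bullet> (u - w)))
      = (\<Sum>c\<in>range f. c * (4 * (E (f -` {c}) u \<bullet> w)))"
    using simple_vimage by (simp add: sum_subtractf[symmetric] right_diff_distrib[symmetric])
  then show ?thesis
    unfolding integral_simple simple_integral_op_def
    by (simp add: inner_sum_left sum_divide_distrib)
qed

end

text \<open>
  With \<open>h = f\<close> this is the isometry from \<open>L\<^sup>2\<close> of the spectral measure of \<open>u\<close>, on simple functions.
\<close>

lemma simple_integral_op_inner_simple:
  assumes f: "simple_function borel f" and h: "simple_function borel h"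
  shows "simple_integral_op f u \<bullet> simple_integral_op h u = (LINT t|spectral_measure E u. f t * h t)"
proof -
  interpret finite_measure "spectral_measure E u" by (rule finite_measure_spectral_measure)
  note [measurable] = simple_vimage[OF f] simple_vimage[OF h]
  have *: "E (f -` {c}) u \<bullet> E (h -` {d}) u = E (f -` {c} \<inter> h -` {d}) u \<bullet> u" for c d
  proof -
    have "E (f -` {c}) u \<bullet> E (h -` {d}) u = u \<bullet> E (f -` {c}) (E (h -` {d}) u)"
      by (rule E_symmetric) simp
    also have "\<dots> = u \<bullet> E (f -` {c} \<inter> h -` {d}) u" by (subst E_Int) simp_all
    finally show ?thesis by (simp add: inner_commute)
  qed
  have prod: "f t * h t = (\<Sum>c\<in>range f. \<Sum>d\<in>range h. (c * d) * indicator (f -` {c} \<inter> h -` {d}) t)" for t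
    by (subst simple_expand[OF f], subst simple_expand[OF h])
      (simp add: sum_product indicator_inter_arith mult_ac)
  have int: "integrable (spectral_measure E u) (\<lambda>t. (c * d) * indicator (f -` {c} \<inter> h -` {d}) t)" for c d :: real
    by (intro integrable_mult_right integrable_real_indicator) (auto simp: emeasure_spectral_measure)
  have "(LINT t|spectral_measure E u. f t * h t)
     = (LINT t|spectral_measure E u. (\<Sum>c\<in>range f. \<Sum>d\<in>range h. (c * d) * indicator (f -` {c} \<inter> h -` {d}) t))"
    by (simp only: prod)
  also have "\<dots> = (\<Sum>c\<in>range f. \<Sum>d\<in>range h. LINT t|spectral_measure E u. (c * d) * indicator (f -` {c} \<inter> h -` {d}) t)"
    by (subst Bochner_Integration.integral_sum, intro Bochner_Integration.integrable_sum int,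
        subst Bochner_Integration.integral_sum, rule int, rule refl)
  also have "\<dots> = (\<Sum>c\<in>range f. \<Sum>d\<in>range h. (c * d) * (E (f -` {c} \<inter> h -` {d}) u \<bullet> u))"
    by (simp add: measure_spectral_measure)
  also have "\<dots> = simple_integral_op f u \<bullet> simple_integral_op h u"
    unfolding simple_integral_op_def inner_sum_left
    by (simp add: inner_sum_right * mult_ac)
  finally show ?thesis by simp
qed

end

lemma (in pvm) integrable_of_square:
  assumes "f \<in> borel_measurable borel" "integrable (spectral_measure E u) (\<lambda>t. (f t)\<^sup>2)"
  shows "integrable (spectral_measure E u) (f :: real \<Rightarrow> real)"
proof -
  interpret finite_measure "spectral_measure E u" by (rule finite_measure_spectral_measure)
  note [measurable] = assms(1)
  show ?thesis
  proof (rule Bochner_Integration.integrable_bound)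
    show "integrable (spectral_measure E u) (\<lambda>t. 1 + (f t)\<^sup>2)" using assms by simp
    have "\<bar>x\<bar> \<le> 1 + x\<^sup>2" for x :: real
      using zero_le_power2[of "\<bar>x\<bar> - 1/2"] by (simp add: power2_eq_square algebra_simps)
    then show "AE t in spectral_measure E u. norm (f t) \<le> norm (1 + (f t)\<^sup>2)"
      by (intro AE_I2) (auto simp: abs_of_nonneg)
  qed measurable
qed

locale hilbert_pvm = pvm E for E :: "real set \<Rightarrow> 'h::{real_inner, complete_space} \<Rightarrow> 'h"
begin

text \<open>
  The vector \<open>\<integral> f dE u\<close> is the limit of the corresponding vectors for simple functions, which
  form a Cauchy sequence because \<open>h \<mapsto> \<integral> h dE u\<close> is an isometry from \<open>L\<^sup>2\<close> of the spectral
  measure of \<open>u\<close>.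
\<close>

lemma spectral_integral_exists:
  assumes f: "f \<in> borel_measurable borel"
    and u: "u \<in> spectral_integral_dom E f"
    and sub: "subspace (spectral_integral_dom E f)"
  shows "\<exists>y. \<forall>w\<in>spectral_integral_dom E f.
    y \<bullet> w = ((LINT t|spectral_measure E (u + w). f t) - (LINT t|spectral_measure E (u - w). f t)) / 4"
proof -
  obtain F where F: "\<And>k. simple_function borel (F k)" "\<And>t. (\<lambda>k. F k t) \<longlonglongrightarrow> f t"
    "\<And>k t. dist (F k t) 0 \<le> 2 * dist (f t) 0"
    using borel_measurable_implies_sequence_metric[OF f, of 0] by auto
  note [measurable] = f borel_measurable_simple_function[OF F(1)]
  have Fb: "\<bar>F k t\<bar> \<le> 2 * \<bar>f t\<bar>" for k t using F(3)[of k t] by simp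
  have dom: "integrable (spectral_measure E x) (\<lambda>t. (f t)\<^sup>2)" if "x \<in> spectral_integral_dom E f" for x
    using that by (simp add: spectral_integral_dom_def)
  let ?M = "spectral_measure E u"
  define T where "T k = simple_integral_op (F k) u" for k
  have F2: "(F k t)\<^sup>2 \<le> 4 * (f t)\<^sup>2" for k t
  proof -
    have "\<bar>F k t\<bar>\<^sup>2 \<le> (2 * \<bar>f t\<bar>)\<^sup>2" by (intro power_mono Fb) simp
    then show ?thesis by (simp add: power_mult_distrib)
  qed
  have dF: "(F k t - f t)\<^sup>2 \<le> 10 * (f t)\<^sup>2" for k t
    using F2[of k t] zero_le_power2[of "F k t + f t"] by (simp add: power2_eq_square algebra_simps)
  have i1: "integrable ?M (\<lambda>t. (F k t - f t)\<^sup>2)" for k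
    by (rule Bochner_Integration.integrable_bound[OF integrable_mult_right[OF dom[OF u], of 10]])
      (use dF in auto)
  have i2: "integrable ?M (\<lambda>t. F k t * F l t)" for k l
  proof (rule Bochner_Integration.integrable_bound[OF integrable_mult_right[OF dom[OF u], of 4]])
    have "\<bar>F k t * F l t\<bar> \<le> 4 * (f t)\<^sup>2" for t
    proof -
      have "\<bar>F k t * F l t\<bar> \<le> (2 * \<bar>f t\<bar>) * (2 * \<bar>f t\<bar>)"
        unfolding abs_mult by (intro mult_mono Fb) auto
      then show ?thesis by (simp add: power2_eq_square)
    qed
    then show "AE t in ?M. norm (F k t * F l t) \<le> norm (4 * (f t)\<^sup>2)" by simp
  qed measurable
  define \<epsilon> where "\<epsilon> k = (LINT t|?M. (F k t - f t)\<^sup>2)" for k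
  have "(\<lambda>k. LINT t|?M. (F k t - f t)\<^sup>2) \<longlonglongrightarrow> (LINT t|?M. 0)"
  proof (rule integral_dominated_convergence[where w = "\<lambda>t. 10 * (f t)\<^sup>2"])
    show "integrable ?M (\<lambda>t. 10 * (f t)\<^sup>2)" using dom[OF u] by simp
    have "(\<lambda>k. (F k t - f t)\<^sup>2) \<longlonglongrightarrow> (f t - f t)\<^sup>2" for t by (intro tendsto_intros F(2))
    then show "AE t in ?M. (\<lambda>k. (F k t - f t)\<^sup>2) \<longlonglongrightarrow> 0" by simp
  qed (use dF in auto)
  then have \<epsilon>0: "\<epsilon> \<longlonglongrightarrow> 0" unfolding \<epsilon>_def[abs_def] by simp
  have TT: "(norm (T k - T l))\<^sup>2 \<le> 2 * \<epsilon> k + 2 * \<epsilon> l" for k l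
  proof -
    have "(norm (T k - T l))\<^sup>2 = (LINT t|?M. F k t * F k t) - 2 * (LINT t|?M. F k t * F l t) + (LINT t|?M. F l t * F l t)"
      unfolding norm_diff_squared T_def
      by (simp add: simple_integral_op_inner_simple F(1) power2_norm_eq_inner)
    also have "\<dots> = (LINT t|?M. F k t * F k t - 2 * (F k t * F l t) + F l t * F l t)"
      using i2 by simp
    also have "\<dots> \<le> (LINT t|?M. 2 * (F k t - f t)\<^sup>2 + 2 * (F l t - f t)\<^sup>2)"
    proof (rule integral_mono)
      fix t
      show "F k t * F k t - 2 * (F k t * F l t) + F l t * F l t \<le> 2 * (F k t - f t)\<^sup>2 + 2 * (F l t - f t)\<^sup>2"
        using zero_le_power2[of "F k t + F l t - 2 * f t"] by (simp add: power2_eq_square algebra_simps)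
    qed (use i1 i2 in auto)
    also have "\<dots> = 2 * \<epsilon> k + 2 * \<epsilon> l" using i1 by (simp add: \<epsilon>_def)
    finally show ?thesis .
  qed
  have "Cauchy T"
  proof (rule metric_CauchyI)
    fix \<delta> :: real assume \<delta>: "\<delta> > 0"
    then obtain N where N: "\<And>k. k \<ge> N \<Longrightarrow> \<epsilon> k < \<delta>\<^sup>2 / 4"
      using order_tendstoD(2)[OF \<epsilon>0, of "\<delta>\<^sup>2 / 4"] by (auto simp: eventually_sequentially)
    have "dist (T k) (T l) < \<delta>" if "k \<ge> N" "l \<ge> N" for k l
    proof -
      have "(norm (T k - T l))\<^sup>2 < \<delta>\<^sup>2" using TT[of k l] N[OF that(1)] N[OF that(2)] by linarith
      then show ?thesis using \<delta> by (simp add: dist_norm power2_less_imp_less)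
    qed
    then show "\<exists>N. \<forall>k\<ge>N. \<forall>l\<ge>N. dist (T k) (T l) < \<delta>" by blast
  qed
  then obtain y where y: "T \<longlonglongrightarrow> y" using Cauchy_convergent convergent_def by blast
  have lim: "(\<lambda>k. LINT t|spectral_measure E x. F k t) \<longlonglongrightarrow> (LINT t|spectral_measure E x. f t)"
    if "x \<in> spectral_integral_dom E f" for x
  proof (rule integral_dominated_convergence[where w = "\<lambda>t. 2 * \<bar>f t\<bar>"])
    show "integrable (spectral_measure E x) (\<lambda>t. 2 * \<bar>f t\<bar>)"
      using integrable_of_square[OF f dom[OF that]] by simp
  qed (use F(2) Fb in auto)
  have "y \<bullet> w = ((LINT t|spectral_measure E (u + w). f t) - (LINT t|spectral_measure E (u - w). f t)) / 4"
    if w: "w \<in> spectral_integral_dom E f" for w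
  proof (rule LIMSEQ_unique)
    show "(\<lambda>k. T k \<bullet> w) \<longlonglongrightarrow> y \<bullet> w" by (intro tendsto_intros y)
    show "(\<lambda>k. T k \<bullet> w) \<longlonglongrightarrow>
        ((LINT t|spectral_measure E (u + w). f t) - (LINT t|spectral_measure E (u - w). f t)) / 4"
      unfolding T_def simple_integral_op_inner[OF F(1)]
      using lim[of "u + w"] lim[of "u - w"] subspace_add[OF sub u w] subspace_diff[OF sub u w]
      by (intro tendsto_intros) auto
  qed
  then show ?thesis by blast
qed

end

subsection \<open>Eigenvectors and spectral resolutions\<close>

context self_adjoint
begin

text \<open>
  The description in the definition of the spectral integral is proper: a vector with the required
  inner products exists, and it is unique because \<open>D\<close> is dense.
\<close>

lemma spectral_resolution_inner:
  assumes E: "is_spectral_resolution D A E" and u: "u \<in> D" and w: "w \<in> D"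
  shows "A u \<bullet> w = ((LINT t|spectral_measure E (u + w). t) - (LINT t|spectral_measure E (u - w). t)) / 4"
proof -
  interpret hilbert_pvm E using E by unfold_locales (simp add: is_spectral_resolution_def)
  have dom: "spectral_integral_dom E (\<lambda>t. t) = D"
    and Au: "spectral_integral E (\<lambda>t. t) u = A u"
    using E u by (auto simp: is_spectral_resolution_def)
  let ?Q = "\<lambda>v. \<forall>w\<in>spectral_integral_dom E (\<lambda>t. t).
      v \<bullet> w = ((LINT t|spectral_measure E (u + w). t) - (LINT t|spectral_measure E (u - w). t)) / 4"
  obtain y where y: "?Q y"
    using spectral_integral_exists[of "\<lambda>t. t" u] u dom subspace_D by auto
  have "z = y" if "?Q z" for z
  proof -
    have "x \<bullet> (z - y) = 0" if "x \<in> D" for x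
      using bspec[OF \<open>?Q z\<close>, of x] bspec[OF y, of x] that dom
      by (simp add: inner_diff_right inner_commute[of x])
    then show ?thesis using orthogonal_D_imp_zero[of "z - y"] by simp
  qed
  with y have "?Q (THE v. ?Q v)" by (rule theI[of ?Q])
  moreover have "A u = (THE v. ?Q v)" using Au by (simp only: spectral_integral_def)
  ultimately have "?Q (A u)" by (simp only:)
  then show ?thesis using w unfolding dom by (rule bspec)
qed

text \<open>
  Testing \<open>A v = l v\<close> with \<open>w = E B v\<close> yields that \<open>t - l\<close> has integral \<open>0\<close> over \<open>B\<close> with respect to
  the spectral measure of \<open>v\<close>. On a half-line \<open>B\<close> that ends at \<open>l\<close>, the integrand has a strict
  sign, so \<open>B\<close> is a null set.
\<close>

lemma eigenvector_spectral_measure_zero: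
  assumes E: "is_spectral_resolution D A E" and v: "v \<in> D" "A v = l *\<^sub>R v"
    and B: "B = {l<..} \<or> B = {..<l}"
  shows "E B v = 0"
proof -
  interpret hilbert_pvm E using E by unfold_locales (simp add: is_spectral_resolution_def)
  interpret finite_measure "spectral_measure E v" by (rule finite_measure_spectral_measure)
  have dom: "spectral_integral_dom E (\<lambda>t. t) = D" using E by (auto simp: is_spectral_resolution_def)
  have Bm[measurable]: "B \<in> sets borel" using B by auto
  let ?M = "spectral_measure E v"
  have isq: "integrable ?M (\<lambda>t. t\<^sup>2)" using v(1) dom by (auto simp: spectral_integral_dom_def)
  have i: "integrable ?M (\<lambda>t. t)" by (rule integrable_of_square) (use isq in auto)
  define w where "w = 1 *\<^sub>R E B v + 0 *\<^sub>R E (- B) v"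
  have vs: "v = 1 *\<^sub>R E B v + 1 *\<^sub>R E (- B) v" using E_Un[of B "- B" v] E_UNIV by simp
  have "integrable (spectral_measure E w) (\<lambda>t. t\<^sup>2)"
    unfolding w_def by (rule integrable_spectral_measure_split) (use isq in auto)
  then have wD: "w \<in> D" using dom by (auto simp: spectral_integral_dom_def)
  have p: "v + w = 2 *\<^sub>R E B v + 1 *\<^sub>R E (- B) v" using vs by (simp add: w_def scaleR_2)
  have m: "v - w = 0 *\<^sub>R E B v + 1 *\<^sub>R E (- B) v"
    using vs unfolding w_def by (simp, metis add_diff_cancel_left')
  have iB: "integrable ?M (\<lambda>t. indicator B t * t)" "integrable ?M (\<lambda>t. indicator (- B) t * t)"
    using integrable_mult_indicator[OF _ i, of B] integrable_mult_indicator[OF _ i, of "- B"] by auto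
  have iBl: "integrable ?M (\<lambda>t. l * indicator B t)"
    by (intro integrable_mult_right integrable_real_indicator) (auto simp: emeasure_spectral_measure)
  have "A v \<bullet> w = ((LINT t|spectral_measure E (v + w). t) - (LINT t|spectral_measure E (v - w). t)) / 4"
    by (rule spectral_resolution_inner[OF E v(1) wD])
  also have "(LINT t|spectral_measure E (v + w). t) = (LINT t|?M. 4 * (indicator B t * t) + indicator (- B) t * t)"
    unfolding p by (subst integral_spectral_measure_split) (auto simp: algebra_simps)
  also have "\<dots> = 4 * (LINT t|?M. indicator B t * t) + (LINT t|?M. indicator (- B) t * t)"
    using iB by simp
  also have "(LINT t|spectral_measure E (v - w). t) = (LINT t|?M. indicator (- B) t * t)"
    unfolding m by (subst integral_spectral_measure_split) auto
  finally have "A v \<bullet> w = (LINT t|?M. indicator B t * t)" by simp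
  moreover have "A v \<bullet> w = l * measure ?M B"
    using v(2) by (simp add: w_def measure_spectral_measure inner_commute)
  moreover have "l * measure ?M B = (LINT t|?M. l * indicator B t)"
    by (simp add: emeasure_spectral_measure)
  ultimately have "(LINT t|?M. indicator B t * t) - (LINT t|?M. l * indicator B t) = 0" by linarith
  then have int0: "(LINT t|?M. indicator B t * t - l * indicator B t) = 0"
    unfolding Bochner_Integration.integral_diff[OF iB(1) iBl] .
  have intd: "integrable ?M (\<lambda>t. indicator B t * t - l * indicator B t)"
    by (rule Bochner_Integration.integrable_diff[OF iB(1) iBl])
  have "AE t in ?M. indicator B t * t - l * indicator B t = 0"
  proof (cases "B = {l<..}")
    case True
    then show ?thesis
      using integral_nonneg_eq_0_iff_AE[OF intd] int0
      by (simp add: eq_commute[of l] split: split_indicator)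
  next
    case False
    then have "B = {..<l}" using B by auto
    then have "AE t in ?M. - (indicator B t * t - l * indicator B t) = 0"
      using integral_nonneg_eq_0_iff_AE[of ?M "\<lambda>t. - (indicator B t * t - l * indicator B t)"] intd int0
      by (auto simp del: minus_diff_eq split: split_indicator)
    then show ?thesis by (rule AE_mp) (intro AE_I2, simp)
  qed
  then have "AE t in ?M. t \<notin> B"
    by (rule AE_mp) (use B in \<open>auto split: split_indicator\<close>)
  then have "emeasure ?M B = 0" by (subst (asm) AE_iff_measurable[of B]) auto
  then show ?thesis by (simp add: emeasure_spectral_measure E_inner_self)
qed

lemma spectral_resolution_eigenvector:
  assumes E: "is_spectral_resolution D A E" and v: "v \<in> D" "A v = l *\<^sub>R v"
    and S: "S \<in> sets borel"
  shows "E S v = indicator S l *\<^sub>R v"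
proof -
  interpret hilbert_pvm E using E by unfold_locales (simp add: is_spectral_resolution_def)
  have "UNIV = ({..<l} \<union> {l<..}) \<union> {l}" by auto
  then have "v = E (({..<l} \<union> {l<..}) \<union> {l}) v" using E_UNIV[of v] by simp
  also have "\<dots> = E ({..<l} \<union> {l<..}) v + E {l} v" by (rule E_Un) auto
  also have "E ({..<l} \<union> {l<..}) v = E {..<l} v + E {l<..} v" by (rule E_Un) auto
  also have "E {..<l} v = 0" using eigenvector_spectral_measure_zero[OF E v] by blast
  also have "E {l<..} v = 0" using eigenvector_spectral_measure_zero[OF E v] by blast
  finally have vl: "E {l} v = v" by simp
  have "E S v = E S (E {l} v)" by (simp only: vl)
  also have "\<dots> = E (S \<inter> {l}) v" using S by (rule E_Int) simp
  also have "\<dots> = indicator S l *\<^sub>R v" using vl E_empty by (cases "l \<in> S") auto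
  finally show ?thesis .
qed

end


section \<open>Spectral calculus in terms of eigenspaces\<close>

context discrete_operator
begin

lemma P_inner_P: "P n x \<bullet> P n y = P n x \<bullet> y"
  using P_symmetric[of n "P n x" y] P_P[of n n x] by simp

lemma P_orthogonal: "m \<noteq> n \<Longrightarrow> P m x \<bullet> P n y = 0"
  using P_symmetric[of m x "P n y"] P_P[of m n y] by simp

lemma parseval: "(\<lambda>n. P n x \<bullet> P n y) sums (x \<bullet> y)"
  unfolding P_inner_P by (rule bounded_linear.sums[OF bounded_linear_inner_left P_sums])

lemma parseval_norm: "(\<lambda>n. (norm (P n x))\<^sup>2) sums (norm x)\<^sup>2"
  unfolding power2_norm_eq_inner by (rule parseval)

lemma eq_by_P: "(\<And>n. P n x = P n y) \<Longrightarrow> x = y"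
  using P_sums[of x] P_sums[of y] by (simp add: sums_unique2)

text \<open>
  Orthogonality turns square summability into the Cauchy property of the partial sums.
\<close>

lemma riesz_fischer:
  assumes a: "\<And>n. P n (a n) = a n" and s: "summable (\<lambda>n. (norm (a n))\<^sup>2)"
  obtains y where "a sums y" "\<And>n. P n y = a n"
proof -
  have orth: "a i \<bullet> a j = 0" if "i \<noteq> j" for i j
    using P_orthogonal[OF that, of "a i" "a j"] by (simp add: a)
  have norm_sum: "(norm (\<Sum>i\<in>I. a i))\<^sup>2 = (\<Sum>i\<in>I. (norm (a i))\<^sup>2)" if "finite I" for I
    using that by (intro norm_sum_Pythagorean) (auto simp: pairwise_def orthogonal_def orth)
  have "Cauchy (\<lambda>k. \<Sum>i<k. a i)"
  proof (rule CauchyI')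
    fix \<epsilon> :: real assume \<epsilon>: "\<epsilon> > 0"
    then obtain N where N: "\<And>m n. m \<ge> N \<Longrightarrow> norm (\<Sum>i=m..<n. (norm (a i))\<^sup>2) < \<epsilon>\<^sup>2"
      using s unfolding summable_Cauchy by (meson zero_less_power)
    show "\<exists>M. \<forall>m\<ge>M. \<forall>n>m. dist (\<Sum>i<m. a i) (\<Sum>i<n. a i) < \<epsilon>"
    proof (intro exI allI impI)
      fix m n :: nat assume mn: "m \<ge> N" "n > m"
      have "(\<Sum>i<n. a i) = (\<Sum>i<m. a i) + (\<Sum>i=m..<n. a i)"
        using mn by (simp add: lessThan_atLeast0 sum.atLeastLessThan_concat)
      then have "norm ((\<Sum>i<m. a i) - (\<Sum>i<n. a i)) = norm (\<Sum>i=m..<n. a i)" by simp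
      moreover have "(norm (\<Sum>i=m..<n. a i))\<^sup>2 < \<epsilon>\<^sup>2"
        using N[OF mn(1), of n] by (simp add: norm_sum)
      ultimately show "dist (\<Sum>i<m. a i) (\<Sum>i<n. a i) < \<epsilon>"
        using \<epsilon> power2_less_imp_less[of _ \<epsilon>] by (simp add: dist_norm)
    qed
  qed
  then obtain y where y: "a sums y"
    unfolding sums_def using Cauchy_convergent convergent_def by blast
  have "P n y = a n" for n
  proof -
    have "P n (a i) = (if i = n then a i else 0)" for i
      using P_P[of n i "a i"] by (simp add: a)
    then have "(\<lambda>i. if i = n then a i else 0) sums P n y" using P.sums[OF y, of n] by simp
    then show ?thesis using sums_single[of n a] sums_unique2 by blast
  qed
  then show ?thesis using y that by blast
qed

lemma multiplier_exists:
  assumes "summable (\<lambda>n. (f n)\<^sup>2 * (norm (P n x))\<^sup>2)"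
  shows "\<exists>y. (\<lambda>n. f n *\<^sub>R P n x) sums y \<and> (\<forall>n. P n y = f n *\<^sub>R P n x)"
  by (rule riesz_fischer[of "\<lambda>n. f n *\<^sub>R P n x"])
    (use assms in \<open>auto simp: P.scaleR P_P power_mult_distrib\<close>)

lemma summable_bounded_multiplier:
  assumes "\<And>n. \<bar>f n\<bar> \<le> C"
  shows "summable (\<lambda>n. f n * (norm (P n x))\<^sup>2)"
proof (rule summable_comparison_test'[of "\<lambda>n. C * (norm (P n x))\<^sup>2" 0])
  show "summable (\<lambda>n. C * (norm (P n x))\<^sup>2)"
    by (intro summable_mult sums_summable[OF parseval_norm])
  show "norm (f n * (norm (P n x))\<^sup>2) \<le> C * (norm (P n x))\<^sup>2" for n
    using assms by (simp add: abs_mult mult_right_mono)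
qed

text \<open>
  If the series converges, \<open>y = \<Sum> e\<^sub>n P n x\<close> satisfies \<open>\<langle>A v, x\<rangle> = \<langle>v, y\<rangle>\<close> on \<open>D\<close>, so \<open>x\<close> is in the
  domain of the adjoint.
\<close>

lemma mem_D_iff: "x \<in> D \<longleftrightarrow> summable (\<lambda>n. (e n)\<^sup>2 * (norm (P n x))\<^sup>2)"
proof
  assume "x \<in> D"
  then show "summable (\<lambda>n. (e n)\<^sup>2 * (norm (P n x))\<^sup>2)"
    using sums_summable[OF parseval_norm[of "A x"]] by (simp add: P_A power_mult_distrib)
next
  assume "summable (\<lambda>n. (e n)\<^sup>2 * (norm (P n x))\<^sup>2)"
  from multiplier_exists[OF this] obtain y where y: "\<And>n. P n y = e n *\<^sub>R P n x" by blast
  show "x \<in> D"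
  proof (rule adjoint_pair_in_graph)
    fix v assume "v \<in> D"
    then have "P n (A v) \<bullet> P n x = P n v \<bullet> P n y" for n by (simp add: P_A y)
    then show "A v \<bullet> x = v \<bullet> y" using parseval[of "A v" x] parseval[of v y] by (simp add: sums_unique2)
  qed
qed

subsection \<open>The spectral resolution\<close>

definition diagonal_pvm :: "real set \<Rightarrow> 'a \<Rightarrow> 'a" where
  "diagonal_pvm S x = (\<Sum>n. indicator S (e n) *\<^sub>R P n x)"

lemma diagonal_pvm_sums: "(\<lambda>n. indicator S (e n) *\<^sub>R P n x) sums diagonal_pvm S x"
  and P_diagonal_pvm: "P n (diagonal_pvm S x) = indicator S (e n) *\<^sub>R P n x"
proof -
  have "summable (\<lambda>n. (indicator S (e n))\<^sup>2 * (norm (P n x))\<^sup>2)"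
    by (rule summable_bounded_multiplier[of _ 1]) (auto split: split_indicator)
  then obtain y where y: "(\<lambda>n. indicator S (e n) *\<^sub>R P n x) sums y" "\<And>n. P n y = indicator S (e n) *\<^sub>R P n x"
    using multiplier_exists[of "\<lambda>n. indicator S (e n)" x] by blast
  moreover have "diagonal_pvm S x = y" using y(1) by (simp add: diagonal_pvm_def sums_iff)
  ultimately show "(\<lambda>n. indicator S (e n) *\<^sub>R P n x) sums diagonal_pvm S x"
    "P n (diagonal_pvm S x) = indicator S (e n) *\<^sub>R P n x" by auto
qed

text \<open>
  For countable additivity, the squared norm of the remainder is a series in \<open>n\<close> that is dominated by
  the square norms \<open>\<parallel>P n u\<parallel>\<^sup>2\<close> and tends to \<open>0\<close> termwise.
\<close>

lemma diagonal_pvm: "projection_valued_measure diagonal_pvm"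
  unfolding projection_valued_measure_def
proof (intro conjI ballI allI impI)
  fix S :: "real set"
  show "linear (diagonal_pvm S)"
    by (rule linearI; rule eq_by_P) (auto simp: P_diagonal_pvm P.add P.scaleR algebra_simps)
  show "diagonal_pvm S (diagonal_pvm S u) = diagonal_pvm S u" for u
    by (rule eq_by_P) (auto simp: P_diagonal_pvm split: split_indicator)
  show "diagonal_pvm S u \<bullet> v = u \<bullet> diagonal_pvm S v" for u v
    using parseval[of "diagonal_pvm S u" v] parseval[of u "diagonal_pvm S v"]
    by (simp add: P_diagonal_pvm sums_unique2)
next
  show "diagonal_pvm UNIV u = u" for u by (rule eq_by_P) (simp add: P_diagonal_pvm)
next
  fix F :: "nat \<Rightarrow> real set" and u
  assume F: "disjoint_family F"
  define c where "c n K = (indicator (\<Union>k. F k) (e n) - (\<Sum>k<K. indicator (F k) (e n)) :: real)" for n K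
  have sumF: "(\<Sum>k<K. indicator (F k) t) = (indicator (\<Union>k<K. F k) t :: real)" for K t
    by (rule indicator_UN_disjoint[symmetric]) (use F in \<open>auto simp: disjoint_family_on_def\<close>)
  have c01: "\<bar>c n K\<bar> \<le> 1" for n K unfolding c_def sumF by (auto split: split_indicator)
  have c0: "(\<lambda>K. c n K) \<longlonglongrightarrow> 0" for n
  proof (cases "e n \<in> (\<Union>k. F k)")
    case True
    then obtain k where k: "e n \<in> F k" by blast
    have "c n K = 0" if "K > k" for K unfolding c_def sumF using k that by (auto split: split_indicator)
    then show ?thesis by (intro tendsto_eventually) (auto simp: eventually_at_top_dense)
  next
    case False
    then show ?thesis unfolding c_def sumF by (auto split: split_indicator)
  qed
  define d where "d K = diagonal_pvm (\<Union>k. F k) u - (\<Sum>k<K. diagonal_pvm (F k) u)" for K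
  have Pd: "P n (d K) = c n K *\<^sub>R P n u" for n K
    by (simp add: d_def c_def P.diff P.sum P_diagonal_pvm scaleR_left.sum scaleR_left_diff_distrib)
  have lim: "(\<lambda>K. \<Sum>n. (c n K)\<^sup>2 * (norm (P n u))\<^sup>2) \<longlonglongrightarrow> (\<Sum>n. 0)"
  proof (rule tannerys_theorem[where M = "\<lambda>n. (norm (P n u))\<^sup>2", THEN conjunct2, THEN conjunct2])
    show "(\<lambda>K. (c n K)\<^sup>2 * (norm (P n u))\<^sup>2) \<longlonglongrightarrow> 0" for n
      by (rule tendsto_eq_intros refl c0)+ simp
    have "norm ((c n K)\<^sup>2 * (norm (P n u))\<^sup>2) \<le> (norm (P n u))\<^sup>2" for n K
      using c01[of n K] by (simp add: abs_mult mult_left_le_one_le abs_square_le_1)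
    then show "\<forall>\<^sub>F (n, K) in sequentially \<times>\<^sub>F sequentially.
        norm ((c n K)\<^sup>2 * (norm (P n u))\<^sup>2) \<le> (norm (P n u))\<^sup>2"
      by (intro always_eventually) auto
    show "summable (\<lambda>n. (norm (P n u))\<^sup>2)" by (rule sums_summable[OF parseval_norm])
  qed auto
  moreover have "(norm (d K))\<^sup>2 = (\<Sum>n. (c n K)\<^sup>2 * (norm (P n u))\<^sup>2)" for K
    using parseval_norm[of "d K"] by (simp add: Pd power_mult_distrib sums_iff)
  ultimately have "(\<lambda>K. (norm (d K))\<^sup>2) \<longlonglongrightarrow> 0" by simp
  then have "(\<lambda>K. sqrt ((norm (d K))\<^sup>2)) \<longlonglongrightarrow> sqrt 0" by (intro tendsto_intros)
  then have "d \<longlonglongrightarrow> 0" by (simp add: tendsto_norm_zero_iff)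
  then have "(\<lambda>K. diagonal_pvm (\<Union>k. F k) u - d K) \<longlonglongrightarrow> diagonal_pvm (\<Union>k. F k) u - 0"
    by (intro tendsto_intros)
  then show "(\<lambda>k. diagonal_pvm (F k) u) sums diagonal_pvm (\<Union>k. F k) u"
    by (simp add: sums_def d_def)
qed

text \<open>
  If \<open>E\<close> agrees with the measure built from the eigenspaces on Borel sets, its scalar spectral
  measures are sums of point masses at the \<open>e n\<close>, and spectral integrals become series.
\<close>

context
  fixes E :: "real set \<Rightarrow> 'a \<Rightarrow> 'a"
  assumes pvm: "projection_valued_measure E"
    and diag: "\<And>S x. S \<in> sets borel \<Longrightarrow> E S x = diagonal_pvm S x"
begin

interpretation hilbert_pvm E by unfold_locales (rule pvm)

lemma spectral_measure_diagonal:
  "spectral_measure E x = distr (density (count_space UNIV) (\<lambda>n. ennreal ((norm (P n x))\<^sup>2))) borel e"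
    (is "_ = distr ?C borel e")
proof (rule measure_eqI)
  fix S assume "S \<in> sets (spectral_measure E x)"
  then have S: "S \<in> sets borel" by simp
  have s: "(\<lambda>n. indicator S (e n) * (norm (P n x))\<^sup>2) sums (E S x \<bullet> x)"
    using parseval[of "diagonal_pvm S x" x] S
    by (simp add: diag P_diagonal_pvm power2_norm_eq_inner)
  have "emeasure (distr ?C borel e) S = emeasure ?C (e -` S)"
    using S by (subst emeasure_distr) auto
  also have "\<dots> = (\<integral>\<^sup>+n. ennreal ((norm (P n x))\<^sup>2) * indicator (e -` S) n \<partial>count_space UNIV)"
    by (subst emeasure_density) auto
  also have "\<dots> = (\<Sum>n. ennreal (indicator S (e n) * (norm (P n x))\<^sup>2))"
    by (subst nn_integral_count_space_nat) (auto intro!: suminf_cong split: split_indicator)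
  also have "\<dots> = ennreal (E S x \<bullet> x)"
    using s by (simp add: suminf_ennreal2 sums_iff)
  finally show "emeasure (spectral_measure E x) S = emeasure (distr ?C borel e) S"
    using S by (simp add: emeasure_spectral_measure)
qed simp

lemma
  fixes f :: "real \<Rightarrow> real"
  assumes f: "f \<in> borel_measurable borel"
  shows integrable_diagonal:
      "integrable (spectral_measure E x) f \<longleftrightarrow> summable (\<lambda>n. \<bar>f (e n)\<bar> * (norm (P n x))\<^sup>2)" (is ?t1)
    and integral_diagonal: "summable (\<lambda>n. \<bar>f (e n)\<bar> * (norm (P n x))\<^sup>2) \<Longrightarrow>
      (\<lambda>n. f (e n) * (norm (P n x))\<^sup>2) sums (LINT t|spectral_measure E x. f t)"
proof -
  note [measurable] = f
  have "integrable (spectral_measure E x) f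
      \<longleftrightarrow> integrable (count_space UNIV) (\<lambda>n. (norm (P n x))\<^sup>2 * f (e n))"
    unfolding spectral_measure_diagonal by (simp add: integrable_distr_eq integrable_density)
  also have "\<dots> \<longleftrightarrow> summable (\<lambda>n. \<bar>f (e n)\<bar> * (norm (P n x))\<^sup>2)"
    by (simp add: integrable_count_space_nat_iff abs_mult mult.commute)
  finally show t1: ?t1 .
  assume s: "summable (\<lambda>n. \<bar>f (e n)\<bar> * (norm (P n x))\<^sup>2)"
  have i: "integrable (count_space UNIV) (\<lambda>n. f (e n) * (norm (P n x))\<^sup>2)"
    using s by (simp add: integrable_count_space_nat_iff abs_mult)
  have "(LINT t|spectral_measure E x. f t) = (LINT n|count_space UNIV. f (e n) * (norm (P n x))\<^sup>2)"
    unfolding spectral_measure_diagonal by (simp add: integral_distr integral_density mult.commute)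
  then show "(\<lambda>n. f (e n) * (norm (P n x))\<^sup>2) sums (LINT t|spectral_measure E x. f t)"
    using sums_integral_count_space_nat[OF i] by simp
qed

lemma spectral_integral_dom_diagonal:
  assumes f: "f \<in> borel_measurable borel"
  shows "x \<in> spectral_integral_dom E f \<longleftrightarrow> summable (\<lambda>n. (f (e n))\<^sup>2 * (norm (P n x))\<^sup>2)"
  using integrable_diagonal[of "\<lambda>t. (f t)\<^sup>2" x] f by (simp add: spectral_integral_dom_def)

lemma spectral_integral_diagonal:
  assumes f: "f \<in> borel_measurable borel" and x: "x \<in> spectral_integral_dom E f"
  shows "P n (spectral_integral E f x) = f (e n) *\<^sub>R P n x"
proof -
  note dom = spectral_integral_dom_diagonal[OF f]
  have "summable (\<lambda>n. (f (e n))\<^sup>2 * (norm (P n x))\<^sup>2)" using x by (simp add: dom)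
  from multiplier_exists[OF this] obtain y where y: "\<And>n. P n y = f (e n) *\<^sub>R P n x" by blast
  let ?I = "\<lambda>w. ((LINT t|spectral_measure E (x + w). f t) - (LINT t|spectral_measure E (x - w). f t)) / 4"
  have yw: "y \<bullet> w = ?I w" if w: "w \<in> spectral_integral_dom E f" for w
  proof -
    have s: "summable (\<lambda>n. \<bar>f (e n)\<bar> * (norm (P n z))\<^sup>2)" if z: "z = x + w \<or> z = x - w" for z
    proof (rule summable_comparison_test'[of "\<lambda>n. 2 * ((norm (P n x))\<^sup>2 + (f (e n))\<^sup>2 * (norm (P n x))\<^sup>2)
          + 2 * ((norm (P n w))\<^sup>2 + (f (e n))\<^sup>2 * (norm (P n w))\<^sup>2)" 0])
      show "summable (\<lambda>n. 2 * ((norm (P n x))\<^sup>2 + (f (e n))\<^sup>2 * (norm (P n x))\<^sup>2)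
          + 2 * ((norm (P n w))\<^sup>2 + (f (e n))\<^sup>2 * (norm (P n w))\<^sup>2))"
        using x w dom by (intro summable_add summable_mult sums_summable[OF parseval_norm]) auto
      fix n
      have "(norm (P n z))\<^sup>2 \<le> (norm (P n x) + norm (P n w))\<^sup>2"
        using z norm_triangle_ineq[of "P n x" "P n w"] norm_triangle_ineq4[of "P n x" "P n w"]
        by (intro power_mono) (auto simp: P.add P.diff)
      also have "\<dots> \<le> 2 * (norm (P n x))\<^sup>2 + 2 * (norm (P n w))\<^sup>2"
        using zero_le_power2[of "norm (P n x) - norm (P n w)"] by (simp add: power2_eq_square algebra_simps)
      finally have 1: "(norm (P n z))\<^sup>2 \<le> 2 * (norm (P n x))\<^sup>2 + 2 * (norm (P n w))\<^sup>2" .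
      have 2: "\<bar>f (e n)\<bar> \<le> 1 + (f (e n))\<^sup>2"
        using zero_le_power2[of "\<bar>f (e n)\<bar> - 1/2"] by (simp add: power2_eq_square algebra_simps)
      have "\<bar>f (e n)\<bar> * (norm (P n z))\<^sup>2
          \<le> (1 + (f (e n))\<^sup>2) * (2 * (norm (P n x))\<^sup>2 + 2 * (norm (P n w))\<^sup>2)"
        using 1 2 by (intro mult_mono) auto
      then show "norm (\<bar>f (e n)\<bar> * (norm (P n z))\<^sup>2) \<le> 2 * ((norm (P n x))\<^sup>2 + (f (e n))\<^sup>2 * (norm (P n x))\<^sup>2)
          + 2 * ((norm (P n w))\<^sup>2 + (f (e n))\<^sup>2 * (norm (P n w))\<^sup>2)"
        by (simp add: algebra_simps)
    qed
    have "(\<lambda>n. (f (e n) * (norm (P n (x + w)))\<^sup>2 - f (e n) * (norm (P n (x - w)))\<^sup>2) / 4) sums ?I w"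
      by (intro sums_divide sums_diff integral_diagonal f s) auto
    moreover have "(f (e n) * (norm (P n (x + w)))\<^sup>2 - f (e n) * (norm (P n (x - w)))\<^sup>2) / 4 = P n y \<bullet> P n w" for n
      by (simp add: y P.add P.diff power2_norm_eq_inner inner_add_left inner_add_right inner_diff_left
          inner_diff_right inner_commute algebra_simps)
    ultimately have "(\<lambda>n. P n y \<bullet> P n w) sums ?I w" by (simp only:)
    then show ?thesis by (rule sums_unique2[OF parseval])
  qed
  have PD: "P n z \<in> spectral_integral_dom E f" for n z
  proof -
    have "(\<lambda>m. (f (e m))\<^sup>2 * (norm (P m (P n z)))\<^sup>2) = (\<lambda>m. if m = n then (f (e m))\<^sup>2 * (norm (P m z))\<^sup>2 else 0)"
      by (auto simp: P_P)
    then show ?thesis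
      unfolding dom by (simp only: sums_summable[OF sums_single])
  qed
  have "spectral_integral E f x = y"
    unfolding spectral_integral_def
  proof (rule the_equality)
    show "\<forall>w\<in>spectral_integral_dom E f. y \<bullet> w = ?I w" using yw by blast
    fix z assume z: "\<forall>w\<in>spectral_integral_dom E f. z \<bullet> w = ?I w"
    show "z = y"
    proof (rule eq_by_P)
      fix n
      have "P n z \<bullet> v = P n y \<bullet> v" for v
        using bspec[OF z PD[of n v]] yw[OF PD[of n v]] by (simp add: P_symmetric)
      then show "P n z = P n y" by (metis vector_eq_rdot)
    qed
  qed
  then show ?thesis using y by simp
qed

end

lemma diagonal_pvm_is_spectral_resolution: "is_spectral_resolution D A diagonal_pvm"
proof -
  have dom: "spectral_integral_dom diagonal_pvm (\<lambda>t. t) = D"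
    using spectral_integral_dom_diagonal[OF diagonal_pvm, of "\<lambda>t. t"] mem_D_iff by auto
  have "spectral_integral diagonal_pvm (\<lambda>t. t) u = A u" if "u \<in> D" for u
    by (rule eq_by_P)
      (use that dom spectral_integral_diagonal[OF diagonal_pvm, of "\<lambda>t. t" u] in \<open>auto simp: P_A\<close>)
  then show ?thesis using dom diagonal_pvm by (auto simp: is_spectral_resolution_def)
qed

text \<open>
  The eigenvectors of \<open>A\<close> determine any spectral resolution on the eigenspaces, whose span is dense.
  Hence the arbitrary choice in \<open>spectral_resolution\<close> does not matter.
\<close>

lemma spectral_resolution_unique:
  assumes E: "is_spectral_resolution D A E" and S: "S \<in> sets borel"
  shows "E S x = diagonal_pvm S x"
proof -
  interpret hilbert_pvm E using E by unfold_locales (simp add: is_spectral_resolution_def)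
  have "(\<lambda>n. E S (P n x)) sums E S x" by (rule bounded_linear.sums[OF bounded_linear_E[OF S] P_sums])
  moreover have "E S (P n x) = indicator S (e n) *\<^sub>R P n x" for n
    by (rule spectral_resolution_eigenvector[OF E P_in_D A_P S])
  ultimately show ?thesis using diagonal_pvm_sums[of S x] by (simp add: sums_unique2)
qed

lemma is_spectral_resolution: "is_spectral_resolution D A (spectral_resolution D A)"
  unfolding spectral_resolution_def
  by (rule someI[where P = "is_spectral_resolution D A"], rule diagonal_pvm_is_spectral_resolution)

subsection \<open>The square root\<close>

lemma mem_dom_sqrt_iff: "x \<in> dom_power D A (1/2) \<longleftrightarrow> summable (\<lambda>n. e n * (norm (P n x))\<^sup>2)"
  and P_op_sqrt: "x \<in> dom_power D A (1/2) \<Longrightarrow> P n (op_power D A (1/2) x) = sqrt (e n) *\<^sub>R P n x"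
proof -
  let ?E = "spectral_resolution D A"
  have E: "projection_valued_measure ?E" and E': "\<And>S x. S \<in> sets borel \<Longrightarrow> spectral_resolution D A S x = diagonal_pvm S x"
    using is_spectral_resolution spectral_resolution_unique
    by (auto simp: is_spectral_resolution_def)
  have m: "power_fun (1/2) \<in> borel_measurable borel" unfolding power_fun_def by measurable
  have s: "power_fun (1/2) (e n) = sqrt (e n)" for n
    using e_nonneg[of n] by (simp add: power_fun_def powr_half_sqrt)
  show "x \<in> dom_power D A (1/2) \<longleftrightarrow> summable (\<lambda>n. e n * (norm (P n x))\<^sup>2)"
    using spectral_integral_dom_diagonal[where E = ?E and f = "power_fun (1/2)" and x = x, OF E E' m] e_nonneg by (simp add: dom_power_def s)
  show "x \<in> dom_power D A (1/2) \<Longrightarrow> P n (op_power D A (1/2) x) = sqrt (e n) *\<^sub>R P n x"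
    using spectral_integral_diagonal[where E = ?E and f = "power_fun (1/2)" and x = x and n = n, OF E E' m] by (simp add: dom_power_def op_power_def s)
qed

end


section \<open>Right Dini derivatives and a comparison principle\<close>

text \<open>
  The upper right Dini derivative of \<open>F\<close> at \<open>s\<close> is at most \<open>d\<close>. For integral inequalities with a
  continuous integrand, this replaces derivatives that exist only almost everywhere.
\<close>

definition rdini_le :: "(real \<Rightarrow> real) \<Rightarrow> real \<Rightarrow> real \<Rightarrow> bool" where
  "rdini_le F s d \<longleftrightarrow> (\<forall>\<epsilon>>0. \<forall>\<^sub>F t in at_right s. F t - F s \<le> (d + \<epsilon>) * (t - s))"

lemma eventually_at_right_gt: "\<forall>\<^sub>F t in at_right s. t > (s::real)"
  by (simp add: eventually_at_filter)

lemma rdini_le_mono: "rdini_le F s d \<Longrightarrow> d \<le> d' \<Longrightarrow> rdini_le F s d'"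
  unfolding rdini_le_def
proof (intro allI impI)
  fix \<epsilon> :: real assume *: "\<forall>\<epsilon>>0. \<forall>\<^sub>F t in at_right s. F t - F s \<le> (d + \<epsilon>) * (t - s)" "d \<le> d'" "\<epsilon> > 0"
  then have "\<forall>\<^sub>F t in at_right s. F t - F s \<le> (d + \<epsilon>) * (t - s)" by blast
  then show "\<forall>\<^sub>F t in at_right s. F t - F s \<le> (d' + \<epsilon>) * (t - s)"
    using eventually_at_right_gt
  proof eventually_elim
    case (elim t)
    have "(d + \<epsilon>) * (t - s) \<le> (d' + \<epsilon>) * (t - s)" using elim *(2) by (intro mult_right_mono) auto
    then show ?case using elim by linarith
  qed
qed

lemma rdini_le_cong:
  assumes "rdini_le F s d" "\<And>t. t \<ge> s \<Longrightarrow> F t = F' t"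
  shows "rdini_le F' s d"
  unfolding rdini_le_def
proof (intro allI impI)
  fix \<epsilon> :: real assume "\<epsilon> > 0"
  then have "\<forall>\<^sub>F t in at_right s. F t - F s \<le> (d + \<epsilon>) * (t - s)"
    using assms(1) unfolding rdini_le_def by blast
  then show "\<forall>\<^sub>F t in at_right s. F' t - F' s \<le> (d + \<epsilon>) * (t - s)"
    using eventually_at_right_gt by eventually_elim (use assms(2) in auto)
qed

lemma rdini_le_tendsto:
  assumes "((\<lambda>t. (F t - F s) / (t - s)) \<longlongrightarrow> d) (at_right s)"
  shows "rdini_le F s d"
  unfolding rdini_le_def
proof (intro allI impI)
  fix \<epsilon> :: real assume "\<epsilon> > 0"
  then have "\<forall>\<^sub>F t in at_right s. (F t - F s) / (t - s) < d + \<epsilon>"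
    using order_tendstoD(2)[OF assms] by simp
  then show "\<forall>\<^sub>F t in at_right s. F t - F s \<le> (d + \<epsilon>) * (t - s)"
    using eventually_at_right_gt by eventually_elim (simp add: divide_less_eq less_imp_le)
qed

lemma rdini_le_add:
  assumes "rdini_le F s d" "rdini_le G s d'"
  shows "rdini_le (\<lambda>t. F t + G t) s (d + d')"
  unfolding rdini_le_def
proof (intro allI impI)
  fix \<epsilon> :: real assume "\<epsilon> > 0"
  then have "\<forall>\<^sub>F t in at_right s. F t - F s \<le> (d + \<epsilon>/2) * (t - s)"
    "\<forall>\<^sub>F t in at_right s. G t - G s \<le> (d' + \<epsilon>/2) * (t - s)"
    using assms unfolding rdini_le_def by (meson half_gt_zero)+
  then show "\<forall>\<^sub>F t in at_right s. F t + G t - (F s + G s) \<le> (d + d' + \<epsilon>) * (t - s)"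
  proof eventually_elim
    case (elim t)
    have "(d + \<epsilon>/2) * (t - s) + (d' + \<epsilon>/2) * (t - s) = (d + d' + \<epsilon>) * (t - s)"
      by (simp add: algebra_simps)
    then show ?case using elim by linarith
  qed
qed

text \<open>
  The difference quotient of \<open>\<psi>\<close> tends to \<open>k > 0\<close>, so it is eventually positive and may be multiplied
  with the bound for the increments of \<open>F\<close>, even when these are negative.
\<close>

lemma rdini_le_compose:
  assumes F: "rdini_le F s d" "(F \<longlongrightarrow> F s) (at_right s)"
    and \<psi>: "(\<psi> has_real_derivative k) (at (F s))" "k > 0"
  shows "rdini_le (\<lambda>t. \<psi> (F t)) s (k * d)"
  unfolding rdini_le_def
proof (intro allI impI)
  fix \<epsilon> :: real assume \<epsilon>: "\<epsilon> > 0"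
  obtain q where q: "\<And>z. \<psi> z - \<psi> (F s) = q z * (z - F s)" "isCont q (F s)" "q (F s) = k"
    using \<psi>(1) unfolding CARAT_DERIV by blast
  define \<epsilon>' where "\<epsilon>' = \<epsilon> / (2 * k)"
  have \<epsilon>': "\<epsilon>' > 0" using \<epsilon> \<psi>(2) by (simp add: \<epsilon>'_def)
  have lim: "((\<lambda>t. q (F t)) \<longlongrightarrow> k) (at_right s)"
    using isCont_tendsto_compose[OF q(2) F(2)] q(3) by simp
  have "\<forall>\<^sub>F t in at_right s. q (F t) > 0" using order_tendstoD(1)[OF lim \<psi>(2)] .
  moreover have "\<forall>\<^sub>F t in at_right s. q (F t) * (d + \<epsilon>') < k * d + \<epsilon>"
  proof (rule order_tendstoD(2))
    show "((\<lambda>t. q (F t) * (d + \<epsilon>')) \<longlongrightarrow> k * (d + \<epsilon>')) (at_right s)" by (intro tendsto_intros lim)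
    show "k * (d + \<epsilon>') < k * d + \<epsilon>" using \<epsilon> \<psi>(2) by (simp add: \<epsilon>'_def field_simps)
  qed
  moreover have "\<forall>\<^sub>F t in at_right s. F t - F s \<le> (d + \<epsilon>') * (t - s)"
    using F(1) \<epsilon>' unfolding rdini_le_def by blast
  ultimately show "\<forall>\<^sub>F t in at_right s. \<psi> (F t) - \<psi> (F s) \<le> (k * d + \<epsilon>) * (t - s)"
    using eventually_at_right_gt
  proof eventually_elim
    case (elim t)
    have "\<psi> (F t) - \<psi> (F s) \<le> q (F t) * ((d + \<epsilon>') * (t - s))"
      unfolding q(1) using elim by (intro mult_left_mono) auto
    also have "\<dots> = (q (F t) * (d + \<epsilon>')) * (t - s)" by simp
    also have "\<dots> \<le> (k * d + \<epsilon>) * (t - s)" using elim by (intro mult_right_mono) auto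
    finally show ?case .
  qed
qed

lemma rdini_le_cmult:
  assumes "rdini_le F s d" "c > 0"
  shows "rdini_le (\<lambda>t. c * F t) s (c * d)"
  unfolding rdini_le_def
proof (intro allI impI)
  fix \<epsilon> :: real assume "\<epsilon> > 0"
  then have "\<forall>\<^sub>F t in at_right s. F t - F s \<le> (d + \<epsilon> / c) * (t - s)"
    using assms unfolding rdini_le_def by (meson divide_pos_pos)
  then show "\<forall>\<^sub>F t in at_right s. c * F t - c * F s \<le> (c * d + \<epsilon>) * (t - s)"
  proof eventually_elim
    case (elim t)
    have "c * (F t - F s) \<le> c * ((d + \<epsilon> / c) * (t - s))" using elim assms(2) by (intro mult_left_mono) auto
    also have "\<dots> = (c * d + \<epsilon>) * (t - s)" using assms(2) by (simp add: field_simps)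
    finally show ?case by (simp add: algebra_simps)
  qed
qed

lemma rdini_le_deriv:
  assumes "(F has_real_derivative d) (at s)"
  shows "rdini_le F s d"
proof -
  have id: "rdini_le (\<lambda>t. t) s 1"
    unfolding rdini_le_def
  proof (intro allI impI)
    fix \<epsilon> :: real assume \<epsilon>: "\<epsilon> > 0"
    show "\<forall>\<^sub>F t in at_right s. t - s \<le> (1 + \<epsilon>) * (t - s)"
      using eventually_at_right_gt by eventually_elim (use \<epsilon> in \<open>simp add: distrib_right\<close>)
  qed
  obtain q where q: "\<And>z. F z - F s = q z * (z - s)" "isCont q s" "q s = d"
    using assms unfolding CARAT_DERIV by blast
  have lim: "(q \<longlongrightarrow> d) (at_right s)" using q(2,3) by (auto simp: isCont_def intro: tendsto_within_subset)
  show ?thesis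
    unfolding rdini_le_def
  proof (intro allI impI)
    fix \<epsilon> :: real assume "\<epsilon> > 0"
    then have "\<forall>\<^sub>F t in at_right s. q t < d + \<epsilon>" using order_tendstoD(2)[OF lim] by simp
    then show "\<forall>\<^sub>F t in at_right s. F t - F s \<le> (d + \<epsilon>) * (t - s)"
      using eventually_at_right_gt
      by eventually_elim (simp add: q(1) mult_right_mono)
  qed
qed

lemma rdini_le_integral:
  assumes "s < b" and h: "continuous_on {s..b} h"
    and F: "\<And>t. s \<le> t \<Longrightarrow> t \<le> b \<Longrightarrow> F t - F s \<le> integral {s..t} h"
  shows "rdini_le F s (h s)"
  unfolding rdini_le_def
proof (intro allI impI)
  fix \<epsilon> :: real assume \<epsilon>: "\<epsilon> > 0"
  then obtain \<delta> where \<delta>: "\<delta> > 0" "\<And>x. x \<in> {s..b} \<Longrightarrow> dist x s < \<delta> \<Longrightarrow> dist (h x) (h s) < \<epsilon>"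
    using h \<open>s < b\<close> unfolding continuous_on_iff by (metis atLeastAtMost_iff less_imp_le order_refl)
  have "F t - F s \<le> (h s + \<epsilon>) * (t - s)" if t: "s < t" "t < min b (s + \<delta>)" for t
  proof -
    have "integral {s..t} h \<le> integral {s..t} (\<lambda>_. h s + \<epsilon>)"
    proof (rule integral_le)
      show "h integrable_on {s..t}"
        using t by (intro integrable_continuous_real continuous_on_subset[OF h]) auto
      fix x assume "x \<in> {s..t}"
      then have "dist (h x) (h s) < \<epsilon>" using t by (intro \<delta>) (auto simp: dist_real_def)
      then show "h x \<le> h s + \<epsilon>" by (simp add: dist_real_def)
    qed auto
    also have "\<dots> = (h s + \<epsilon>) * (t - s)" using t by simp
    finally show ?thesis using F[of t] t by simp
  qed
  then show "\<forall>\<^sub>F t in at_right s. F t - F s \<le> (h s + \<epsilon>) * (t - s)"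
    using \<open>s < b\<close> \<delta>(1)
    by (intro eventually_at_rightI[of s "min b (s + \<delta>)"]) auto
qed

text \<open>
  If \<open>F\<close> were positive at \<open>t\<close>, a small multiple \<open>\<epsilon> exp ((C + 1) (t - a))\<close> would still lie below
  \<open>F t\<close>; at the last point before \<open>t\<close> where \<open>F\<close> meets this multiple, \<open>F\<close> would have to grow at
  least at the rate \<open>(C + 1) F\<close>.
\<close>

lemma comparison_principle:
  assumes cont: "continuous_on {a..b} F" and Fa: "F a \<le> 0"
    and growth: "\<And>s. a \<le> s \<Longrightarrow> s < b \<Longrightarrow> F s > 0 \<Longrightarrow> rdini_le F s (C * F s)"
    and t: "t \<in> {a..b}"
  shows "F t \<le> 0"
proof (rule ccontr)
  assume "\<not> F t \<le> 0"
  then have Ft: "F t > 0" by simp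
  define k where "k = C + 1"
  define \<epsilon> where "\<epsilon> = F t / (2 * exp (k * (t - a)))"
  define H where "H x = F x - \<epsilon> * exp (k * (x - a))" for x
  have \<epsilon>: "\<epsilon> > 0" using Ft by (simp add: \<epsilon>_def)
  have Ht: "H t > 0" using Ft by (simp add: H_def \<epsilon>_def)
  have contH: "continuous_on {a..t} H"
    unfolding H_def using t by (intro continuous_intros continuous_on_subset[OF cont]) auto
  define S where "S = {x \<in> {a..t}. H x \<le> 0}"
  have S: "compact S"
  proof -
    have "closed S" unfolding S_def
      by (rule continuous_on_closed_Collect_le[OF contH continuous_on_const closed_atLeastAtMost])
    moreover have "bounded S" by (rule bounded_subset[OF bounded_closed_interval]) (auto simp: S_def)
    ultimately show ?thesis by (simp add: compact_eq_bounded_closed)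
  qed
  have "a \<in> S" using t Fa \<epsilon> by (auto simp: S_def H_def)
  then obtain s where s: "s \<in> S" "\<And>x. x \<in> S \<Longrightarrow> x \<le> s"
    using compact_attains_sup[OF S] by blast
  have st: "a \<le> s" "s < t" "H s \<le> 0"
    using s(1) Ht by (auto simp: S_def le_less)
  have pos: "H x > 0" if "s < x" "x \<le> t" for x
    using s(2)[of x] that st by (force simp: S_def)
  have tend: "(H \<longlongrightarrow> H s) (at_right s)"
  proof -
    have "(H \<longlongrightarrow> H s) (at s within {a..t})" using contH st by (simp add: continuous_on_def)
    then have "(H \<longlongrightarrow> H s) (at s within {s..t})" by (rule tendsto_within_subset) (use st in auto)
    then show ?thesis using st(2) by (simp add: at_within_Icc_at_right)
  qed
  have "H s \<ge> 0"
  proof (rule tendsto_lowerbound[OF tend])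
    show "\<forall>\<^sub>F x in at_right s. 0 \<le> H x"
      using pos st by (intro eventually_at_rightI[of s t]) (auto simp: less_imp_le)
  qed simp
  then have Fs: "F s = \<epsilon> * exp (k * (s - a))" using st by (simp add: H_def)
  then have Fs0: "F s > 0" using \<epsilon> by simp
  have "rdini_le F s (C * F s)" using growth st t Fs0 by auto
  then have "\<forall>\<^sub>F x in at_right s. F x - F s \<le> (C * F s + F s / 2) * (x - s)"
    using Fs0 unfolding rdini_le_def by (meson half_gt_zero)
  moreover have "\<forall>\<^sub>F x in at_right s. x < t" using st by (simp add: eventually_at_right_less eventually_at_right_real eventually_at_right_field) (blast)
  ultimately have "\<forall>\<^sub>F x in at_right s. False"
    using eventually_at_right_gt
  proof eventually_elim
    case (elim x)
    have "1 + k * (x - s) \<le> exp (k * (x - s))" by (rule exp_ge_add_one_self)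
    then have "F s * (1 + k * (x - s)) \<le> F s * exp (k * (x - s))" using Fs0 by (intro mult_left_mono) auto
    also have "\<dots> = \<epsilon> * exp (k * (x - a))"
      by (simp add: Fs flip: exp_add) (simp add: algebra_simps)
    finally have "F s * (1 + k * (x - s)) \<le> \<epsilon> * exp (k * (x - a))" .
    moreover have "H x > 0" using pos elim by simp
    ultimately have "F s * (1 + k * (x - s)) < F x" by (simp add: H_def)
    also have "F x \<le> F s + (C * F s + F s / 2) * (x - s)" using elim by simp
    finally have "F s * (1 + k * (x - s)) < F s + (C * F s + F s / 2) * (x - s)" .
    moreover have "F s * (1 + k * (x - s)) = F s + C * (F s * (x - s)) + F s * (x - s)"
      "F s + (C * F s + F s / 2) * (x - s) = F s + C * (F s * (x - s)) + F s * (x - s) / 2"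
      by (auto simp: k_def algebra_simps)
    moreover have "F s * (x - s) > 0" using Fs0 elim by simp
    ultimately show False by linarith
  qed
  then show False by simp
qed

section \<open>The fundamental theorem of calculus for dominated increments\<close>

text \<open>
  The increments of \<open>f\<close> are dominated by those of the integral of \<open>V\<close>. In a Riemann sum, the
  intervals whose tag lies in the null set \<open>Z\<close> contribute little: with \<open>V\<close> redefined as \<open>0\<close> on
  \<open>Z\<close>, Henstock's lemma says that the sum of the integrals of \<open>V\<close> over them is small.
\<close>

lemma ftc_dominated:
  fixes f h V :: "real \<Rightarrow> real"
  assumes ab: "a \<le> b" and V: "V integrable_on {a..b}"
    and dom: "\<And>c d. a \<le> c \<Longrightarrow> c \<le> d \<Longrightarrow> d \<le> b \<Longrightarrow> \<bar>f d - f c\<bar> \<le> integral {c..d} V"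
    and Z: "negligible Z"
    and der: "\<And>x. x \<in> {a..b} - Z \<Longrightarrow> (f has_real_derivative h x) (at x)"
  shows "(h has_integral (f b - f a)) {a..b}"
proof -
  define h' where "h' x = (if x \<in> Z then 0 else h x)" for x
  define V' where "V' x = (if x \<in> Z then 0 else V x)" for x
  have V': "V' integrable_on {a..b}"
    by (rule integrable_spike[OF V Z]) (simp add: V'_def)
  have intV: "integral K V' = integral K V" for K
    by (rule integral_spike[OF Z]) (simp add: V'_def)
  have "(h' has_integral (f b - f a)) {a..b}"
    unfolding has_integral_real
  proof (intro allI impI)
    fix E :: real assume E: "E > 0"
    define \<epsilon> where "\<epsilon> = E / (2 * (b - a + 1))"
    have \<epsilon>: "\<epsilon> > 0" using E ab by (simp add: \<epsilon>_def)
    obtain \<gamma> where \<gamma>: "gauge \<gamma>"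
      "\<And>p. \<lbrakk>p tagged_partial_division_of {a..b}; \<gamma> fine p\<rbrakk> \<Longrightarrow>
          (\<Sum>(x,k)\<in>p. norm (measure lborel k *\<^sub>R V' x - integral k V')) < \<epsilon>"
      using Henstock_lemma[of V' a b \<epsilon>] V' \<epsilon> by (auto simp: box_real)
    have "\<exists>\<delta>>0. \<forall>y. \<bar>y - x\<bar> < \<delta> \<longrightarrow> \<bar>f y - f x - h x * (y - x)\<bar> \<le> \<epsilon> * \<bar>y - x\<bar>"
      if "x \<in> {a..b} - Z" for x
    proof -
      have "(f has_derivative (\<lambda>y. h x * y)) (at x)"
        using der[OF that] by (simp add: has_field_derivative_def)
      then show ?thesis unfolding has_derivative_at_alt using \<epsilon> by auto
    qed
    then obtain \<delta> where \<delta>: "\<And>x. x \<in> {a..b} - Z \<Longrightarrow> \<delta> x > 0"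
      "\<And>x y. x \<in> {a..b} - Z \<Longrightarrow> \<bar>y - x\<bar> < \<delta> x \<Longrightarrow> \<bar>f y - f x - h x * (y - x)\<bar> \<le> \<epsilon> * \<bar>y - x\<bar>"
      by metis
    define d where "d x = \<gamma> x \<inter> (if x \<in> {a..b} - Z then ball x (\<delta> x) else UNIV)" for x
    have "gauge d" using \<gamma>(1) \<delta>(1) by (auto simp: gauge_def d_def)
    moreover have "norm ((\<Sum>(x,k)\<in>p. measure lborel k *\<^sub>R h' x) - (f b - f a)) < E"
      if p: "p tagged_division_of {a..b}" and fine: "d fine p" for p
    proof -
      have fin: "finite p" using p by blast
      have "\<gamma> fine p" using fine by (auto simp: fine_def d_def)
      then have hen: "(\<Sum>(x,k)\<in>p. norm (measure lborel k *\<^sub>R V' x - integral k V')) < \<epsilon>"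
        using \<gamma>(2) p tagged_division_of_def by blast
      have tele: "(\<Sum>(x,k)\<in>p. f (Sup k) - f (Inf k)) = f b - f a"
        by (rule additive_tagged_division_1[OF ab p])
      have "(\<Sum>(x,k)\<in>p. measure lborel k *\<^sub>R h' x) - (f b - f a)
          = (\<Sum>(x,k)\<in>p. measure lborel k * h' x - (f (Sup k) - f (Inf k)))"
        unfolding tele[symmetric] by (simp add: sum_subtractf split_def)
      also have "\<bar>\<dots>\<bar> \<le> (\<Sum>(x,k)\<in>p. \<epsilon> * measure lborel k + norm (measure lborel k *\<^sub>R V' x - integral k V'))"
      proof (rule order.trans[OF sum_abs sum_mono], clarify)
        fix x k assume xk: "(x, k) \<in> p"
        obtain u v where uv: "k = {u..v}" using tagged_division_ofD(4)[OF p xk] by (auto simp: box_real)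
        have xk': "x \<in> k" "k \<subseteq> {a..b}" using tagged_division_ofD(2,3)[OF p xk] by auto
        then have ord: "u \<le> x" "x \<le> v" "a \<le> u" "v \<le> b" using uv by auto
        then have SI: "Sup k = v" "Inf k = u" "measure lborel k = v - u" using uv by auto
        show "\<bar>measure lborel k * h' x - (f (Sup k) - f (Inf k))\<bar>
            \<le> \<epsilon> * measure lborel k + norm (measure lborel k *\<^sub>R V' x - integral k V')"
        proof (cases "x \<in> Z")
          case True
          have "\<bar>f v - f u\<bar> \<le> integral k V'" using dom[of u v] ord by (simp add: uv intV)
          moreover have "0 \<le> \<epsilon> * (v - u)" using \<epsilon> ord by simp
          ultimately show ?thesis using True by (simp add: h'_def V'_def SI)
        next
          case False
          have x: "x \<in> {a..b} - Z" using False xk' by auto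
          have "k \<subseteq> d x" using fine xk by (auto simp: fine_def)
          then have "k \<subseteq> ball x (\<delta> x)" using x unfolding d_def by simp
          moreover have "u \<in> k" "v \<in> k" using uv ord by auto
          ultimately have uvx: "u \<in> ball x (\<delta> x)" "v \<in> ball x (\<delta> x)" by blast+
          then have "\<bar>u - x\<bar> < \<delta> x" "\<bar>v - x\<bar> < \<delta> x" by (auto simp: dist_real_def)
          then have "\<bar>f u - f x - h x * (u - x)\<bar> \<le> \<epsilon> * (x - u)" "\<bar>f v - f x - h x * (v - x)\<bar> \<le> \<epsilon> * (v - x)"
            using \<delta>(2)[OF x] ord by fastforce+
          moreover have "(v - u) * h x - (f v - f u) = (f u - f x - h x * (u - x)) - (f v - f x - h x * (v - x))"
            by (simp add: algebra_simps)
          ultimately have "\<bar>(v - u) * h x - (f v - f u)\<bar> \<le> \<epsilon> * (x - u) + \<epsilon> * (v - x)" by linarith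
          also have "\<dots> = \<epsilon> * (v - u)" by (simp add: algebra_simps)
          finally show ?thesis using False by (simp add: SI h'_def add_increasing2)
        qed
      qed
      also have "\<dots> = \<epsilon> * (\<Sum>(x,k)\<in>p. measure lborel k) + (\<Sum>(x,k)\<in>p. norm (measure lborel k *\<^sub>R V' x - integral k V'))"
        by (simp add: sum.distrib sum_distrib_left split_def)
      also have "(\<Sum>(x,k)\<in>p. measure lborel k) = b - a"
        using additive_content_tagged_division[of p a b] p ab by (simp add: box_real)
      also have "\<epsilon> * (b - a) + (\<Sum>(x,k)\<in>p. norm (measure lborel k *\<^sub>R V' x - integral k V')) < \<epsilon> * (b - a) + \<epsilon>"
        using hen by simp
      also have "\<epsilon> * (b - a) + \<epsilon> = E / 2"
      proof -
        have "E / (2 * z) * z = E / 2" if "z > 0" for z using that by simp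
        from this[of "b - a + 1"] have "\<epsilon> * (b - a + 1) = E / 2" using ab unfolding \<epsilon>_def by linarith
        then show ?thesis by (simp add: algebra_simps)
      qed
      finally show ?thesis using E by simp
    qed
    ultimately show "\<exists>\<gamma>. gauge \<gamma> \<and> (\<forall>\<D>. \<D> tagged_division_of {a..b} \<and> \<gamma> fine \<D> \<longrightarrow>
        norm ((\<Sum>(x,k)\<in>\<D>. measure lborel k *\<^sub>R h' x) - (f b - f a)) < E)"
      by (intro exI[of _ d] conjI allI impI) auto
  qed
  then show ?thesis
    by (rule has_integral_spike[OF Z, rotated]) (simp add: h'_def)
qed

section \<open>Weak derivatives\<close>

text \<open>
  A continuously differentiable step, made of quadratic splines, that rises from \<open>0\<close> to \<open>h\<^sup>2 / 2\<close> on
  \<open>[0, h]\<close>. Its derivative \<open>tent h\<close> is piecewise linear with support \<open>[0, h]\<close>.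
\<close>

definition bump :: "real \<Rightarrow> real \<Rightarrow> real" where
  "bump h x = (max 0 x)\<^sup>2 - 2 * (max 0 (x - h / 2))\<^sup>2 + (max 0 (x - h))\<^sup>2"

definition tent :: "real \<Rightarrow> real \<Rightarrow> real" where
  "tent h x = 2 * max 0 x - 4 * max 0 (x - h / 2) + 2 * max 0 (x - h)"

lemma has_derivative_square_pos_part:
  "((\<lambda>x. (max 0 (x - c))\<^sup>2) has_real_derivative 2 * max 0 (x - c)) (at x)" for c x :: real
proof -
  have base: "((\<lambda>x. (max 0 x)\<^sup>2) has_real_derivative 2 * max 0 x) (at x)" for x :: real
    unfolding CARAT_DERIV
  proof (intro exI conjI allI)
    define g where "g z = (if z = x then 2 * max 0 x else ((max 0 z)\<^sup>2 - (max 0 x)\<^sup>2) / (z - x))" for z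
    show "(max 0 z)\<^sup>2 - (max 0 x)\<^sup>2 = g z * (z - x)" for z by (simp add: g_def)
    show "g x = 2 * max 0 x" by (simp add: g_def)
    have "\<bar>g z - 2 * max 0 x\<bar> \<le> \<bar>z - x\<bar>" for z
    proof (cases "z = x")
      case False
      define d where "d = (max 0 z)\<^sup>2 - (max 0 x)\<^sup>2 - 2 * max 0 x * (z - x)"
      have sq: "(z - x)\<^sup>2 = z\<^sup>2 + (x\<^sup>2 - 2 * (x * z))" by (simp add: power2_eq_square algebra_simps)
      have "\<bar>d\<bar> \<le> (z - x)\<^sup>2"
      proof (cases "z \<ge> 0"; cases "x \<ge> 0")
        assume "z \<ge> 0" "x \<ge> 0"
        then have "d = (z - x)\<^sup>2" unfolding d_def sq by (simp add: power2_eq_square algebra_simps)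
        then show ?thesis by simp
      next
        assume a: "z \<ge> 0" "\<not> x \<ge> 0"
        then have "z * z \<le> (z - x) * (z - x)" by (intro mult_mono) auto
        then show ?thesis using a by (simp add: d_def max_def power2_eq_square)
      next
        assume a: "\<not> z \<ge> 0" "x \<ge> 0"
        then have "d = x\<^sup>2 - 2 * (x * z)" by (simp add: d_def power2_eq_square algebra_simps)
        moreover have "x * z \<le> 0" using a by (simp add: mult_nonneg_nonpos)
        moreover have "0 \<le> z\<^sup>2" "0 \<le> x\<^sup>2" by auto
        ultimately show ?thesis unfolding sq by linarith
      qed (auto simp: d_def max_def)
      moreover have "g z - 2 * max 0 x = d / (z - x)" using False by (simp add: g_def d_def field_simps)
      ultimately show ?thesis using False by (simp add: abs_divide divide_le_eq power2_eq_square flip: abs_mult)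
    qed (simp add: g_def)
    then show "isCont g x"
      unfolding isCont_def LIM_def
      by (auto simp: dist_real_def g_def[of x] intro: le_less_trans)
  qed
  have "((\<lambda>x. x - c) has_real_derivative 1) (at x)" by (auto intro!: derivative_eq_intros)
  from DERIV_chain2[where f = "\<lambda>x. (max 0 x)\<^sup>2" and g = "\<lambda>x. x - c", OF base[of "x - c"] this]
  show ?thesis by simp
qed

lemma bump_deriv: "(bump h has_real_derivative tent h x) (at x)"
proof -
  have "((\<lambda>x. (max 0 (x - 0))\<^sup>2 - 2 * (max 0 (x - h / 2))\<^sup>2 + (max 0 (x - h))\<^sup>2) has_real_derivative
      2 * max 0 (x - 0) - 2 * (2 * max 0 (x - h / 2)) + 2 * max 0 (x - h)) (at x)"
    by (intro DERIV_add DERIV_diff DERIV_cmult has_derivative_square_pos_part)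
  then show ?thesis by (simp add: bump_def[abs_def] tent_def)
qed

lemma tent_nonneg: "h > 0 \<Longrightarrow> tent h x \<ge> 0"
  and tent_left: "h > 0 \<Longrightarrow> x \<le> 0 \<Longrightarrow> tent h x = 0"
  and tent_right: "h > 0 \<Longrightarrow> x \<ge> h \<Longrightarrow> tent h x = 0"
  and bump_left: "h > 0 \<Longrightarrow> x \<le> 0 \<Longrightarrow> bump h x = 0"
  and bump_right: "h > 0 \<Longrightarrow> x \<ge> h \<Longrightarrow> bump h x = h\<^sup>2 / 2"
  by (auto simp: tent_def bump_def max_def power2_eq_square field_simps)

lemma bump_mono: "h > 0 \<Longrightarrow> x \<le> y \<Longrightarrow> bump h x \<le> bump h y"
  using DERIV_nonneg_imp_nondecreasing[of x y "bump h"] bump_deriv tent_nonneg by blast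

text \<open>
  The weight \<open>tent h (x - c)\<close> has integral \<open>h\<^sup>2 / 2\<close> and is concentrated on \<open>[c, c + h]\<close>.
\<close>

lemma tent_average:
  fixes f :: "real \<Rightarrow> real"
  assumes h: "h > 0" and c: "0 \<le> c" "c + h \<le> T" and f: "continuous_on {0..T} f"
    and close: "\<And>x. x \<in> {c..c+h} \<Longrightarrow> \<bar>f x - k\<bar> \<le> \<epsilon>"
  shows "\<bar>integral {0..T} (\<lambda>x. tent h (x - c) * f x) - h\<^sup>2 / 2 * k\<bar> \<le> h\<^sup>2 / 2 * \<epsilon>"
proof -
  have ft: "((\<lambda>x. tent h (x - c)) has_integral (bump h (T - c) - bump h (0 - c))) {0..T}"
  proof (rule fundamental_theorem_of_calculus)
    fix x assume "x \<in> {0..T}"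
    have "((\<lambda>x. bump h (x - c)) has_real_derivative tent h (x - c) * (1 - 0)) (at x within {0..T})"
      by (rule DERIV_chain2[OF bump_deriv]) (auto intro!: derivative_eq_intros)
    then show "((\<lambda>x. bump h (x - c)) has_vector_derivative tent h (x - c)) (at x within {0..T})"
      by (simp add: has_real_derivative_iff_has_vector_derivative)
  qed (use h c in auto)
  then have I: "((\<lambda>x. tent h (x - c)) has_integral (h\<^sup>2 / 2)) {0..T}"
    using bump_right[OF h, of "T - c"] bump_left[OF h, of "- c"] c by simp
  have cont: "continuous_on {0..T} (\<lambda>x. tent h (x - c))"
    unfolding tent_def by (intro continuous_intros)
  have int: "(\<lambda>x. tent h (x - c) * f x) integrable_on {0..T}"
    by (intro integrable_continuous_real continuous_intros cont f)
  have "(\<lambda>x. tent h (x - c) * f x - tent h (x - c) * k) integrable_on {0..T}"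
    by (intro integrable_continuous_real continuous_intros cont f)
  then have "norm (integral {0..T} (\<lambda>x. tent h (x - c) * f x - tent h (x - c) * k))
      \<le> integral {0..T} (\<lambda>x. tent h (x - c) * \<epsilon>)"
  proof (rule integral_norm_bound_integral)
    show "(\<lambda>x. tent h (x - c) * \<epsilon>) integrable_on {0..T}"
      by (intro integrable_continuous_real continuous_intros cont)
    fix x assume "x \<in> {0..T}"
    show "norm (tent h (x - c) * f x - tent h (x - c) * k) \<le> tent h (x - c) * \<epsilon>"
    proof (cases "x \<in> {c..c+h}")
      case True
      have "norm (tent h (x - c) * f x - tent h (x - c) * k) = tent h (x - c) * \<bar>f x - k\<bar>"
        using tent_nonneg[OF h] by (simp add: abs_mult flip: right_diff_distrib)
      then show ?thesis using close[OF True] tent_nonneg[OF h] by (simp add: mult_left_mono)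
    next
      case False
      then have "tent h (x - c) = 0" using tent_left[OF h, of "x - c"] tent_right[OF h, of "x - c"] by force
      then show ?thesis by simp
    qed
  qed
  moreover have "integral {0..T} (\<lambda>x. tent h (x - c) * f x - tent h (x - c) * k)
      = integral {0..T} (\<lambda>x. tent h (x - c) * f x) - h\<^sup>2 / 2 * k"
    using Henstock_Kurzweil_Integration.integral_diff[OF int has_integral_integrable[OF has_integral_mult_left[OF I, of k]]]
      integral_unique[OF has_integral_mult_left[OF I, of k]] by simp
  moreover have "integral {0..T} (\<lambda>x. tent h (x - c) * \<epsilon>) = h\<^sup>2 / 2 * \<epsilon>"
    using integral_unique[OF has_integral_mult_left[OF I, of \<epsilon>]] .
  ultimately show ?thesis by (simp only: real_norm_def)
qed

text \<open>
  Testing the weak derivative with a trapezoid that rises near \<open>s\<close> and falls near \<open>t\<close> gives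
  \<open>\<langle>u t - u s, w\<rangle>\<close> in the limit of steep slopes. The dominating function \<open>1 + \<parallel>v\<parallel>\<^sup>2\<close> is used instead
  of \<open>\<parallel>v\<parallel>\<close> because its integrability needs no further argument.
\<close>

lemma weak_derivative_increment:
  fixes u v :: "real \<Rightarrow> 'h::real_inner"
  assumes wd: "has_weak_derivative_on u v T" and v: "L2_on {0<..<T} v"
    and u: "continuous_on {0..T} u" and st: "0 < s" "s < t" "t < T"
  shows "norm (u t - u s) \<le> integral {s..t} (\<lambda>x. 1 + (norm (v x))\<^sup>2)"
    and "(\<lambda>x. 1 + (norm (v x))\<^sup>2) integrable_on {0..T}"
proof -
  define V where "V x = 1 + (norm (v x))\<^sup>2" for x
  have Vint: "set_integrable lebesgue {0<..<T} V"
  proof -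
    have "set_integrable lebesgue {0<..<T} (\<lambda>x. 1 :: real)"
      using st by (intro absolutely_integrable_on_const) auto
    then show ?thesis
      unfolding V_def using v unfolding L2_on_def by (intro set_integral_add(1)) auto
  qed
  have Vn: "V x \<ge> 0" for x by (simp add: V_def)
  have "V integrable_on {0<..<T}" using set_lebesgue_integral_eq_integral(1)[OF Vint] .
  then show VI: "(\<lambda>x. 1 + (norm (v x))\<^sup>2) integrable_on {0..T}"
    unfolding V_def[symmetric, abs_def] by (simp add: integrable_on_open_interval_real)
  have Vst: "set_integrable lebesgue {s..t} V"
    by (rule set_integrable_subset[OF Vint]) (use st in auto)
  define I where "I = integral {s..t} V"
  have I: "I = (LINT x:{s..t}|lebesgue. V x)"
    unfolding I_def using set_lebesgue_integral_eq_integral(2)[OF Vst] by simp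
  have key: "\<bar>(u s - u t) \<bullet> w\<bar> \<le> norm w * I + 2 * \<epsilon>" if \<epsilon>: "\<epsilon> > 0" for w \<epsilon>
  proof -
    define f where "f x = u x \<bullet> w" for x
    have f: "continuous_on {0..T} f" unfolding f_def by (intro continuous_intros u)
    have "\<exists>\<delta>>0. \<forall>x\<in>{0..T}. \<bar>x - r\<bar> < \<delta> \<longrightarrow> \<bar>f x - f r\<bar> \<le> \<epsilon>" if "r \<in> {0..T}" for r
      using f that \<epsilon> unfolding continuous_on_iff dist_real_def by (meson less_imp_le)
    from this[of s] this[of t] obtain \<delta>s \<delta>t where
      \<delta>: "\<delta>s > 0" "\<And>x. x \<in> {0..T} \<Longrightarrow> \<bar>x - s\<bar> < \<delta>s \<Longrightarrow> \<bar>f x - f s\<bar> \<le> \<epsilon>"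
      "\<delta>t > 0" "\<And>x. x \<in> {0..T} \<Longrightarrow> \<bar>x - t\<bar> < \<delta>t \<Longrightarrow> \<bar>f x - f t\<bar> \<le> \<epsilon>"
      using st by auto
    \<comment> \<open>The slopes must be short enough for \<open>f\<close> to be nearly constant on them, and disjoint.\<close>
    define h where "h = min (\<delta>s / 2) (min (\<delta>t / 2) ((t - s) / 2))"
    have h: "h > 0" "h < \<delta>s" "h < \<delta>t" "2 * h \<le> t - s"
      using \<delta> st by (auto simp: h_def min_def)
    define c where "c = h\<^sup>2 / 2"
    have c: "c > 0" using h by (simp add: c_def)
    define \<phi> where "\<phi> x = (bump h (x - s) - bump h (x - (t - h))) / c" for x
    define \<psi> where "\<psi> x = (tent h (x - s) - tent h (x - (t - h))) / c" for x
    have d\<phi>: "(\<phi> has_real_derivative \<psi> x) (at x)" for x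
    proof -
      have "((\<lambda>x. bump h (x - a)) has_real_derivative tent h (x - a) * (1 - 0)) (at x)" for a
        by (rule DERIV_chain2[OF bump_deriv]) (auto intro!: derivative_eq_intros)
      then show ?thesis
        unfolding \<phi>_def[abs_def] \<psi>_def by (intro DERIV_cdivide DERIV_diff) auto
    qed
    have "\<phi> C1_differentiable_on UNIV"
      unfolding C1_differentiable_on_def
    proof (intro exI conjI ballI)
      show "(\<phi> has_vector_derivative \<psi> x) (at x)" for x
        using d\<phi> by (simp add: has_real_derivative_iff_has_vector_derivative)
      show "continuous_on UNIV \<psi>" unfolding \<psi>_def tent_def by (intro continuous_intros) (use c in auto)
    qed
    moreover have "\<phi> x = 0" if "x \<notin> {s..t}" for x
      using that h bump_left[OF h(1), of "x - s"] bump_left[OF h(1), of "x - (t - h)"]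
        bump_right[OF h(1), of "x - s"] bump_right[OF h(1), of "x - (t - h)"]
      by (auto simp: \<phi>_def not_le)
    ultimately have "(LINT x:{0<..<T}|lebesgue. deriv \<phi> x * (u x \<bullet> w))
        = - (LINT x:{0<..<T}|lebesgue. \<phi> x * (v x \<bullet> w))"
      using wd st unfolding has_weak_derivative_on_def by blast
    then have weak: "\<bar>LINT x:{0<..<T}|lebesgue. \<psi> x * f x\<bar> = \<bar>LINT x:{0<..<T}|lebesgue. \<phi> x * (v x \<bullet> w)\<bar>"
      using DERIV_imp_deriv[OF d\<phi>] by (simp add: f_def)
    have \<phi>1: "\<bar>\<phi> x\<bar> \<le> indicator {s..t} x" for x
    proof (cases "x \<in> {s..t}")
      case True
      have "bump h (x - (t - h)) \<le> bump h (x - s)" using h by (intro bump_mono) auto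
      moreover have "bump h (x - s) \<le> c"
        using bump_mono[OF h(1), of "x - s" "max h (x - s)"] bump_right[OF h(1), of "max h (x - s)"]
        by (simp add: c_def)
      moreover have "0 \<le> bump h (x - (t - h))"
        using bump_mono[OF h(1), of "min 0 (x - (t - h))" "x - (t - h)"]
          bump_left[OF h(1), of "min 0 (x - (t - h))"] by simp
      ultimately show ?thesis using True c by (simp add: \<phi>_def)
    next
      case False
      then show ?thesis using \<open>\<And>x. x \<notin> {s..t} \<Longrightarrow> \<phi> x = 0\<close> by simp
    qed
    have "\<bar>LINT x:{0<..<T}|lebesgue. \<phi> x * (v x \<bullet> w)\<bar>
        \<le> (LINT x|lebesgue. norm (indicator {0<..<T} x *\<^sub>R (\<phi> x * (v x \<bullet> w))))"
      unfolding set_lebesgue_integral_def real_norm_def[symmetric] by (rule integral_norm_bound)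
    also have "\<dots> \<le> (LINT x|lebesgue. norm w * (indicator {s..t} x *\<^sub>R V x))"
    proof (rule integral_mono')
      show "integrable lebesgue (\<lambda>x. norm w * (indicator {s..t} x *\<^sub>R V x))"
        using Vst unfolding set_integrable_def by simp
      show "0 \<le> norm w * (indicator {s..t} x *\<^sub>R V x)" for x using Vn by simp
      fix x
      have "norm (v x) \<le> V x"
        using zero_le_power2[of "norm (v x) - 1/2"] by (simp add: V_def power2_eq_square algebra_simps)
      then have "\<bar>v x \<bullet> w\<bar> \<le> V x * norm w"
        using Cauchy_Schwarz_ineq2[of "v x" w] mult_right_mono[of "norm (v x)" "V x" "norm w"] by simp
      then have "\<bar>\<phi> x\<bar> * \<bar>v x \<bullet> w\<bar> \<le> indicator {s..t} x * (V x * norm w)"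
        using \<phi>1[of x] by (intro mult_mono) auto
      then show "norm (indicator {0<..<T} x *\<^sub>R (\<phi> x * (v x \<bullet> w))) \<le> norm w * (indicator {s..t} x *\<^sub>R V x)"
        using Vn[of x] by (auto simp: abs_mult mult_ac split: split_indicator)
    qed
    also have "\<dots> = norm w * I" by (simp add: I set_lebesgue_integral_def)
    finally have R: "\<bar>LINT x:{0<..<T}|lebesgue. \<phi> x * (v x \<bullet> w)\<bar> \<le> norm w * I" .
    have cont: "continuous_on {0..T} (\<lambda>x. tent h (x - a) * f x)" for a
      unfolding tent_def by (intro continuous_intros f)
    have "continuous_on {0..T} (\<lambda>x. \<psi> x * f x)"
      unfolding \<psi>_def tent_def by (intro continuous_intros f) (use c in auto)
    then have "set_integrable lebesgue {0..T} (\<lambda>x. \<psi> x * f x)"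
      by (rule absolutely_integrable_continuous_real)
    then have "set_integrable lebesgue {0<..<T} (\<lambda>x. \<psi> x * f x)"
      by (rule set_integrable_subset) auto
    then have L0: "(LINT x:{0<..<T}|lebesgue. \<psi> x * f x) = integral {0..T} (\<lambda>x. \<psi> x * f x)"
      using set_lebesgue_integral_eq_integral(2) integral_open_interval_real by metis
    have "integral {0..T} (\<lambda>x. \<psi> x * f x)
        = integral {0..T} (\<lambda>x. (tent h (x - s) * f x - tent h (x - (t - h)) * f x) / c)"
      by (rule arg_cong[where f = "integral {0..T}"]) (auto simp: \<psi>_def field_simps)
    also have "\<dots> = (integral {0..T} (\<lambda>x. tent h (x - s) * f x)
        - integral {0..T} (\<lambda>x. tent h (x - (t - h)) * f x)) / c"
      by (simp add: integral_divide Henstock_Kurzweil_Integration.integral_diff integrable_continuous_real cont)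
    finally have L: "(LINT x:{0<..<T}|lebesgue. \<psi> x * f x) * c = integral {0..T} (\<lambda>x. tent h (x - s) * f x)
        - integral {0..T} (\<lambda>x. tent h (x - (t - h)) * f x)" using c L0 by simp
    have 1: "\<bar>integral {0..T} (\<lambda>x. tent h (x - s) * f x) - c * f s\<bar> \<le> c * \<epsilon>"
      unfolding c_def by (rule tent_average[OF h(1) _ _ f]) (use st h \<delta>(2) in auto)
    have 2: "\<bar>integral {0..T} (\<lambda>x. tent h (x - (t - h)) * f x) - c * f t\<bar> \<le> c * \<epsilon>"
      unfolding c_def by (rule tent_average[OF h(1) _ _ f]) (use st h \<delta>(4) in auto)
    have "\<bar>c * (f s - f t)\<bar> \<le> \<bar>(LINT x:{0<..<T}|lebesgue. \<psi> x * f x) * c\<bar> + 2 * (c * \<epsilon>)"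
      unfolding L using 1 2 by (simp add: right_diff_distrib)
    also have "\<dots> = c * (\<bar>LINT x:{0<..<T}|lebesgue. \<psi> x * f x\<bar> + 2 * \<epsilon>)"
      using c by (simp add: abs_mult algebra_simps)
    finally have "c * \<bar>f s - f t\<bar> \<le> c * (\<bar>LINT x:{0<..<T}|lebesgue. \<psi> x * f x\<bar> + 2 * \<epsilon>)"
      using c by (simp add: abs_mult)
    then have "\<bar>f s - f t\<bar> \<le> \<bar>LINT x:{0<..<T}|lebesgue. \<psi> x * f x\<bar> + 2 * \<epsilon>" using c by simp
    then show ?thesis using weak R by (simp add: f_def inner_diff_left)
  qed
  have "\<bar>(u s - u t) \<bullet> w\<bar> \<le> norm w * I" for w
    by (rule field_le_epsilon) (use key[of "_ / 2" w] in fastforce)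
  from this[of "u s - u t"] have "norm (u s - u t) * norm (u s - u t) \<le> norm (u s - u t) * I"
    by (simp add: power2_norm_eq_inner[symmetric] power2_eq_square)
  moreover have "I \<ge> 0" unfolding I_def
    by (intro Henstock_Kurzweil_Integration.integral_nonneg set_lebesgue_integral_eq_integral(1)[OF Vst]) (use Vn in auto)
  ultimately have "norm (u s - u t) \<le> I" by (cases "u s = u t") auto
  then show "norm (u t - u s) \<le> integral {s..t} (\<lambda>x. 1 + (norm (v x))\<^sup>2)"
    by (simp add: I_def V_def[abs_def] norm_minus_commute)
qed


section \<open>Energy inequalities for strong solutions\<close>

context discrete_operator
begin

definition energy :: "(nat \<Rightarrow> real) \<Rightarrow> 'a \<Rightarrow> real" where
  "energy c x = (\<Sum>n. c n * (norm (P n x))\<^sup>2)"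

text \<open>
  The weights for which the quadratic form \<open>energy c\<close> is bounded on the domain of \<open>A\<^sup>1\<^sup>/\<^sup>2\<close>.
\<close>

definition dominated :: "(nat \<Rightarrow> real) \<Rightarrow> bool" where
  "dominated c \<longleftrightarrow> (\<exists>C. \<forall>n. \<bar>c n\<bar> \<le> C * (1 + e n))"

lemma dominatedI: "(\<And>n. \<bar>c n\<bar> \<le> C * (1 + e n)) \<Longrightarrow> dominated c"
  unfolding dominated_def by blast

lemma bessel: "finite I \<Longrightarrow> (\<Sum>n\<in>I. (norm (P n x))\<^sup>2) \<le> (norm x)\<^sup>2"
  using sum_le_suminf[OF sums_summable[OF parseval_norm[of x]], of I] parseval_norm[of x]
  by (simp add: sums_iff)

lemma norm_P_le: "norm (P n x) \<le> norm x"
  unfolding P_def by (intro norm_orthogonal_projection_le subspace_eigenspace closed_eigenspace)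

lemma one_plus_e_sums:
  assumes "x \<in> dom_power D A (1/2)"
  shows "(\<lambda>n. (1 + e n) * (norm (P n x))\<^sup>2) sums ((norm x)\<^sup>2 + (norm (op_power D A (1/2) x))\<^sup>2)"
proof -
  have "(\<lambda>n. (norm (P n x))\<^sup>2 + (norm (P n (op_power D A (1/2) x)))\<^sup>2)
      sums ((norm x)\<^sup>2 + (norm (op_power D A (1/2) x))\<^sup>2)"
    by (intro sums_add parseval_norm)
  moreover have "(norm (P n (op_power D A (1/2) x)))\<^sup>2 = e n * (norm (P n x))\<^sup>2" for n
    using e_nonneg[of n] by (simp add: P_op_sqrt[OF assms] power_mult_distrib)
  ultimately show ?thesis by (simp add: distrib_right)
qed

lemma energy_sums:
  assumes x: "x \<in> dom_power D A (1/2)" and c: "dominated c"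
  shows "(\<lambda>n. c n * (norm (P n x))\<^sup>2) sums energy c x"
proof -
  obtain C where C: "\<And>n. \<bar>c n\<bar> \<le> C * (1 + e n)" using c unfolding dominated_def by blast
  have "summable (\<lambda>n. c n * (norm (P n x))\<^sup>2)"
  proof (rule summable_comparison_test'[of "\<lambda>n. C * ((1 + e n) * (norm (P n x))\<^sup>2)" 0])
    show "summable (\<lambda>n. C * ((1 + e n) * (norm (P n x))\<^sup>2))"
      by (intro summable_mult sums_summable[OF one_plus_e_sums[OF x]])
    show "norm (c n * (norm (P n x))\<^sup>2) \<le> C * ((1 + e n) * (norm (P n x))\<^sup>2)" for n
      using mult_right_mono[OF C[of n], of "(norm (P n x))\<^sup>2"] by (simp add: abs_mult mult.assoc)
  qed
  then show ?thesis by (simp add: energy_def summable_sums)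
qed

lemma bounded_multiplier:
  assumes b: "\<And>n. \<bar>b n\<bar> \<le> C"
  shows "\<exists>B. bounded_linear B \<and> (\<forall>n x. P n (B x) = b n *\<^sub>R P n x)"
proof -
  have b2: "(b n)\<^sup>2 \<le> C\<^sup>2" for n using b[of n] by (meson abs_ge_zero abs_le_square_iff order.trans abs_ge_self)
  have "\<exists>y. \<forall>n. P n y = b n *\<^sub>R P n x" for x
  proof -
    have "summable (\<lambda>n. (b n)\<^sup>2 * (norm (P n x))\<^sup>2)"
      by (rule summable_bounded_multiplier[of _ "C\<^sup>2"]) (use b2 in simp)
    from multiplier_exists[OF this] show ?thesis by blast
  qed
  then obtain B where B: "\<And>n x. P n (B x) = b n *\<^sub>R P n x" by metis
  have C0: "C \<ge> 0" using b[of 0] by linarith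
  have "bounded_linear B"
  proof (rule bounded_linear_intro[where K = C])
    show "B (x + y) = B x + B y" for x y by (rule eq_by_P) (simp add: B P.add algebra_simps)
    show "B (r *\<^sub>R x) = r *\<^sub>R B x" for r x by (rule eq_by_P) (simp add: B P.scaleR algebra_simps)
    fix x
    have "(norm (B x))\<^sup>2 \<le> C\<^sup>2 * (norm x)\<^sup>2"
    proof (rule sums_le[OF _ parseval_norm sums_mult[OF parseval_norm]])
      show "(norm (P n (B x)))\<^sup>2 \<le> C\<^sup>2 * (norm (P n x))\<^sup>2" for n
        using b2[of n] by (simp add: B power_mult_distrib mult_right_mono)
    qed
    then have "(norm (B x))\<^sup>2 \<le> (norm x * C)\<^sup>2" by (simp add: power_mult_distrib mult.commute)
    then show "norm (B x) \<le> norm x * C" by (rule power2_le_imp_le) (use C0 in simp)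
  qed
  then show ?thesis using B by blast
qed

text \<open>
  With the bounded operator \<open>B\<close> that multiplies the modes by \<open>c / (1 + e)\<close>, the form \<open>energy c\<close> at
  \<open>x\<close> is \<open>\<langle>B x, x\<rangle> + \<langle>B A\<^sup>1\<^sup>/\<^sup>2 x, A\<^sup>1\<^sup>/\<^sup>2 x\<rangle>\<close>.
\<close>

lemma continuous_on_energy:
  assumes u: "continuous_on I u" "continuous_on I (\<lambda>t. op_power D A (1/2) (u t))"
    "\<And>t. t \<in> I \<Longrightarrow> u t \<in> dom_power D A (1/2)" and c: "dominated c"
  shows "continuous_on I (\<lambda>t. energy c (u t))"
proof -
  obtain C where C: "\<And>n. \<bar>c n\<bar> \<le> C * (1 + e n)" using c unfolding dominated_def by blast
  have "\<bar>c n / (1 + e n)\<bar> \<le> C" for n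
    using C[of n] e_nonneg[of n] by (simp add: abs_divide divide_le_eq)
  from bounded_multiplier[of "\<lambda>n. c n / (1 + e n)", OF this] obtain B where B: "bounded_linear B"
    "\<And>n x. P n (B x) = (c n / (1 + e n)) *\<^sub>R P n x" by blast
  let ?S = "op_power D A (1/2)"
  have "energy c (u t) = B (u t) \<bullet> u t + B (?S (u t)) \<bullet> ?S (u t)" if "t \<in> I" for t
  proof (rule sums_unique2[OF energy_sums[OF u(3)[OF that] c]])
    have "(\<lambda>n. P n (B (u t)) \<bullet> P n (u t) + P n (B (?S (u t))) \<bullet> P n (?S (u t)))
        sums (B (u t) \<bullet> u t + B (?S (u t)) \<bullet> ?S (u t))"
      by (intro sums_add parseval)
    moreover have "P n (B (u t)) \<bullet> P n (u t) + P n (B (?S (u t))) \<bullet> P n (?S (u t))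
        = c n * (norm (P n (u t)))\<^sup>2" for n
    proof -
      have "P n (B (u t)) \<bullet> P n (u t) + P n (B (?S (u t))) \<bullet> P n (?S (u t))
          = c n / (1 + e n) * (1 + e n) * (norm (P n (u t)))\<^sup>2"
        using e_nonneg[of n]
        by (simp add: B(2) P_op_sqrt[OF u(3)[OF that]] power2_norm_eq_inner algebra_simps add_divide_distrib)
      then show ?thesis using e_nonneg[of n] by simp
    qed
    ultimately show "(\<lambda>n. c n * (norm (P n (u t)))\<^sup>2) sums (B (u t) \<bullet> u t + B (?S (u t)) \<bullet> ?S (u t))"
      by simp
  qed
  moreover have "continuous_on I (\<lambda>t. B (u t) \<bullet> u t + B (?S (u t)) \<bullet> ?S (u t))"
    by (intro continuous_intros u bounded_linear.continuous_on[OF B(1)])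
  ultimately show ?thesis using continuous_on_cong[of I I] by simp
qed

end

locale parabolic_solution = discrete_operator D A e
  for D :: "'a::{real_inner, complete_space} set" and A e +
  fixes g u :: "real \<Rightarrow> 'a" and G :: "real \<Rightarrow> real"
  assumes u_continuous: "continuous_into_dom_power D A (1/2) {0..} u"
    and u_solution: "strong_solution D A g u"
    and G_continuous: "continuous_on {0..} G"
    and g_le_G: "\<And>t. t \<ge> 0 \<Longrightarrow> norm (g t) \<le> G t"
begin

lemma u_dom: "t \<ge> 0 \<Longrightarrow> u t \<in> dom_power D A (1/2)"
  and continuous_on_u: "I \<subseteq> {0..} \<Longrightarrow> continuous_on I u"
  and continuous_on_sqrt_u: "I \<subseteq> {0..} \<Longrightarrow> continuous_on I (\<lambda>t. op_power D A (1/2) (u t))"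
  and continuous_on_G: "I \<subseteq> {0..} \<Longrightarrow> continuous_on I G"
proof -
  have *: "continuous_on {0..} (\<lambda>t. (u t, op_power D A (1/2) (u t)))" "\<And>t. t \<ge> 0 \<Longrightarrow> u t \<in> dom_power D A (1/2)"
    using u_continuous by (auto simp: continuous_into_dom_power_def)
  show "t \<ge> 0 \<Longrightarrow> u t \<in> dom_power D A (1/2)" by (rule *(2))
  show "I \<subseteq> {0..} \<Longrightarrow> continuous_on I u"
    using continuous_on_fst[OF *(1)] by (auto intro: continuous_on_subset)
  show "I \<subseteq> {0..} \<Longrightarrow> continuous_on I (\<lambda>t. op_power D A (1/2) (u t))"
    using continuous_on_snd[OF *(1)] by (auto intro: continuous_on_subset)
  show "I \<subseteq> {0..} \<Longrightarrow> continuous_on I G" using G_continuous by (rule continuous_on_subset)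
qed

lemma continuous_on_energy_u: "I \<subseteq> {0..} \<Longrightarrow> dominated c \<Longrightarrow> continuous_on I (\<lambda>t. energy c (u t))"
  by (intro continuous_on_energy continuous_on_u continuous_on_sqrt_u u_dom) auto

lemma equation_ae:
  obtains Z where "negligible Z"
    "\<And>t. t \<ge> 0 \<Longrightarrow> t \<notin> Z \<Longrightarrow> \<exists>u'. (u has_vector_derivative u') (at t) \<and> (\<forall>n. P n u' = P n (g t) - e n *\<^sub>R P n (u t))"
proof -
  have "AE t in lebesgue. t > 0 \<longrightarrow> (\<exists>u'. (u has_vector_derivative u') (at t) \<and> u t \<in> D \<and> u' + A (u t) = g t)"
    using u_solution by (simp add: strong_solution_def)
  then obtain N where N: "N \<in> null_sets lebesgue"
    "\<And>t. t \<notin> N \<Longrightarrow> t > 0 \<Longrightarrow> \<exists>u'. (u has_vector_derivative u') (at t) \<and> u t \<in> D \<and> u' + A (u t) = g t"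
    by (rule AE_E3) auto
  show ?thesis
  proof (rule that)
    show "negligible (insert 0 N)" using N(1) by (simp add: negligible_iff_null_sets)
    fix t :: real assume t: "t \<ge> 0" "t \<notin> insert 0 N"
    then obtain u' where u': "(u has_vector_derivative u') (at t)" "u t \<in> D" "u' + A (u t) = g t"
      using N(2)[of t] by (auto simp: le_less)
    have "P n u' = P n (g t) - e n *\<^sub>R P n (u t)" for n
      unfolding u'(3)[symmetric] by (simp add: P.add P_A u'(2))
    then show "\<exists>u'. (u has_vector_derivative u') (at t) \<and> (\<forall>n. P n u' = P n (g t) - e n *\<^sub>R P n (u t))"
      using u'(1) by blast
  qed
qed

text \<open>
  The weak derivative bounds the increments inside the open interval; the left endpoint \<open>0\<close> is
  reached by continuity, the right endpoint \<open>T\<close> by using the interval \<open>(0, T + 1)\<close>.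
\<close>

lemma u_increment:
  assumes T: "T > 0"
  obtains V where "V integrable_on {0..T}"
    "\<And>s t. 0 \<le> s \<Longrightarrow> s \<le> t \<Longrightarrow> t \<le> T \<Longrightarrow> norm (u t - u s) \<le> integral {s..t} V"
proof -
  have "W12_on (T + 1) u" using u_solution T by (simp add: strong_solution_def)
  then obtain v where v: "L2_on {0<..<T+1} v" "has_weak_derivative_on u v (T + 1)"
    unfolding W12_on_def by blast
  define V where "V x = 1 + (norm (v x))\<^sup>2" for x
  note inc = weak_derivative_increment[OF v(2,1) continuous_on_u, folded V_def]
  have Vi: "V integrable_on {0..T+1}"
    using inc(2)[of "T/2" T] T unfolding V_def[abs_def] by auto
  have Vi': "V integrable_on {s..t}" if "0 \<le> s" "t \<le> T + 1" for s t
    by (rule integrable_on_subinterval[OF Vi]) (use that in auto)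
  have pos: "norm (u t - u s) \<le> integral {s..t} V" if "0 < s" "s < t" "t \<le> T" for s t
    using inc(1)[of s t] that by auto
  show ?thesis
  proof (rule that)
    show "V integrable_on {0..T}" by (rule Vi') auto
    fix s t assume st: "0 \<le> s" "s \<le> t" "t \<le> T"
    consider "s = t" | "0 < s" "s < t" | "s = 0" "s < t" using st by linarith
    then show "norm (u t - u s) \<le> integral {s..t} V"
    proof cases
      case 3
      have "(u \<longlongrightarrow> u 0) (at 0 within {0..t})"
        using continuous_on_u[of "{0..t}"] 3 by (simp add: continuous_on_def)
      then have lim: "((\<lambda>r. norm (u t - u r)) \<longlongrightarrow> norm (u t - u 0)) (at_right 0)"
        using 3 by (intro tendsto_intros) (simp add: at_within_Icc_at_right)
      have "norm (u t - u 0) \<le> integral {0..t} V"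
      proof (rule tendsto_upperbound[OF lim])
        have "norm (u t - u r) \<le> integral {0..t} V" if "r \<in> {0<..<t}" for r
        proof -
          have "norm (u t - u r) \<le> integral {r..t} V" using pos that st by auto
          also have "\<dots> \<le> integral {0..t} V"
            using that st by (intro integral_subset_le Vi') (auto simp: V_def)
          finally show ?thesis .
        qed
        then show "\<forall>\<^sub>F r in at_right 0. norm (u t - u r) \<le> integral {0..t} V"
          using 3 by (intro eventually_at_rightI[of 0 t]) auto
      qed simp
      then show ?thesis using 3 by simp
    qed (use pos st in auto)
  qed
qed

lemma u_bounded:
  assumes "T \<ge> 0"
  obtains M where "M > 0" "\<And>t. 0 \<le> t \<Longrightarrow> t \<le> T \<Longrightarrow> norm (u t) \<le> M"
proof -
  have "compact (u ` {0..T})" by (intro compact_continuous_image continuous_on_u) auto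
  then obtain M where M: "\<forall>x\<in>u ` {0..T}. norm x \<le> M" using compact_imp_bounded bounded_iff by blast
  show ?thesis by (rule that[of "max M 1"]) (use M in \<open>auto simp: le_max_iff_disj\<close>)
qed

text \<open>
  Writing the solution in eigenspaces, each mode satisfies
  \<open>d/dt (c \<parallel>u\<^sub>n\<parallel>\<^sup>2) = 2 c \<langle>u\<^sub>n, g\<^sub>n\<rangle> - 2 c e\<^sub>n \<parallel>u\<^sub>n\<parallel>\<^sup>2 \<le> d\<^sub>n \<parallel>u\<^sub>n\<parallel>\<^sup>2 + \<theta> \<parallel>g\<^sub>n\<parallel>\<^sup>2\<close>; the modes are
  summed up to \<open>N\<close> first because the integrand for \<open>N = \<infinity>\<close> involves \<open>A u\<close>, which is defined
  only almost everywhere, whereas the bound only involves continuous functions.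
\<close>

lemma energy_inequality:
  assumes c: "dominated c" and d: "dominated d" and th: "\<theta> > 0"
    and cd: "\<And>n. (c n)\<^sup>2 / \<theta> - 2 * c n * e n \<le> d n" and st: "0 \<le> s" "s \<le> t"
  shows "energy c (u t) - energy c (u s) \<le> integral {s..t} (\<lambda>r. energy d (u r) + \<theta> * (G r)\<^sup>2)"
proof (cases "s = t")
  case False
  then have st': "s < t" "t > 0" using st by auto
  obtain Z where Z: "negligible Z" "\<And>r. r \<ge> 0 \<Longrightarrow> r \<notin> Z \<Longrightarrow> \<exists>u'. (u has_vector_derivative u') (at r) \<and>
      (\<forall>n. P n u' = P n (g r) - e n *\<^sub>R P n (u r))" using equation_ae by blast
  obtain V where V: "V integrable_on {0..t}"
    "\<And>p q. 0 \<le> p \<Longrightarrow> p \<le> q \<Longrightarrow> q \<le> t \<Longrightarrow> norm (u q - u p) \<le> integral {p..q} V"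
    using u_increment[OF st'(2)] by blast
  obtain M where M: "M > 0" "\<And>r. 0 \<le> r \<Longrightarrow> r \<le> t \<Longrightarrow> norm (u r) \<le> M"
    using u_bounded[of t] st' by auto
  obtain C where C: "\<And>n. \<bar>d n\<bar> \<le> C * (1 + e n)" using d unfolding dominated_def by blast
  define w where "w n r = (norm (P n (u r)))\<^sup>2" for n r
  define f where "f N r = (\<Sum>n<N. c n * w n r)" for N :: nat and r
  define h where "h N r = (\<Sum>n<N. c n * (2 * (P n (u r) \<bullet> (P n (g r) - e n *\<^sub>R P n (u r)))))" for N :: nat and r
  define k where "k N r = (\<Sum>n<N. d n * w n r)" for N :: nat and r
  have subI: "{s..t} \<subseteq> {0..}" using st by auto
  have cont_w: "continuous_on {s..t} (w n)" for n
    unfolding w_def by (intro continuous_intros P.continuous_on continuous_on_u subI)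
  have dw: "\<bar>w n q - w n p\<bar> \<le> 2 * M * norm (u q - u p)" if "0 \<le> p" "p \<le> t" "0 \<le> q" "q \<le> t" for n p q
  proof -
    have "w n q - w n p = (norm (P n (u q)) - norm (P n (u p))) * (norm (P n (u q)) + norm (P n (u p)))"
      by (simp add: w_def power2_eq_square algebra_simps)
    then have "\<bar>w n q - w n p\<bar> = \<bar>norm (P n (u q)) - norm (P n (u p))\<bar> * (norm (P n (u q)) + norm (P n (u p)))"
      by (simp add: abs_mult)
    also have "\<dots> \<le> norm (P n (u q - u p)) * (M + M)"
    proof (intro mult_mono add_mono)
      show "\<bar>norm (P n (u q)) - norm (P n (u p))\<bar> \<le> norm (P n (u q - u p))"
        unfolding P.diff by (rule norm_triangle_ineq3)
      show "norm (P n (u q)) \<le> M" "norm (P n (u p)) \<le> M"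
        using that by (auto intro: order.trans[OF norm_P_le M(2)])
    qed auto
    also have "\<dots> \<le> norm (u q - u p) * (M + M)"
      using M(1) norm_P_le by (intro mult_right_mono) auto
    finally show ?thesis by (simp add: mult_ac)
  qed
  have "(h N has_integral (f N t - f N s)) {s..t}" for N
  proof -
    define K where "K = (\<Sum>n<N. \<bar>c n\<bar>) * (2 * M)"
    have K: "K \<ge> 0" using M by (simp add: K_def sum_nonneg)
    have V': "V integrable_on {p..q}" if "0 \<le> p" "q \<le> t" for p q
      by (rule integrable_on_subinterval[OF V(1)]) (use that in auto)
    show ?thesis
    proof (rule ftc_dominated[where V = "\<lambda>r. K * V r" and Z = Z])
      show "(\<lambda>r. K * V r) integrable_on {s..t}" using st by (intro integrable_on_mult_right V') auto
      fix p q assume pq: "s \<le> p" "p \<le> q" "q \<le> t"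
      have "\<bar>f N q - f N p\<bar> \<le> (\<Sum>n<N. \<bar>c n * (w n q - w n p)\<bar>)"
        unfolding f_def sum_subtractf[symmetric] right_diff_distrib[symmetric] by (rule sum_abs)
      also have "\<dots> \<le> (\<Sum>n<N. \<bar>c n\<bar> * (2 * M * norm (u q - u p)))"
        unfolding abs_mult using pq st by (intro sum_mono mult_left_mono dw) auto
      also have "\<dots> = K * norm (u q - u p)" by (simp add: K_def mult.assoc flip: sum_distrib_right)
      also have "\<dots> \<le> K * integral {p..q} V" using K V(2)[of p q] pq st by (intro mult_left_mono) auto
      finally show "\<bar>f N q - f N p\<bar> \<le> integral {p..q} (\<lambda>r. K * V r)" by simp
    next
      fix r assume r: "r \<in> {s..t} - Z"
      then obtain u' where u': "(u has_vector_derivative u') (at r)"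
        "\<And>n. P n u' = P n (g r) - e n *\<^sub>R P n (u r)" using Z(2)[of r] st by auto
      have "(w n has_real_derivative 2 * (P n (u r) \<bullet> P n u')) (at r)" for n
      proof -
        have Pu: "((\<lambda>r. P n (u r)) has_vector_derivative P n u') (at r)"
          by (rule P.has_vector_derivative[OF u'(1)])
        have "((\<lambda>r. P n (u r) \<bullet> P n (u r)) has_vector_derivative (P n (u r) \<bullet> P n u' + P n u' \<bullet> P n (u r))) (at r)"
          by (rule bounded_bilinear.has_vector_derivative[OF bounded_bilinear_inner Pu Pu])
        then show ?thesis
          unfolding w_def[abs_def] has_real_derivative_iff_has_vector_derivative
          by (simp add: power2_norm_eq_inner inner_commute)
      qed
      then show "(f N has_real_derivative h N r) (at r)"
        unfolding f_def[abs_def] h_def u'(2)[symmetric] by (intro DERIV_sum DERIV_cmult)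
    qed (use st Z in auto)
  qed
  have hk: "h N r \<le> k N r + \<theta> * (G r)\<^sup>2" if "r \<in> {s..t}" for N r
  proof -
    have "h N r \<le> (\<Sum>n<N. d n * w n r + \<theta> * (norm (P n (g r)))\<^sup>2)"
      unfolding h_def
    proof (rule sum_mono)
      fix n
      have "0 \<le> (norm ((c n / \<theta>) *\<^sub>R P n (u r) - P n (g r)))\<^sup>2" by simp
      also have "\<dots> = (c n)\<^sup>2 / \<theta>\<^sup>2 * w n r - 2 * c n / \<theta> * (P n (u r) \<bullet> P n (g r)) + (norm (P n (g r)))\<^sup>2"
        by (simp add: norm_diff_squared w_def power_mult_distrib power_divide)
      finally have "0 \<le> \<theta> * ((c n)\<^sup>2 / \<theta>\<^sup>2 * w n r - 2 * c n / \<theta> * (P n (u r) \<bullet> P n (g r)) + (norm (P n (g r)))\<^sup>2)"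
        using th by simp
      also have "\<dots> = (c n)\<^sup>2 / \<theta> * w n r - 2 * c n * (P n (u r) \<bullet> P n (g r)) + \<theta> * (norm (P n (g r)))\<^sup>2"
        using th by (simp add: field_simps power2_eq_square)
      finally have "2 * c n * (P n (u r) \<bullet> P n (g r)) - 2 * c n * e n * w n r
          \<le> ((c n)\<^sup>2 / \<theta> - 2 * c n * e n) * w n r + \<theta> * (norm (P n (g r)))\<^sup>2"
        by (simp add: algebra_simps)
      also have "\<dots> \<le> d n * w n r + \<theta> * (norm (P n (g r)))\<^sup>2"
        using cd[of n] by (intro add_right_mono mult_right_mono) (auto simp: w_def)
      finally show "c n * (2 * (P n (u r) \<bullet> (P n (g r) - e n *\<^sub>R P n (u r)))) \<le> d n * w n r + \<theta> * (norm (P n (g r)))\<^sup>2"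
        by (simp add: inner_diff_right w_def power2_norm_eq_inner algebra_simps)
    qed
    also have "\<dots> = k N r + \<theta> * (\<Sum>n<N. (norm (P n (g r)))\<^sup>2)"
      by (simp add: k_def sum.distrib sum_distrib_left)
    also have "(\<Sum>n<N. (norm (P n (g r)))\<^sup>2) \<le> (G r)\<^sup>2"
    proof -
      have "(\<Sum>n<N. (norm (P n (g r)))\<^sup>2) \<le> (norm (g r))\<^sup>2" by (rule bessel) simp
      also have "\<dots> \<le> (G r)\<^sup>2" using g_le_G[of r] that st by (intro power_mono) auto
      finally show ?thesis .
    qed
    finally show ?thesis using th by simp
  qed
  have cont_k: "continuous_on {s..t} (k N)" for N
    unfolding k_def[abs_def] by (intro continuous_intros cont_w)
  have cont_G: "continuous_on {s..t} (\<lambda>r. \<theta> * (G r)\<^sup>2)"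
    by (intro continuous_intros continuous_on_G subI)
  have fin: "f N t - f N s \<le> integral {s..t} (\<lambda>r. k N r + \<theta> * (G r)\<^sup>2)" for N
    by (rule has_integral_le[OF \<open>(h N has_integral (f N t - f N s)) {s..t}\<close> integrable_integral hk])
      (intro integrable_continuous_real continuous_on_add cont_k cont_G)
  have "(\<lambda>N. integral {s..t} (\<lambda>r. k N r + \<theta> * (G r)\<^sup>2)) \<longlonglongrightarrow> integral {s..t} (\<lambda>r. energy d (u r) + \<theta> * (G r)\<^sup>2)"
  proof (rule dominated_convergence(2)[where h = "\<lambda>r. C * energy (\<lambda>n. 1 + e n) (u r) + \<theta> * (G r)\<^sup>2"])
    have dom1: "dominated (\<lambda>n. 1 + e n)" by (rule dominatedI[of _ 1]) (use e_nonneg in auto)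
    show "(\<lambda>r. k N r + \<theta> * (G r)\<^sup>2) integrable_on {s..t}" for N
      by (intro integrable_continuous_real continuous_on_add cont_k cont_G)
    show "(\<lambda>r. C * energy (\<lambda>n. 1 + e n) (u r) + \<theta> * (G r)\<^sup>2) integrable_on {s..t}"
      by (intro integrable_continuous_real continuous_on_add continuous_on_mult continuous_on_const
          continuous_on_energy_u subI dom1 cont_G)
    fix N r assume r: "r \<in> {s..t}"
    then have r0: "r \<ge> 0" using st by auto
    have "\<bar>k N r\<bar> \<le> (\<Sum>n<N. \<bar>d n * w n r\<bar>)" unfolding k_def by (rule sum_abs)
    also have "\<dots> \<le> (\<Sum>n<N. C * ((1 + e n) * w n r))"
    proof (rule sum_mono)
      fix n show "\<bar>d n * w n r\<bar> \<le> C * ((1 + e n) * w n r)"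
        using mult_right_mono[OF C[of n], of "w n r"] by (simp add: abs_mult w_def mult.assoc)
    qed
    also have "\<dots> = C * (\<Sum>n<N. (1 + e n) * w n r)" by (simp add: sum_distrib_left)
    also have "\<dots> \<le> C * energy (\<lambda>n. 1 + e n) (u r)"
    proof (rule mult_left_mono)
      show "(\<Sum>n<N. (1 + e n) * w n r) \<le> energy (\<lambda>n. 1 + e n) (u r)"
        unfolding energy_def w_def using energy_sums[OF u_dom[OF r0] dom1] e_nonneg
        by (intro sum_le_suminf) (auto simp: sums_iff)
      have "0 \<le> C * (1 + e 0)" using C[of 0] by linarith
      then show "C \<ge> 0" by (simp add: e_0)
    qed
    finally show "norm (k N r + \<theta> * (G r)\<^sup>2) \<le> C * energy (\<lambda>n. 1 + e n) (u r) + \<theta> * (G r)\<^sup>2"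
      using th by (simp add: abs_le_iff) (smt (verit) mult_nonneg_nonneg zero_le_power2)
  next
    fix r assume "r \<in> {s..t}"
    then have r0: "r \<ge> 0" using st by auto
    have "(\<lambda>N. k N r) \<longlonglongrightarrow> energy d (u r)"
      using energy_sums[OF u_dom[OF r0] d] by (simp add: sums_def k_def w_def)
    then show "(\<lambda>N. k N r + \<theta> * (G r)\<^sup>2) \<longlonglongrightarrow> energy d (u r) + \<theta> * (G r)\<^sup>2"
      by (intro tendsto_intros)
  qed
  note lim = this
  have "(\<lambda>N. f N t - f N s) \<longlonglongrightarrow> energy c (u t) - energy c (u s)"
    using energy_sums[OF u_dom c, of t] energy_sums[OF u_dom c, of s] st
    unfolding f_def w_def sums_def by (intro tendsto_diff) auto
  from LIMSEQ_le[OF this lim] fin show ?thesis by blast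
qed simp

lemma rdini_energy:
  assumes "dominated c" "dominated d" "\<theta> > 0" "\<And>n. (c n)\<^sup>2 / \<theta> - 2 * c n * e n \<le> d n" "s \<ge> 0"
  shows "rdini_le (\<lambda>t. energy c (u t)) s (energy d (u s) + \<theta> * (G s)\<^sup>2)"
  by (rule rdini_le_integral[of s "s + 1"])
    (use assms energy_inequality in \<open>auto intro!: continuous_on_add continuous_on_mult continuous_on_const
      continuous_on_power continuous_on_energy_u continuous_on_G\<close>)

text \<open>
  Duhamel's formula for one mode: \<open>exp (e\<^sub>n t) P n (u t)\<close> has derivative \<open>exp (e\<^sub>n t) P n (g t)\<close>.
  The estimate is obtained by pairing with the increment \<open>x\<close> itself.
\<close>

lemma mode_increment:
  assumes st: "0 \<le> s" "s \<le> t"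
  shows "norm (exp (e n * t) *\<^sub>R P n (u t) - exp (e n * s) *\<^sub>R P n (u s)) \<le> integral {s..t} (\<lambda>r. exp (e n * r) * G r)"
proof (cases "s = t")
  case False
  then have st': "s < t" "t > 0" using st by auto
  define l where "l = e n"
  have l: "l \<ge> 0" by (simp add: l_def e_nonneg)
  obtain Z where Z: "negligible Z" "\<And>r. r \<ge> 0 \<Longrightarrow> r \<notin> Z \<Longrightarrow> \<exists>u'. (u has_vector_derivative u') (at r) \<and>
      (\<forall>n. P n u' = P n (g r) - e n *\<^sub>R P n (u r))" using equation_ae by blast
  obtain V where V: "V integrable_on {0..t}"
    "\<And>p q. 0 \<le> p \<Longrightarrow> p \<le> q \<Longrightarrow> q \<le> t \<Longrightarrow> norm (u q - u p) \<le> integral {p..q} V"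
    using u_increment[OF st'(2)] by blast
  obtain M where M: "M > 0" "\<And>r. 0 \<le> r \<Longrightarrow> r \<le> t \<Longrightarrow> norm (u r) \<le> M"
    using u_bounded[of t] st' by auto
  define x where "x = exp (l * t) *\<^sub>R P n (u t) - exp (l * s) *\<^sub>R P n (u s)"
  define f where "f r = exp (l * r) * (P n (u r) \<bullet> x)" for r
  define h where "h r = exp (l * r) * (P n (g r) \<bullet> x)" for r
  define I where "I = integral {s..t} (\<lambda>r. exp (l * r) * G r)"
  define B where "B r = norm x * exp (l * t) * (V r + l * M)" for r
  have V': "V integrable_on {p..q}" if "0 \<le> p" "q \<le> t" for p q
    by (rule integrable_on_subinterval[OF V(1)]) (use that in auto)
  have "(h has_integral (f t - f s)) {s..t}"
  proof (rule ftc_dominated[where V = B and Z = Z])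
    show "B integrable_on {s..t}" unfolding B_def[abs_def]
      using V'[of s t] st by (intro integrable_on_mult_right integrable_add) auto
    fix p q assume pq: "s \<le> p" "p \<le> q" "q \<le> t"
    have pq0: "0 \<le> p" "0 \<le> q" using pq st by auto
    have e1: "\<bar>exp (l * q) - exp (l * p)\<bar> \<le> exp (l * t) * (l * (q - p))"
    proof -
      have "1 - l * (q - p) \<le> exp (- (l * (q - p)))" using exp_ge_add_one_self[of "- (l * (q - p))"] by simp
      then have "exp (l * q) * (1 - l * (q - p)) \<le> exp (l * q) * exp (- (l * (q - p)))" by simp
      also have "\<dots> = exp (l * p)" by (simp flip: exp_add add: algebra_simps)
      finally have "exp (l * q) - exp (l * p) \<le> exp (l * q) * (l * (q - p))" by (simp add: algebra_simps)
      also have "\<dots> \<le> exp (l * t) * (l * (q - p))"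
        using pq l by (intro mult_right_mono) (auto intro: mult_left_mono)
      finally show ?thesis using pq l by (simp add: mult_left_mono)
    qed
    have "f q - f p = exp (l * q) * (P n (u q - u p) \<bullet> x) + (exp (l * q) - exp (l * p)) * (P n (u p) \<bullet> x)"
      by (simp add: f_def P.diff inner_diff_left algebra_simps)
    then have "\<bar>f q - f p\<bar> \<le> exp (l * q) * \<bar>P n (u q - u p) \<bullet> x\<bar> + \<bar>exp (l * q) - exp (l * p)\<bar> * \<bar>P n (u p) \<bullet> x\<bar>"
      by (metis abs_exp_cancel abs_mult abs_triangle_ineq)
    also have "\<dots> \<le> exp (l * t) * (norm (u q - u p) * norm x) + (exp (l * t) * (l * (q - p))) * (M * norm x)"
    proof (intro add_mono mult_mono e1)
      show "exp (l * q) \<le> exp (l * t)" using pq l by (simp add: mult_left_mono)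
      show "\<bar>P n (u q - u p) \<bullet> x\<bar> \<le> norm (u q - u p) * norm x"
        by (rule order.trans[OF Cauchy_Schwarz_ineq2]) (intro mult_right_mono norm_P_le norm_ge_zero)
      show "\<bar>P n (u p) \<bullet> x\<bar> \<le> M * norm x"
        by (rule order.trans[OF Cauchy_Schwarz_ineq2], rule mult_right_mono)
          (use M(2)[of p] norm_P_le[of n "u p"] pq pq0 in auto)
    qed (use l pq in auto)
    also have "\<dots> = norm x * exp (l * t) * (norm (u q - u p) + l * M * (q - p))"
      by (simp add: algebra_simps)
    also have "\<dots> \<le> norm x * exp (l * t) * (integral {p..q} V + l * M * (q - p))"
      using V(2)[of p q] pq pq0 by (intro mult_left_mono add_right_mono) auto
    also have "\<dots> = integral {p..q} B"
    proof -
      have "integral {p..q} (\<lambda>r. V r + l * M) = integral {p..q} V + integral {p..q} (\<lambda>r. l * M)"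
        using V'[of p q] pq pq0 by (intro Henstock_Kurzweil_Integration.integral_add) auto
      then show ?thesis using pq unfolding B_def[abs_def] by simp
    qed
    finally show "\<bar>f q - f p\<bar> \<le> integral {p..q} B" .
  next
    fix r assume r: "r \<in> {s..t} - Z"
    then obtain u' where u': "(u has_vector_derivative u') (at r)"
      "P n u' = P n (g r) - e n *\<^sub>R P n (u r)" using Z(2)[of r] st by auto
    have "((\<lambda>r. P n (u r) \<bullet> x) has_vector_derivative P n u' \<bullet> x) (at r)"
      by (rule bounded_linear.has_vector_derivative[OF bounded_linear_inner_left P.has_vector_derivative[OF u'(1)]])
    then have *: "((\<lambda>r. P n (u r) \<bullet> x) has_real_derivative P n u' \<bullet> x) (at r)"
      by (simp add: has_real_derivative_iff_has_vector_derivative)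
    have "((\<lambda>r. exp (l * r)) has_real_derivative exp (l * r) * l) (at r)"
      by (auto intro!: derivative_eq_intros)
    from DERIV_mult[OF this *] show "(f has_real_derivative h r) (at r)"
      unfolding f_def[abs_def] h_def by (simp add: u'(2) l_def inner_diff_left algebra_simps)
  qed (use st Z in auto)
  then have "f t - f s \<le> norm x * I"
  proof (rule has_integral_le)
    have "(\<lambda>r. exp (l * r) * G r) integrable_on {s..t}"
      using st by (intro integrable_continuous_real continuous_intros continuous_on_G) auto
    then show "((\<lambda>r. norm x * (exp (l * r) * G r)) has_integral norm x * I) {s..t}"
      unfolding I_def by (intro has_integral_mult_right integrable_integral)
    fix r assume "r \<in> {s..t}"
    then have "norm (P n (g r)) \<le> G r" using g_le_G[of r] norm_P_le[of n "g r"] st by auto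
    then have "P n (g r) \<bullet> x \<le> G r * norm x"
      using norm_cauchy_schwarz[of "P n (g r)" x] mult_right_mono[of "norm (P n (g r))" "G r" "norm x"] by simp
    then show "h r \<le> norm x * (exp (l * r) * G r)" by (simp add: h_def mult_ac)
  qed
  moreover have "f t - f s = x \<bullet> x" by (simp add: f_def x_def inner_diff_left)
  ultimately have "norm x * norm x \<le> norm x * I" by (simp add: power2_norm_eq_inner flip: power2_eq_square)
  moreover have "I \<ge> 0"
  proof -
    have "0 \<le> G r" if "r \<in> {s..t}" for r using g_le_G[of r] norm_ge_zero[of "g r"] that st by (meson atLeastAtMost_iff order.trans)
    then show ?thesis unfolding I_def
      using st by (intro Henstock_Kurzweil_Integration.integral_nonneg integrable_continuous_real continuous_intros continuous_on_G) auto
  qed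
  ultimately have "norm x \<le> I" by (cases "x = 0") auto
  then show ?thesis by (simp add: x_def I_def l_def)
qed simp

end


section \<open>Exponentials and powers\<close>

lemma exp_bound_extend:
  fixes f :: "real \<Rightarrow> real"
  assumes f: "continuous_on {0..T} f" and b: "\<And>t. t \<ge> T \<Longrightarrow> f t \<le> C * exp (- (k * t))"
  shows "\<exists>C'>0. \<forall>t\<ge>0. f t \<le> C' * exp (- (k * t))"
proof -
  have "compact ((\<lambda>t. f t * exp (k * t)) ` {0..T})"
    by (intro compact_continuous_image continuous_intros f) auto
  then have "bounded ((\<lambda>t. f t * exp (k * t)) ` {0..T})" by (rule compact_imp_bounded)
  then obtain B where "\<forall>t\<in>{0..T}. \<bar>f t * exp (k * t)\<bar> \<le> B"
    unfolding bounded_iff by auto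
  then have B: "\<bar>f t * exp (k * t)\<bar> \<le> B" if "t \<in> {0..T}" for t using that by blast
  have "f t \<le> max 1 (max B C) * exp (- (k * t))" if "t \<ge> 0" for t
  proof (cases "t \<le> T")
    case True
    then have "f t * exp (k * t) \<le> B" using B[of t] that by auto
    then have "f t * exp (k * t) * exp (- (k * t)) \<le> B * exp (- (k * t))" by (intro mult_right_mono) auto
    then have "f t \<le> B * exp (- (k * t))" by (simp add: mult.assoc flip: exp_add)
    also have "\<dots> \<le> max 1 (max B C) * exp (- (k * t))" by (intro mult_right_mono) auto
    finally show ?thesis .
  next
    case False
    then have "f t \<le> C * exp (- (k * t))" using b by simp
    also have "\<dots> \<le> max 1 (max B C) * exp (- (k * t))" by (intro mult_right_mono) auto
    finally show ?thesis .
  qed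
  then show ?thesis by (intro exI[of _ "max 1 (max B C)"]) auto
qed

lemma has_derivative_powr_reflected:
  assumes "c > (0::real)"
  shows "((\<lambda>x. (- x) powr a) has_real_derivative - (a * c powr (a - 1))) (at (- c))"
proof -
  have "((\<lambda>x. x powr a) has_real_derivative a * c powr (a - 1)) (at (- (- c)))"
    using has_real_derivative_powr[OF assms, of a] by simp
  moreover have "(uminus has_real_derivative -1) (at (- c))"
    using DERIV_minus[OF DERIV_ident, of "- c"] by simp
  ultimately show ?thesis using DERIV_chain2[where f = "\<lambda>x. x powr a" and g = uminus] by fastforce
qed

lemma powr_one_plus: "x \<ge> 0 \<Longrightarrow> x powr (1 + a) = x * x powr a" for x a :: real
  by (simp add: powr_add)

lemma exp_decay_tendsto_0: "k > 0 \<Longrightarrow> ((\<lambda>t. C * exp (- (k * t))) \<longlongrightarrow> 0) at_top" for k C :: real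
  by real_asymp

lemma exp_le_exp_imp_rate_le:
  fixes a b c C :: real
  assumes "c > 0" "\<And>t. t \<ge> 0 \<Longrightarrow> c * exp (- (a * t)) \<le> C * exp (- (b * t))"
  shows "b \<le> a"
proof (rule ccontr)
  assume "\<not> b \<le> a"
  then have lim: "((\<lambda>t. C * exp (- ((b - a) * t))) \<longlongrightarrow> 0) at_top" by (intro exp_decay_tendsto_0) simp
  have "c \<le> 0"
  proof (rule tendsto_lowerbound[OF lim])
    have "c \<le> C * exp (- ((b - a) * t))" if "t \<ge> 0" for t
    proof -
      have "c * exp (- (a * t)) * exp (a * t) \<le> C * exp (- (b * t)) * exp (a * t)"
        using assms(2)[OF that] by (intro mult_right_mono) auto
      then show ?thesis by (simp add: mult.assoc algebra_simps flip: exp_add)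
    qed
    then show "\<forall>\<^sub>F t in at_top. c \<le> C * exp (- ((b - a) * t))"
      by (rule eventually_mono[OF eventually_ge_at_top[of 0]])
  qed simp
  then show False using assms(1) by simp
qed

section \<open>The trichotomy of decay rates\<close>

locale semilinear_parabolic =
  parabolic_solution D A e g u "\<lambda>t. K * (norm (u t) powr (1 + p) + norm (op_power D A (1/2) (u t)) powr (1 + q))"
  for D :: "'a::{real_inner, complete_space} set" and A e g u and p q K :: real +
  assumes p_pos: "p > 0" and q_pos: "q > 0" and K_nonneg: "K \<ge> 0"
    and decay: "((\<lambda>t. dom_power_norm D A (1/2) (u t)) \<longlongrightarrow> 0) at_top"
begin

text \<open>
  The quotient \<open>z / y\<close> is the Dirichlet quotient of the solution; \<open>eta\<close> is the small coefficient in
  \<open>\<parallel>g\<parallel>\<^sup>2 \<le> G\<^sup>2 \<le> eta (y + z)\<close>.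
\<close>

definition y :: "real \<Rightarrow> real" where "y t = (norm (u t))\<^sup>2"
definition z :: "real \<Rightarrow> real" where "z t = (norm (op_power D A (1/2) (u t)))\<^sup>2"
definition G :: "real \<Rightarrow> real" where
  "G t = K * (norm (u t) powr (1 + p) + norm (op_power D A (1/2) (u t)) powr (1 + q))"
definition eta :: "real \<Rightarrow> real" where "eta t = 2 * K\<^sup>2 * (y t powr p + z t powr q)"

lemma y_nonneg: "y t \<ge> 0" and z_nonneg: "z t \<ge> 0" and eta_nonneg: "eta t \<ge> 0"
  and G_nonneg: "G t \<ge> 0"
  using K_nonneg by (auto simp: y_def z_def eta_def G_def)

lemma continuous_y: "I \<subseteq> {0..} \<Longrightarrow> continuous_on I y"
  and continuous_z: "I \<subseteq> {0..} \<Longrightarrow> continuous_on I z"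
  unfolding y_def z_def by (intro continuous_intros continuous_on_u continuous_on_sqrt_u; simp)+

lemma continuous_eta: "I \<subseteq> {0..} \<Longrightarrow> continuous_on I eta"
  unfolding eta_def using p_pos q_pos
  by (intro continuous_intros continuous_on_powr' continuous_y continuous_z) (auto simp: y_nonneg z_nonneg)

lemma eta_bounded: obtains N where "N > 0" "\<And>t. t \<in> {a..b} \<Longrightarrow> a \<ge> 0 \<Longrightarrow> eta t \<le> N"
proof (cases "a \<ge> 0")
  case True
  have "compact (eta ` {a..b})" using True by (intro compact_continuous_image continuous_eta) auto
  then have "bounded (eta ` {a..b})" by (rule compact_imp_bounded)
  then obtain B where B: "\<forall>t\<in>{a..b}. \<bar>eta t\<bar> \<le> B" unfolding bounded_iff by auto
  have "eta t \<le> max 1 B" if "t \<in> {a..b}" for t using bspec[OF B that] by linarith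
  then show ?thesis by (intro that[of "max 1 B"]) auto
qed (use that[of 1] in auto)

lemma G_squared_le: "(G t)\<^sup>2 \<le> 2 * K\<^sup>2 * (y t powr (1 + p) + z t powr (1 + q))"
proof -
  have sq: "(norm x powr a)\<^sup>2 = (norm x)\<^sup>2 powr a" for x :: 'a and a
    by (cases "x = 0") (auto simp: powr_powr mult.commute simp flip: powr_numeral)
  have "(a + b)\<^sup>2 \<le> 2 * (a\<^sup>2 + b\<^sup>2)" for a b :: real
    using zero_le_power2[of "a - b"] by (simp add: power2_eq_square algebra_simps)
  then have "K\<^sup>2 * (norm (u t) powr (1 + p) + norm (op_power D A (1/2) (u t)) powr (1 + q))\<^sup>2
      \<le> K\<^sup>2 * (2 * ((norm (u t) powr (1 + p))\<^sup>2 + (norm (op_power D A (1/2) (u t)) powr (1 + q))\<^sup>2))"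
    by (intro mult_left_mono) auto
  then show ?thesis unfolding G_def power_mult_distrib sq y_def z_def by (simp add: algebra_simps)
qed

lemma G_squared_le_eta: "(G t)\<^sup>2 \<le> eta t * (y t + z t)"
proof -
  have "2 * K\<^sup>2 * (y t powr (1 + p) + z t powr (1 + q)) \<le> eta t * (y t + z t)"
    by (simp add: eta_def powr_one_plus y_nonneg z_nonneg algebra_simps mult_left_mono)
  then show ?thesis using G_squared_le[of t] by linarith
qed

lemma tendsto_y: "(y \<longlongrightarrow> 0) at_top" and tendsto_z: "(z \<longlongrightarrow> 0) at_top"
proof -
  have "((\<lambda>t. (dom_power_norm D A (1/2) (u t))\<^sup>2) \<longlongrightarrow> 0\<^sup>2) at_top"
    by (intro tendsto_power decay)
  moreover have "(dom_power_norm D A (1/2) (u t))\<^sup>2 = y t + z t" for t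
    by (simp add: dom_power_norm_def y_def z_def)
  ultimately have lim: "((\<lambda>t. y t + z t) \<longlongrightarrow> 0) at_top" by simp
  show "(y \<longlongrightarrow> 0) at_top" "(z \<longlongrightarrow> 0) at_top"
    by (rule tendsto_sandwich[OF _ _ tendsto_const lim]; simp add: y_nonneg z_nonneg)+
qed

lemma tendsto_y_powr: "a > 0 \<Longrightarrow> ((\<lambda>t. y t powr a) \<longlongrightarrow> 0) at_top"
  and tendsto_z_powr: "a > 0 \<Longrightarrow> ((\<lambda>t. z t powr a) \<longlongrightarrow> 0) at_top"
  by (rule tendsto_zero_powrI[OF tendsto_y tendsto_const] tendsto_zero_powrI[OF tendsto_z tendsto_const];
      simp add: y_nonneg z_nonneg)+

lemma energy_affine: "t \<ge> 0 \<Longrightarrow> energy (\<lambda>n. a + b * e n) (u t) = a * y t + b * z t"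
  and z_sums: "t \<ge> 0 \<Longrightarrow> (\<lambda>n. e n * (norm (P n (u t)))\<^sup>2) sums z t"
proof -
  have ys: "(\<lambda>n. (norm (P n (u t)))\<^sup>2) sums y t" unfolding y_def by (rule parseval_norm)
  have zs: "(\<lambda>n. e n * (norm (P n (u t)))\<^sup>2) sums z t" if "t \<ge> 0"
  proof -
    have "(norm (P n (op_power D A (1/2) (u t))))\<^sup>2 = e n * (norm (P n (u t)))\<^sup>2" for n
      using e_nonneg[of n] by (simp add: P_op_sqrt[OF u_dom[OF that]] power_mult_distrib)
    then show ?thesis using parseval_norm[of "op_power D A (1/2) (u t)"] by (simp add: z_def)
  qed
  then show "t \<ge> 0 \<Longrightarrow> (\<lambda>n. e n * (norm (P n (u t)))\<^sup>2) sums z t" .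
  assume t: "t \<ge> 0"
  have "(\<lambda>n. a * (norm (P n (u t)))\<^sup>2 + b * (e n * (norm (P n (u t)))\<^sup>2)) sums (a * y t + b * z t)"
    by (intro sums_add sums_mult ys zs t)
  then show "energy (\<lambda>n. a + b * e n) (u t) = a * y t + b * z t"
    by (simp add: energy_def sums_iff algebra_simps)
qed

lemma dominated_affine: "dominated (\<lambda>n. a + b * e n)"
proof (rule dominatedI[of _ "\<bar>a\<bar> + \<bar>b\<bar>"])
  fix n
  have "\<bar>a + b * e n\<bar> \<le> \<bar>a\<bar> + \<bar>b\<bar> * e n" using e_nonneg[of n] by (metis abs_mult abs_of_nonneg abs_triangle_ineq)
  also have "\<dots> \<le> (\<bar>a\<bar> + \<bar>b\<bar>) * (1 + e n)" using e_nonneg[of n] by (simp add: algebra_simps)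
  finally show "\<bar>a + b * e n\<bar> \<le> (\<bar>a\<bar> + \<bar>b\<bar>) * (1 + e n)" .
qed

text \<open>
  The weights \<open>a + b e\<close> are the ones whose energy is a combination of \<open>y\<close> and \<open>z\<close>.
\<close>

lemma rdini_affine:
  assumes s: "s \<ge> 0" and th: "\<theta> > 0"
    and le: "\<And>n. (a + b * e n)\<^sup>2 / \<theta> - 2 * (a + b * e n) * e n \<le> a' + b' * e n"
  shows "rdini_le (\<lambda>t. a * y t + b * z t) s (a' * y s + b' * z s + \<theta> * (G s)\<^sup>2)"
proof -
  have "rdini_le (\<lambda>t. energy (\<lambda>n. a + b * e n) (u t)) s (energy (\<lambda>n. a' + b' * e n) (u s) + \<theta> * (G s)\<^sup>2)"
    using rdini_energy[OF dominated_affine[of a b] dominated_affine[of a' b'] th le s] by (simp add: G_def)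
  then show ?thesis
    unfolding energy_affine[OF s]
    by (rule rdini_le_cong) (use s in \<open>simp add: energy_affine\<close>)
qed

definition e1 :: real where "e1 = e 1"

lemma e1_pos: "e1 > 0"
  using e_mono e_0 by (metis e1_def strict_mono_def zero_less_one)

lemma e_cases: "e n = 0 \<or> e1 \<le> e n"
proof (cases n)
  case (Suc m)
  then have "e 1 \<le> e n" using strict_mono_mono[OF e_mono] by (auto dest: monoD)
  then show ?thesis by (simp add: e1_def)
qed (simp add: e_0)

subsection \<open>Forward and backward uniqueness\<close>

text \<open>
  \<open>y + z\<close> satisfies the linear inequality \<open>(y + z)' \<le> y + G\<^sup>2 \<le> (1 + eta) (y + z)\<close>.
\<close>

lemma zero_forward:
  assumes "0 \<le> s" "s \<le> t" "u s = 0"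
  shows "u t = 0"
proof -
  have zs: "z s = 0" using z_sums[OF assms(1)] assms(3) by (simp add: P.zero sums_iff)
  have ys: "y s = 0" using assms(3) by (simp add: y_def)
  obtain N where N: "N > 0" "\<And>r. r \<in> {s..t} \<Longrightarrow> s \<ge> 0 \<Longrightarrow> eta r \<le> N" using eta_bounded by blast
  have "1 * y t + 1 * z t \<le> 0"
  proof (rule comparison_principle[where a = s and b = t and C = "1 + N" and F = "\<lambda>t. 1 * y t + 1 * z t"])
    show "continuous_on {s..t} (\<lambda>t. 1 * y t + 1 * z t)"
      using assms(1) by (intro continuous_intros continuous_y continuous_z) auto
    show "1 * y s + 1 * z s \<le> 0" by (simp add: ys zs)
    fix r assume r: "s \<le> r" "r < t"
    have r0: "r \<ge> 0" using r assms by simp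
    have "rdini_le (\<lambda>t. 1 * y t + 1 * z t) r (1 * y r + 0 * z r + 1 * (G r)\<^sup>2)"
      by (rule rdini_affine[OF r0]) (auto simp: power2_eq_square algebra_simps)
    moreover have "1 * y r + 0 * z r + 1 * (G r)\<^sup>2 \<le> (1 + N) * (1 * y r + 1 * z r)"
    proof -
      have "(G r)\<^sup>2 \<le> N * (y r + z r)"
        using G_squared_le_eta[of r] mult_right_mono[OF N(2)[of r], of "y r + z r"] r assms y_nonneg z_nonneg
        by (smt (verit) atLeastAtMost_iff add_nonneg_nonneg)
      then show ?thesis using z_nonneg[of r] by (simp add: algebra_simps)
    qed
    ultimately show "rdini_le (\<lambda>t. 1 * y t + 1 * z t) r ((1 + N) * (1 * y r + 1 * z r))"
      by (rule rdini_le_mono)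
  qed (use assms in auto)
  then have "y t = 0" using y_nonneg[of t] z_nonneg[of t] by simp
  then show ?thesis by (simp add: y_def)
qed

text \<open>
  With \<open>\<theta> = 1/2\<close> the energy inequality for \<open>z - m y\<close> reads \<open>(z - m y)' \<le> - 2 m (z - m y) + G\<^sup>2 / 2\<close>.
  Hence the Dirichlet quotient \<open>z / y\<close> stays below \<open>m\<close> as soon as \<open>m\<close> grows fast enough to absorb
  the forcing term.
\<close>

lemma dirichlet_quotient_le:
  assumes a: "0 \<le> a" and m: "\<And>t. t \<ge> a \<Longrightarrow> (m has_real_derivative m' t) (at t)" "\<And>t. t \<ge> a \<Longrightarrow> m t \<ge> 0"
    and N: "\<And>t. t \<in> {a..b} \<Longrightarrow> eta t \<le> N"
    and growth: "\<And>t. t \<in> {a..b} \<Longrightarrow> eta t * (1 + m t) / 2 \<le> m' t"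
    and start: "z a \<le> m a * y a" and t: "t \<in> {a..b}"
  shows "z t \<le> m t * y t"
proof -
  have cm: "continuous_on {a..b} m"
    by (intro continuous_at_imp_continuous_on ballI DERIV_isCont[OF m(1)]) simp
  have N0: "N \<ge> 0" using N[OF t] eta_nonneg[of t] by simp
  have "z t - m t * y t \<le> 0"
  proof (rule comparison_principle[where a = a and b = b and C = N and F = "\<lambda>t. z t - m t * y t"])
    show "continuous_on {a..b} (\<lambda>t. z t - m t * y t)"
      using a by (intro continuous_intros continuous_y continuous_z cm) auto
    fix s assume s: "a \<le> s" "s < b" and pos: "z s - m s * y s > 0"
    define F where "F = z s - m s * y s"
    have s0: "s \<ge> 0" using s a by simp
    have r1: "rdini_le (\<lambda>t. (- m s) * y t + 1 * z t) s (2 * (m s)\<^sup>2 * y s + (- 2 * m s) * z s + (1/2) * (G s)\<^sup>2)"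
      by (rule rdini_affine[OF s0]) (auto simp: power2_eq_square algebra_simps)
    have r2: "rdini_le (\<lambda>t. - ((m t - m s) * y t)) s (- (m' s * y s))"
    proof (rule rdini_le_tendsto)
      have "(y \<longlongrightarrow> y s) (at s within {s..b})"
        using continuous_y[of "{s..b}"] s a by (auto simp: continuous_on_def)
      then have ylim: "(y \<longlongrightarrow> y s) (at_right s)" using s by (simp add: at_within_Icc_at_right)
      have "((\<lambda>t. (m t - m s) / (t - s)) \<longlongrightarrow> m' s) (at s)"
        using m(1)[OF s(1)] by (simp add: has_field_derivative_iff)
      then have "((\<lambda>t. (m t - m s) / (t - s)) \<longlongrightarrow> m' s) (at_right s)"
        by (auto intro: tendsto_within_subset)
      from tendsto_minus[OF tendsto_mult[OF this ylim]]
      show "((\<lambda>t. (- ((m t - m s) * y t) - - ((m s - m s) * y s)) / (t - s)) \<longlongrightarrow> - (m' s * y s)) (at_right s)"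
        by simp
    qed
    have "rdini_le (\<lambda>t. z t - m t * y t) s
        ((2 * (m s)\<^sup>2 * y s + (- 2 * m s) * z s + (1/2) * (G s)\<^sup>2) + - (m' s * y s))"
      by (rule rdini_le_cong[OF rdini_le_add[OF r1 r2]]) (simp add: algebra_simps)
    moreover have "(2 * (m s)\<^sup>2 * y s + (- 2 * m s) * z s + (1/2) * (G s)\<^sup>2) + - (m' s * y s) \<le> N * F"
    proof -
      define W where "W = eta s * (1 + m s) * y s"
      have "2 * (m s)\<^sup>2 * y s + (- 2 * m s) * z s = - 2 * (m s * F)"
        by (simp add: F_def power2_eq_square algebra_simps)
      moreover have "0 \<le> m s * F" using m(2)[OF s(1)] pos by (simp add: F_def)
      moreover have "(G s)\<^sup>2 \<le> eta s * F + W"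
        using G_squared_le_eta[of s] by (simp add: F_def W_def algebra_simps)
      moreover have "W / 2 \<le> m' s * y s"
        using mult_right_mono[OF growth[of s] y_nonneg[of s]] s by (simp add: W_def)
      moreover have "eta s * F \<le> N * F" using N[of s] s pos by (intro mult_right_mono) (auto simp: F_def)
      moreover have "0 \<le> N * F" using N0 pos by (simp add: F_def)
      ultimately show ?thesis by linarith
    qed
    ultimately show "rdini_le (\<lambda>t. z t - m t * y t) s (N * (z s - m s * y s))"
      unfolding F_def by (rule rdini_le_mono)
  qed (use start t in auto)
  then show ?thesis by simp
qed

text \<open>
  A bounded Dirichlet quotient excludes superexponential decay, as \<open>- y' \<le> y + 2 z + G\<^sup>2\<close>.
\<close>

lemma exponential_lower_bound:
  assumes a: "0 \<le> a" and M: "\<And>t. t \<in> {a..b} \<Longrightarrow> z t \<le> M * y t" "M \<ge> 0"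
    and N: "\<And>t. t \<in> {a..b} \<Longrightarrow> eta t \<le> N" and t: "t \<in> {a..b}"
  shows "y a * exp (- ((1 + 2 * M + N * (1 + M)) * (t - a))) \<le> y t"
proof -
  define C where "C = 1 + 2 * M + N * (1 + M)"
  have "(-1) * y t + 0 * z t + y a * exp (- (C * (t - a))) \<le> 0"
  proof (rule comparison_principle[where a = a and b = b and C = "- C" and F = "\<lambda>t. (-1) * y t + 0 * z t + y a * exp (- (C * (t - a)))"])
    show "continuous_on {a..b} (\<lambda>t. (-1) * y t + 0 * z t + y a * exp (- (C * (t - a))))"
      using a by (intro continuous_intros continuous_y continuous_z) auto
    fix s assume s: "a \<le> s" "s < b"
    have s0: "s \<ge> 0" using s a by simp
    have "rdini_le (\<lambda>t. (-1) * y t + 0 * z t) s (1 * y s + 2 * z s + 1 * (G s)\<^sup>2)"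
      by (rule rdini_affine[OF s0]) (auto simp: e_nonneg)
    moreover have "((\<lambda>t. y a * exp (- (C * (t - a)))) has_real_derivative (- C * (y a * exp (- (C * (s - a)))))) (at s)"
      by (auto intro!: derivative_eq_intros)
    ultimately have "rdini_le (\<lambda>t. (-1) * y t + 0 * z t + y a * exp (- (C * (t - a)))) s
        ((1 * y s + 2 * z s + 1 * (G s)\<^sup>2) + (- C * (y a * exp (- (C * (s - a))))))"
      by (rule rdini_le_add[OF _ rdini_le_deriv])
    moreover have "1 * y s + 2 * z s + 1 * (G s)\<^sup>2 \<le> C * y s"
    proof -
      have zM: "z s \<le> M * y s" using M s by auto
      have "(G s)\<^sup>2 \<le> eta s * (y s + z s)" by (rule G_squared_le_eta)
      also have "\<dots> \<le> N * (y s + M * y s)"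
        using N[of s] s zM eta_nonneg[of s] y_nonneg[of s] z_nonneg[of s] by (intro mult_mono) auto
      finally show ?thesis using zM by (simp add: C_def algebra_simps)
    qed
    ultimately show "rdini_le (\<lambda>t. (-1) * y t + 0 * z t + y a * exp (- (C * (t - a)))) s
        (- C * ((-1) * y s + 0 * z s + y a * exp (- (C * (s - a)))))"
      by (elim rdini_le_mono) (simp add: algebra_simps)
  qed (use t in auto)
  then show ?thesis by (simp add: C_def)
qed

lemma nonzero_forward:
  assumes a: "0 \<le> a" "a \<le> t" "u a \<noteq> 0"
  shows "u t \<noteq> 0"
proof -
  obtain N where N: "N > 0" "\<And>r. r \<in> {a..t} \<Longrightarrow> a \<ge> 0 \<Longrightarrow> eta r \<le> N" using eta_bounded by blast
  define m0 where "m0 = z a / y a"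
  have ya: "y a > 0" using a(3) by (simp add: y_def)
  have m0: "m0 \<ge> 0" using ya z_nonneg[of a] by (simp add: m0_def)
  \<comment> \<open>The solution of \<open>m' = N (1 + m) / 2\<close> that starts at the Dirichlet quotient at time \<open>a\<close>.\<close>
  define m where "m r = (1 + m0) * exp (N / 2 * (r - a)) - 1" for r
  have m_nn: "m r \<ge> 0" if "r \<ge> a" for r
  proof -
    have "1 * 1 \<le> (1 + m0) * exp (N / 2 * (r - a))" using m0 N that by (intro mult_mono) auto
    then show ?thesis by (simp add: m_def)
  qed
  have zm: "z r \<le> m r * y r" if "r \<in> {a..t}" for r
  proof (rule dirichlet_quotient_le[where a = a and b = t and N = N and m' = "\<lambda>r. N / 2 * (1 + m r)"])
    show "(m has_real_derivative N / 2 * (1 + m r)) (at r)" for r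
      unfolding m_def[abs_def] by (auto intro!: derivative_eq_intros)
    show "eta r * (1 + m r) / 2 \<le> N / 2 * (1 + m r)" if "r \<in> {a..t}" for r
      using mult_right_mono[OF N(2)[OF that a(1)], of "1 + m r"] m_nn[of r] that by simp
    show "z a \<le> m a * y a" using ya by (simp add: m_def m0_def)
  qed (use a N m_nn that in auto)
  have "z r \<le> m t * y r" if r: "r \<in> {a..t}" for r
  proof -
    have "m r \<le> m t" using r m0 N(1) by (auto simp: m_def intro!: mult_left_mono)
    then have "m r * y r \<le> m t * y r" using y_nonneg by (rule mult_right_mono)
    then show ?thesis using zm[OF r] by linarith
  qed
  from exponential_lower_bound[OF a(1) this, of t N t] N a m_nn
  have "y a * exp (- ((1 + 2 * m t + N * (1 + m t)) * (t - a))) \<le> y t" by auto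
  moreover have "y a * exp (- ((1 + 2 * m t + N * (1 + m t)) * (t - a))) > 0" using ya by simp
  ultimately have "y t > 0" by linarith
  then show ?thesis by (auto simp: y_def)
qed

lemma null_or_nowhere_zero: "null_solution u \<or> (\<forall>t\<ge>0. u t \<noteq> 0)"
  unfolding null_solution_def
  using zero_forward nonzero_forward by (meson linear)

subsection \<open>Slow solutions\<close>

text \<open>
  The level separating slow from fast solutions. It is well below \<open>e1\<close>, and the factor \<open>8 (1 + p)\<close>
  makes the growth rate \<open>4 kappa (1 + p)\<close> of \<open>- y\<^sup>1\<^sup>+\<^sup>p\<close> equal to \<open>e1 / 2\<close>, less than the decay rate
  of \<open>z\<close>.
\<close>

definition kappa :: real where "kappa = e1 / (8 * (1 + p))"

definition small_from :: "real \<Rightarrow> bool" where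
  "small_from T \<longleftrightarrow> T \<ge> 0 \<and> (\<forall>t\<ge>T. eta t * (1 + kappa) \<le> kappa\<^sup>2 \<and> 2 * K\<^sup>2 * z t powr q \<le> e1 / 4)"

lemma kappa_pos: "kappa > 0" and kappa_le: "8 * kappa \<le> e1" "8 * (1 + p) * kappa = e1"
proof -
  show pos: "kappa > 0" using e1_pos p_pos by (simp add: kappa_def)
  show eq: "8 * (1 + p) * kappa = e1" using p_pos by (simp add: kappa_def)
  have "0 \<le> p * kappa" using pos p_pos by simp
  with eq show "8 * kappa \<le> e1" by (simp add: algebra_simps)
qed

lemma small_from_exists: "\<exists>T. small_from T"
proof -
  have yp: "((\<lambda>t. y t powr p) \<longlongrightarrow> 0) at_top" "((\<lambda>t. z t powr q) \<longlongrightarrow> 0) at_top"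
    using tendsto_y_powr tendsto_z_powr p_pos q_pos by auto
  have "((\<lambda>t. eta t * (1 + kappa)) \<longlongrightarrow> 2 * K\<^sup>2 * (0 + 0) * (1 + kappa)) at_top"
    unfolding eta_def by (intro tendsto_intros yp)
  then have "\<forall>\<^sub>F t in at_top. eta t * (1 + kappa) < kappa\<^sup>2"
    using kappa_pos by (intro order_tendstoD(2)) auto
  moreover have "((\<lambda>t. 2 * K\<^sup>2 * z t powr q) \<longlongrightarrow> 2 * K\<^sup>2 * 0) at_top" by (intro tendsto_intros yp)
  then have "\<forall>\<^sub>F t in at_top. 2 * K\<^sup>2 * z t powr q < e1 / 4"
    using e1_pos by (intro order_tendstoD(2)) auto
  ultimately have "\<forall>\<^sub>F t in at_top. t \<ge> 0 \<and> eta t * (1 + kappa) \<le> kappa\<^sup>2 \<and> 2 * K\<^sup>2 * z t powr q \<le> e1 / 4"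
    using eventually_ge_at_top[of 0] by eventually_elim auto
  then obtain T where "\<forall>t\<ge>T. t \<ge> 0 \<and> eta t * (1 + kappa) \<le> kappa\<^sup>2 \<and> 2 * K\<^sup>2 * z t powr q \<le> e1 / 4"
    unfolding eventually_at_top_linorder by blast
  then show ?thesis by (auto simp: small_from_def)
qed

text \<open>
  Since the spectrum has no point in \<open>(0, e1)\<close>, the level \<open>\<kappa>\<close> of the Dirichlet quotient cannot be
  crossed upwards once the forcing term is small.
\<close>

lemma dirichlet_quotient_stays_small:
  assumes T: "small_from T0" "T \<ge> T0" and start: "z T \<le> kappa * y T" and t: "t \<ge> T"
  shows "z t \<le> kappa * y t"
proof -
  have "(- kappa) * y t + 1 * z t \<le> 0"
  proof (rule comparison_principle[where a = T and b = t and C = "kappa\<^sup>2" and F = "\<lambda>t. (- kappa) * y t + 1 * z t"])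
    show "continuous_on {T..t} (\<lambda>t. (- kappa) * y t + 1 * z t)"
      using T by (intro continuous_intros continuous_y continuous_z) (auto simp: small_from_def)
    fix s assume s: "T \<le> s" "s < t" and pos: "(- kappa) * y s + 1 * z s > 0"
    define F where "F = (- kappa) * y s + 1 * z s"
    have s0: "s \<ge> 0" using s T by (simp add: small_from_def)
    have "rdini_le (\<lambda>t. (- kappa) * y t + 1 * z t) s (kappa\<^sup>2 * y s + (- 2 * kappa) * z s + 1 * (G s)\<^sup>2)"
    proof (rule rdini_affine[OF s0])
      fix n
      have "2 * kappa * e n \<le> e n * e n"
        using e_cases[of n] kappa_le kappa_pos by (auto intro: mult_right_mono)
      then show "(- kappa + 1 * e n)\<^sup>2 / 1 - 2 * (- kappa + 1 * e n) * e n \<le> kappa\<^sup>2 + (- 2 * kappa) * e n"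
        by (simp add: power2_eq_square algebra_simps)
    qed simp
    moreover have "kappa\<^sup>2 * y s + (- 2 * kappa) * z s + 1 * (G s)\<^sup>2 \<le> kappa\<^sup>2 * F"
    proof -
      have eta: "eta s * (1 + kappa) \<le> kappa\<^sup>2" using T s by (auto simp: small_from_def)
      have "eta s \<le> eta s * (1 + kappa)" using eta_nonneg[of s] kappa_pos by (simp add: algebra_simps)
      then have "eta s * F \<le> kappa\<^sup>2 * F" using eta pos by (intro mult_right_mono) (auto simp: F_def)
      moreover have "(eta s * (1 + kappa)) * y s \<le> kappa\<^sup>2 * y s" using eta y_nonneg by (rule mult_right_mono)
      moreover have "(G s)\<^sup>2 \<le> eta s * F + (eta s * (1 + kappa)) * y s"
        using G_squared_le_eta[of s] by (simp add: F_def algebra_simps)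
      moreover have "kappa\<^sup>2 * y s + (- 2 * kappa) * z s = - 2 * (kappa * F) - kappa\<^sup>2 * y s"
        by (simp add: F_def power2_eq_square algebra_simps)
      moreover have "0 \<le> kappa * F" using kappa_pos pos by (simp add: F_def)
      ultimately show ?thesis by linarith
    qed
    ultimately show "rdini_le (\<lambda>t. (- kappa) * y t + 1 * z t) s (kappa\<^sup>2 * ((- kappa) * y s + 1 * z s))"
      unfolding F_def by (rule rdini_le_mono)
  qed (use start t in auto)
  then show ?thesis by simp
qed

lemma rdini_z: "s \<ge> 0 \<Longrightarrow> rdini_le z s (- e1 * z s + (G s)\<^sup>2)"
proof -
  assume s: "s \<ge> 0"
  have "rdini_le (\<lambda>t. 0 * y t + 1 * z t) s (0 * y s + (- e1) * z s + 1 * (G s)\<^sup>2)"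
  proof (rule rdini_affine[OF s])
    fix n
    have "e1 * e n \<le> e n * e n" using e_cases[of n] e1_pos by (auto intro: mult_right_mono)
    then show "(0 + 1 * e n)\<^sup>2 / 1 - 2 * (0 + 1 * e n) * e n \<le> 0 + (- e1) * e n"
      by (simp add: power2_eq_square)
  qed simp
  then show ?thesis by simp
qed

lemma rdini_neg_y: "s \<ge> 0 \<Longrightarrow> \<sigma> > 0 \<Longrightarrow> rdini_le (\<lambda>t. - y t) s (\<sigma> * y s + 2 * z s + (G s)\<^sup>2 / \<sigma>)"
  using rdini_affine[of s "1 / \<sigma>" "-1" 0 \<sigma> 2] by (simp add: e_nonneg)

text \<open>
  The function \<open>z\<close> decays at the rate \<open>e1\<close>, up to a forcing term of order \<open>y\<^sup>1\<^sup>+\<^sup>p\<close>, while by the choice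
  of \<open>kappa\<close> the function \<open>M y\<^sup>1\<^sup>+\<^sup>p\<close> decays at most at the rate \<open>e1 / 2\<close>; this does not depend on
  \<open>M\<close>, which has to be large enough for the initial time.
\<close>

lemma z_le_power_y:
  assumes nz: "\<And>t. t \<ge> 0 \<Longrightarrow> u t \<noteq> 0"
    and T: "small_from T0" "T \<ge> T0" and start: "z T \<le> kappa * y T"
  obtains M where "M > 0" "\<And>t. t \<ge> T \<Longrightarrow> z t \<le> M * y t powr (1 + p)"
proof -
  have T0: "T \<ge> 0" using T by (simp add: small_from_def)
  have ypos: "y t > 0" if "t \<ge> 0" for t using nz[OF that] by (simp add: y_def)
  define M where "M = max (8 * K\<^sup>2 / e1) (z T / y T powr (1 + p)) + 1"
  have M: "8 * K\<^sup>2 / e1 \<le> M" "z T / y T powr (1 + p) \<le> M" "M > 0"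
  proof -
    have "8 * K\<^sup>2 / e1 \<ge> 0" using e1_pos by simp
    then show "8 * K\<^sup>2 / e1 \<le> M" "z T / y T powr (1 + p) \<le> M" "M > 0" by (auto simp: M_def max_def)
  qed
  have "z t + M * (- (y t powr (1 + p))) \<le> 0" if t: "t \<ge> T" for t
  proof (rule comparison_principle[where a = T and b = t and C = "- (3/4 * e1)" and F = "\<lambda>t. z t + M * (- (y t powr (1 + p)))"])
    have "\<forall>s\<in>{T..t}. y s \<noteq> 0" using ypos T0 by (metis atLeastAtMost_iff less_irrefl order.trans)
    then show "continuous_on {T..t} (\<lambda>t. z t + M * (- (y t powr (1 + p))))"
      using T0 by (intro continuous_intros continuous_y continuous_z) auto
    show "z T + M * - (y T powr (1 + p)) \<le> 0"
      using M(2) ypos[OF T0] by (simp add: divide_le_eq)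
    fix s assume s: "T \<le> s" "s < t"
    have s0: "s \<ge> 0" using s T0 by simp
    have zk: "z s \<le> kappa * y s" using dirichlet_quotient_stays_small[OF T start s(1)] .
    have small: "eta s * (1 + kappa) \<le> kappa\<^sup>2" "2 * K\<^sup>2 * z s powr q \<le> e1 / 4"
      using T s by (auto simp: small_from_def)
    define Y where "Y = y s powr (1 + p)"
    have Y: "Y > 0" using ypos[OF s0] by (simp add: Y_def)
    have "rdini_le (\<lambda>t. - y t) s (kappa * y s + 2 * z s + (G s)\<^sup>2 / kappa)"
      by (rule rdini_neg_y[OF s0 kappa_pos])
    moreover have "kappa * y s + 2 * z s + (G s)\<^sup>2 / kappa \<le> 4 * kappa * y s"
    proof -
      have "(G s)\<^sup>2 \<le> eta s * (y s + kappa * y s)"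
        using G_squared_le_eta[of s] mult_left_mono[OF zk eta_nonneg[of s]] by (simp add: algebra_simps)
      also have "\<dots> = (eta s * (1 + kappa)) * y s" by (simp add: algebra_simps)
      also have "\<dots> \<le> kappa\<^sup>2 * y s" using small(1) y_nonneg by (rule mult_right_mono)
      finally have "(G s)\<^sup>2 / kappa \<le> kappa * y s"
        using kappa_pos by (simp add: divide_le_eq power2_eq_square mult_ac)
      then show ?thesis using zk by linarith
    qed
    ultimately have ry: "rdini_le (\<lambda>t. - y t) s (4 * kappa * y s)" by (rule rdini_le_mono)
    have lim: "((\<lambda>t. - y t) \<longlongrightarrow> - y s) (at_right s)"
    proof -
      have "(y \<longlongrightarrow> y s) (at s within {s..t})"
        using continuous_y[of "{s..t}"] s s0 by (auto simp: continuous_on_def)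
      then show ?thesis using s by (intro tendsto_minus) (simp add: at_within_Icc_at_right)
    qed
    have "((\<lambda>x. - ((- x) powr (1 + p))) has_real_derivative (1 + p) * y s powr p) (at (- y s))"
      using DERIV_minus[OF has_derivative_powr_reflected[OF ypos[OF s0], of "1 + p"]] by simp
    from rdini_le_compose[OF ry lim this]
    have "rdini_le (\<lambda>t. - ((- (- y t)) powr (1 + p))) s ((1 + p) * y s powr p * (4 * kappa * y s))"
      using p_pos ypos[OF s0] by simp
    moreover have "(1 + p) * y s powr p * (4 * kappa * y s) = e1 / 2 * Y"
    proof -
      have "(1 + p) * y s powr p * (4 * kappa * y s) = (8 * (1 + p) * kappa) / 2 * (y s * y s powr p)" by simp
      then show ?thesis by (simp only: kappa_le(2) Y_def powr_one_plus[OF y_nonneg])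
    qed
    ultimately have "rdini_le (\<lambda>t. - (y t powr (1 + p))) s (e1 / 2 * Y)" by simp
    from rdini_le_add[OF rdini_z[OF s0] rdini_le_cmult[OF this M(3)]]
    have "rdini_le (\<lambda>t. z t + M * (- (y t powr (1 + p)))) s ((- e1 * z s + (G s)\<^sup>2) + M * (e1 / 2 * Y))" .
    moreover have "(- e1 * z s + (G s)\<^sup>2) + M * (e1 / 2 * Y) \<le> - (3/4 * e1) * (z s + M * (- Y))"
    proof -
      have "(G s)\<^sup>2 \<le> 2 * K\<^sup>2 * Y + (2 * K\<^sup>2 * z s powr q) * z s"
        using G_squared_le[of s] by (simp add: Y_def powr_one_plus z_nonneg algebra_simps)
      also have "\<dots> \<le> 2 * K\<^sup>2 * Y + e1 / 4 * z s"
        using mult_right_mono[OF small(2) z_nonneg[of s]] by simp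
      also have "2 * K\<^sup>2 * Y \<le> e1 / 4 * M * Y"
        using M(1) e1_pos Y by (intro mult_right_mono) (auto simp: divide_le_eq mult.commute)
      finally have g: "(G s)\<^sup>2 \<le> e1 / 4 * M * Y + e1 / 4 * z s" by simp
      define X Z where "X = e1 * M * Y" and "Z = e1 * z s"
      have "(G s)\<^sup>2 \<le> X / 4 + Z / 4" using g by (simp add: X_def Z_def)
      moreover have "(- e1 * z s + (G s)\<^sup>2) + M * (e1 / 2 * Y) = - Z + (G s)\<^sup>2 + X / 2"
        "- (3/4 * e1) * (z s + M * (- Y)) = - (3/4) * Z + 3/4 * X"
        by (simp_all add: X_def Z_def field_simps)
      ultimately show ?thesis by linarith
    qed
    ultimately show "rdini_le (\<lambda>t. z t + M * (- (y t powr (1 + p)))) s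
        (- (3/4 * e1) * (z s + M * (- (y s powr (1 + p)))))"
      unfolding Y_def by (rule rdini_le_mono)
  qed (use t in auto)
  then show ?thesis using M(3) that by simp
qed

text \<open>
  By \<open>z \<le> M y\<^sup>1\<^sup>+\<^sup>p\<close>, the function \<open>y\<close> satisfies \<open>- y' \<le> C y\<^sup>1\<^sup>+\<^sup>p\<^sup>/\<^sup>2\<close>, that is, \<open>y\<close> to the power
  \<open>- p / 2\<close> grows at most linearly.
\<close>

lemma y_power_lower_bound:
  assumes nz: "\<And>t. t \<ge> 0 \<Longrightarrow> u t \<noteq> 0"
    and T: "T \<ge> 0" and M: "M > 0" "\<And>t. t \<ge> T \<Longrightarrow> z t \<le> M * y t powr (1 + p)"
  obtains C where "C > 0" "\<And>t. t \<ge> T \<Longrightarrow> y t powr (- p / 2) \<le> C * (1 + t)"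
proof -
  have ypos: "y t > 0" if "t \<ge> 0" for t using nz[OF that] by (simp add: y_def)
  obtain B where B: "B > 0" "\<And>t. t \<ge> T \<Longrightarrow> y t powr (p / 2) \<le> B" "\<And>t. t \<ge> T \<Longrightarrow> z t powr q \<le> B"
  proof -
    have "((\<lambda>t. y t powr (p / 2) + z t powr q) \<longlongrightarrow> 0 + 0) at_top"
      using p_pos q_pos by (intro tendsto_add tendsto_y_powr tendsto_z_powr) auto
    then have "\<forall>\<^sub>F t in at_top. y t powr (p / 2) + z t powr q < 1" by (intro order_tendstoD(2)) auto
    then obtain T1 where T1: "\<And>t. t \<ge> T1 \<Longrightarrow> y t powr (p / 2) + z t powr q < 1"
      unfolding eventually_at_top_linorder by blast
    have "y t powr (p / 2) + z t powr q \<le> 1 * exp (- (0 * t))" if "t \<ge> T1" for t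
      using T1[OF that] by simp
    moreover have "continuous_on {0..T1} (\<lambda>t. y t powr (p / 2) + z t powr q)"
      using p_pos q_pos by (intro continuous_intros continuous_on_powr' continuous_y continuous_z)
        (auto simp: y_nonneg z_nonneg)
    ultimately obtain B where B: "B > 0" "\<forall>t\<ge>0. y t powr (p / 2) + z t powr q \<le> B * exp (- (0 * t))"
      using exp_bound_extend[of T1 "\<lambda>t. y t powr (p / 2) + z t powr q" 1 0] by blast
    have "y t powr (p / 2) \<le> B" "z t powr q \<le> B" if "t \<ge> T" for t
    proof -
      have "y t powr (p / 2) + z t powr q \<le> B" using B(2) T that by simp
      then show "y t powr (p / 2) \<le> B" "z t powr q \<le> B"
        using powr_ge_zero[of "y t" "p/2"] powr_ge_zero[of "z t" q] by linarith+
    qed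
    then show ?thesis using that B(1) by blast
  qed
  define C where "C = 1 + 2 * M * B + 2 * K\<^sup>2 * (1 + B * M)"
  have C: "C > 0" using M B by (simp add: C_def add_pos_nonneg)
  define D where "D = p / 2 * C"
  define c0 where "c0 = y T powr (- p / 2)"
  have c0: "c0 \<ge> 0" by (simp add: c0_def)
  have bound: "y t powr (- p / 2) + (- c0 - D * (t - T)) \<le> 0" if t: "t \<ge> T" for t
  proof (rule comparison_principle[where a = T and b = t and C = 0 and F = "\<lambda>t. y t powr (- p / 2) + (- c0 - D * (t - T))"])
    have "\<forall>s\<in>{T..t}. y s \<noteq> 0" using ypos T by (metis atLeastAtMost_iff less_irrefl order.trans)
    then show "continuous_on {T..t} (\<lambda>t. y t powr (- p / 2) + (- c0 - D * (t - T)))"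
      using T by (intro continuous_intros continuous_y) auto
    fix s assume s: "T \<le> s" "s < t"
    have s0: "s \<ge> 0" using s T by simp
    note ys = ypos[OF s0]
    define a where "a = y s powr (p / 2)"
    have a: "a > 0" using ys by (simp add: a_def)
    have aa: "y s powr p = a * a" by (simp add: a_def flip: powr_add)
    \<comment> \<open>Balancing \<open>\<sigma> y\<close> against \<open>G\<^sup>2 / \<sigma>\<close> with \<open>G\<^sup>2\<close> of order \<open>a\<^sup>2 y\<close> suggests \<open>\<sigma> = a\<close>.\<close>
    have "rdini_le (\<lambda>t. - y t) s (a * y s + 2 * z s + (G s)\<^sup>2 / a)" by (rule rdini_neg_y[OF s0 a])
    moreover have "a * y s + 2 * z s + (G s)\<^sup>2 / a \<le> C * (a * y s)"
    proof -
      have z1: "z s \<le> M * (y s * (a * a))"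
        using M(2)[OF s(1)] by (simp add: powr_one_plus[OF y_nonneg] aa)
      have aB: "a \<le> B" "z s powr q \<le> B" using B s by (auto simp: a_def)
      have "z s * z s powr q \<le> (M * (y s * (a * a))) * B"
        using z1 aB(2) M(1) ys a by (intro mult_mono) auto
      moreover have "(G s)\<^sup>2 \<le> 2 * K\<^sup>2 * (y s * (a * a) + z s * z s powr q)"
        using G_squared_le[of s] by (simp only: powr_one_plus[OF y_nonneg] powr_one_plus[OF z_nonneg] aa)
      moreover have "2 * K\<^sup>2 * (y s * (a * a) + z s * z s powr q) \<le> 2 * K\<^sup>2 * (y s * (a * a) + (M * (y s * (a * a))) * B)"
        using calculation(1) by (intro mult_left_mono add_left_mono) auto
      ultimately have "(G s)\<^sup>2 \<le> 2 * K\<^sup>2 * (y s * (a * a) + (M * (y s * (a * a))) * B)" by linarith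
      then have "(G s)\<^sup>2 / a \<le> (2 * K\<^sup>2 * (y s * (a * a) + (M * (y s * (a * a))) * B)) / a"
        using a by (intro divide_right_mono) auto
      also have "\<dots> = 2 * K\<^sup>2 * (1 + B * M) * (a * y s)" using a by (simp add: field_simps)
      finally have g: "(G s)\<^sup>2 / a \<le> 2 * K\<^sup>2 * (1 + B * M) * (a * y s)" .
      have "M * (y s * (a * a)) = M * a * (a * y s)" by simp
      also have "\<dots> \<le> M * B * (a * y s)" using M aB a ys by (intro mult_right_mono mult_left_mono) auto
      finally have "z s \<le> M * B * (a * y s)" using z1 by linarith
      then show ?thesis using g by (simp add: C_def algebra_simps)
    qed
    ultimately have ry: "rdini_le (\<lambda>t. - y t) s (C * (a * y s))" by (rule rdini_le_mono)
    have lim: "((\<lambda>t. - y t) \<longlongrightarrow> - y s) (at_right s)"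
    proof -
      have "(y \<longlongrightarrow> y s) (at s within {s..t})"
        using continuous_y[of "{s..t}"] s s0 by (auto simp: continuous_on_def)
      then show ?thesis using s by (intro tendsto_minus) (simp add: at_within_Icc_at_right)
    qed
    have "((\<lambda>x. (- x) powr (- p / 2)) has_real_derivative p / 2 * y s powr (- p / 2 - 1)) (at (- y s))"
      using has_derivative_powr_reflected[OF ys, of "- p / 2"] by simp
    from rdini_le_compose[OF ry lim this]
    have "rdini_le (\<lambda>t. (- (- y t)) powr (- p / 2)) s (p / 2 * y s powr (- p / 2 - 1) * (C * (a * y s)))"
      using p_pos ys by simp
    moreover have "p / 2 * y s powr (- p / 2 - 1) * (C * (a * y s)) = D"
    proof -
      have "y s powr (- p / 2 - 1) * (a * y s) = y s powr (- p / 2 - 1) * y s powr (p / 2) * y s powr 1"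
        using ys by (simp add: a_def)
      also have "\<dots> = y s powr 0" by (simp only: powr_add[symmetric]) simp
      also have "\<dots> = 1" using ys by simp
      finally have "y s powr (- p / 2 - 1) * (a * y s) = 1" .
      moreover have "p / 2 * y s powr (- p / 2 - 1) * (C * (a * y s)) = p / 2 * C * (y s powr (- p / 2 - 1) * (a * y s))"
        by (simp only: mult_ac)
      ultimately show ?thesis by (simp add: D_def)
    qed
    ultimately have "rdini_le (\<lambda>t. y t powr (- p / 2)) s D" by simp
    moreover have "((\<lambda>t. - c0 - D * (t - T)) has_real_derivative - D) (at s)"
      by (auto intro!: derivative_eq_intros)
    ultimately have "rdini_le (\<lambda>t. y t powr (- p / 2) + (- c0 - D * (t - T))) s (D + - D)"
      by (rule rdini_le_add[OF _ rdini_le_deriv])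
    then show "rdini_le (\<lambda>t. y t powr (- p / 2) + (- c0 - D * (t - T))) s
        (0 * (y s powr (- p / 2) + (- c0 - D * (s - T))))" by simp
  qed (use t in \<open>auto simp: c0_def\<close>)
  have D: "D \<ge> 0" using C p_pos by (simp add: D_def)
  show ?thesis
  proof (rule that[of "1 + c0 + D"])
    show "1 + c0 + D > 0" using D c0 by simp
    fix t assume t: "t \<ge> T"
    have "D * (t - T) \<le> D * t" using D T by (intro mult_left_mono) auto
    moreover have "(1 + c0 + D) * (1 + t) =
        1 + c0 + D + t + c0 * t + D * t" by (simp add: algebra_simps)
    moreover have "0 \<le> c0 * t" using t T c0 by simp
    ultimately show "y t powr (- p / 2) \<le> (1 + c0 + D) * (1 + t)"
      using bound[OF t] t T D by linarith
  qed
qed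

text \<open>
  The bounds for late times extend to all times, with other constants, because the solution has no
  zero on the remaining compact interval.
\<close>

lemma small_dirichlet_quotient_imp_slow:
  assumes nz: "\<And>t. t \<ge> 0 \<Longrightarrow> u t \<noteq> 0"
    and T: "small_from T0" "T \<ge> T0" and start: "z T \<le> kappa * y T"
  shows "slow_solution D A p u"
proof -
  have T0: "T \<ge> 0" using T by (simp add: small_from_def)
  define N where "N t = norm (u t)" for t
  define W where "W t = norm (op_power D A (1/2) (u t))" for t
  have Npos: "N t > 0" if "t \<ge> 0" for t using nz[OF that] by (simp add: N_def)
  have yN: "y t = (N t)\<^sup>2" and zW: "z t = (W t)\<^sup>2" for t by (auto simp: y_def z_def N_def W_def)
  obtain M where M: "M > 0" "\<And>t. t \<ge> T \<Longrightarrow> z t \<le> M * y t powr (1 + p)"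
    using z_le_power_y[OF nz T start] by blast
  obtain C where C: "C > 0" "\<And>t. t \<ge> T \<Longrightarrow> y t powr (- p / 2) \<le> C * (1 + t)"
    using y_power_lower_bound[OF nz T0 M] by blast
  have contN: "continuous_on {0..T} N" "continuous_on {0..T} W"
    unfolding N_def W_def by (intro continuous_intros continuous_on_u continuous_on_sqrt_u; auto)+
  have low: "C powr (- 1 / p) / (1 + t) powr (1 / p) \<le> N t" if t: "t \<ge> T" for t
  proof -
    have t0: "t \<ge> 0" using t T0 by simp
    have "N t powr (- p) \<le> C * (1 + t)"
      using C(2)[OF t] Npos[OF t0] by (simp add: yN powr_powr flip: powr_numeral)
    moreover have "N t powr (- p) > 0" using Npos[OF t0] by simp
    ultimately have "(C * (1 + t)) powr (- 1 / p) \<le> (N t powr (- p)) powr (- 1 / p)"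
      using p_pos by (intro powr_mono2') auto
    also have "\<dots> = N t" using Npos[OF t0] p_pos by (simp add: powr_powr)
    also have "(C * (1 + t)) powr (- 1 / p) = C powr (- 1 / p) / (1 + t) powr (1 / p)"
      using C(1) t0 by (simp add: powr_mult powr_minus divide_inverse)
    finally show ?thesis .
  qed
  have up: "W t \<le> sqrt M * N t powr (1 + p)" if t: "t \<ge> T" for t
  proof -
    have t0: "t \<ge> 0" using t T0 by simp
    have "(W t)\<^sup>2 \<le> M * ((N t)\<^sup>2 powr (1 + p))" using M(2)[OF t] by (simp add: yN zW)
    also have "(N t)\<^sup>2 powr (1 + p) = (N t powr (1 + p))\<^sup>2"
      using Npos[OF t0] by (simp add: powr_powr mult.commute flip: powr_numeral)
    also have "M * (N t powr (1 + p))\<^sup>2 = (sqrt M * N t powr (1 + p))\<^sup>2"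
      using M(1) by (simp add: power_mult_distrib)
    finally show ?thesis by (rule power2_le_imp_le) (use M(1) in simp)
  qed
  have ne: "{0..T} \<noteq> {}" using T0 by simp
  have Nne: "\<forall>s\<in>{0..T}. N s \<noteq> 0" using Npos by (metis atLeastAtMost_iff less_irrefl)
  obtain c1 where c1: "c1 > 0" "\<And>t. t \<in> {0..T} \<Longrightarrow> c1 \<le> N t * (1 + t) powr (1 / p)"
  proof -
    have "continuous_on {0..T} (\<lambda>t. N t * (1 + t) powr (1 / p))"
      by (intro continuous_intros contN) auto
    from continuous_attains_inf[OF compact_Icc ne this]
    obtain x where x: "x \<in> {0..T}" "\<And>t. t \<in> {0..T} \<Longrightarrow> N x * (1 + x) powr (1 / p) \<le> N t * (1 + t) powr (1 / p)"
      by blast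
    show ?thesis by (rule that[OF _ x(2)]) (use x(1) Npos[of x] in auto)
  qed
  obtain c2 where c2: "\<And>t. t \<in> {0..T} \<Longrightarrow> W t / N t powr (1 + p) \<le> c2"
  proof -
    have "continuous_on {0..T} (\<lambda>t. W t / N t powr (1 + p))"
      using Nne by (intro continuous_intros contN) auto
    from continuous_attains_sup[OF compact_Icc ne this] show ?thesis using that by blast
  qed
  define M1 where "M1 = min c1 (C powr (- 1 / p))"
  define M2 where "M2 = max 1 (max c2 (sqrt M))"
  have "M1 / (1 + t) powr (1 / p) \<le> N t \<and> W t \<le> M2 * N t powr (1 + p)" if t0: "t \<ge> 0" for t
  proof (cases "t \<le> T")
    case True
    have "M1 \<le> N t * (1 + t) powr (1 / p)" using c1(2)[of t] True t0 by (simp add: M1_def)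
    moreover have "W t \<le> c2 * N t powr (1 + p)"
      using c2[of t] True t0 Npos[OF t0] by (simp add: divide_le_eq)
    moreover have "c2 * N t powr (1 + p) \<le> M2 * N t powr (1 + p)" by (intro mult_right_mono) (auto simp: M2_def)
    ultimately show ?thesis using t0 by (simp add: divide_le_eq)
  next
    case False
    have "M1 / (1 + t) powr (1 / p) \<le> C powr (- 1 / p) / (1 + t) powr (1 / p)"
      by (intro divide_right_mono) (auto simp: M1_def)
    moreover have "sqrt M * N t powr (1 + p) \<le> M2 * N t powr (1 + p)" by (intro mult_right_mono) (auto simp: M2_def)
    ultimately show ?thesis using low[of t] up[of t] False by linarith
  qed
  moreover have "M1 > 0" "M2 > 0" using c1(1) C(1) by (auto simp: M1_def M2_def)
  ultimately show ?thesis unfolding slow_solution_def N_def W_def by blast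
qed

end


subsection \<open>Fast solutions\<close>

context discrete_operator
begin

lemma eigenspace_subset_dom: "v \<in> eigenspace j \<Longrightarrow> v \<in> dom_power D A (1/2)"
proof -
  assume v: "v \<in> eigenspace j"
  have "P n v = (if n = j then v else 0)" for n using P_P[of n j v] P_fixes[OF v] by simp
  then have "(\<lambda>n. e n * (norm (P n v))\<^sup>2) = (\<lambda>n. if n = j then e n * (norm v)\<^sup>2 else 0)" by auto
  then show ?thesis unfolding mem_dom_sqrt_iff by (simp only: sums_summable[OF sums_single])
qed

lemma dom_diff:
  assumes "x \<in> dom_power D A (1/2)" "x' \<in> dom_power D A (1/2)"
  shows "x - x' \<in> dom_power D A (1/2)"
  unfolding mem_dom_sqrt_iff
proof (rule summable_comparison_test'[of "\<lambda>n. 2 * (e n * (norm (P n x))\<^sup>2) + 2 * (e n * (norm (P n x'))\<^sup>2)" 0])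
  show "summable (\<lambda>n. 2 * (e n * (norm (P n x))\<^sup>2) + 2 * (e n * (norm (P n x'))\<^sup>2))"
    using assms unfolding mem_dom_sqrt_iff by (intro summable_add summable_mult)
  fix n
  have "(norm (P n (x - x')))\<^sup>2 \<le> (norm (P n x) + norm (P n x'))\<^sup>2"
    unfolding P.diff by (intro power_mono norm_triangle_ineq4) simp
  also have "\<dots> \<le> 2 * (norm (P n x))\<^sup>2 + 2 * (norm (P n x'))\<^sup>2"
    using zero_le_power2[of "norm (P n x) - norm (P n x')"] by (simp add: power2_eq_square algebra_simps)
  finally have "e n * (norm (P n (x - x')))\<^sup>2 \<le> e n * (2 * (norm (P n x))\<^sup>2 + 2 * (norm (P n x'))\<^sup>2)"
    using e_nonneg by (rule mult_left_mono)
  then show "norm (e n * (norm (P n (x - x')))\<^sup>2) \<le> 2 * (e n * (norm (P n x))\<^sup>2) + 2 * (e n * (norm (P n x'))\<^sup>2)"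
    using e_nonneg[of n] by (simp add: algebra_simps)
qed

text \<open>
  The weight whose energy is \<open>z\<close> without the modes below \<open>k\<close>.
\<close>

definition tail_weight :: "nat \<Rightarrow> nat \<Rightarrow> real" where
  "tail_weight k n = (if n \<ge> k then e n else 0)"

lemma dominated_tail_weight: "dominated (\<lambda>n. c * tail_weight k n)"
proof (rule dominatedI[of _ "\<bar>c\<bar>"])
  fix n
  have "tail_weight k n \<le> 1 + e n" "tail_weight k n \<ge> 0" using e_nonneg[of n] by (auto simp: tail_weight_def)
  then show "\<bar>c * tail_weight k n\<bar> \<le> \<bar>c\<bar> * (1 + e n)" by (simp add: abs_mult mult_left_mono)
qed

text \<open>
  Above \<open>k\<close> the norm is controlled by \<open>A\<^sup>1\<^sup>/\<^sup>2\<close> alone, since \<open>1 + e n \<le> (1 + 1 / e k) e n\<close>.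
\<close>

lemma low_and_high_modes:
  assumes x: "x \<in> dom_power D A (1/2)" and k: "e k > 0"
  shows "(norm x)\<^sup>2 + (norm (op_power D A (1/2) x))\<^sup>2
    \<le> (\<Sum>n<k. (1 + e n) * (norm (P n x))\<^sup>2) + (1 + 1 / e k) * energy (tail_weight k) x"
proof -
  have "(\<lambda>n. if n < k then (1 + e n) * (norm (P n x))\<^sup>2 else 0) sums (\<Sum>n<k. (1 + e n) * (norm (P n x))\<^sup>2)"
    using sums_If_finite_set[of "{..<k}" "\<lambda>n. (1 + e n) * (norm (P n x))\<^sup>2"] by simp
  moreover have "(\<lambda>n. (1 + 1 / e k) * (tail_weight k n * (norm (P n x))\<^sup>2)) sums ((1 + 1 / e k) * energy (tail_weight k) x)"
    using dominated_tail_weight[of 1 k] by (intro sums_mult energy_sums x) simp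
  ultimately have "(\<lambda>n. (if n < k then (1 + e n) * (norm (P n x))\<^sup>2 else 0)
      + (1 + 1 / e k) * (tail_weight k n * (norm (P n x))\<^sup>2))
      sums ((\<Sum>n<k. (1 + e n) * (norm (P n x))\<^sup>2) + (1 + 1 / e k) * energy (tail_weight k) x)"
    by (rule sums_add)
  moreover have "(1 + e n) * (norm (P n x))\<^sup>2 \<le> (if n < k then (1 + e n) * (norm (P n x))\<^sup>2 else 0)
      + (1 + 1 / e k) * (tail_weight k n * (norm (P n x))\<^sup>2)" for n
  proof (cases "n < k")
    case False
    then have "e k \<le> e n" by (simp add: e_le_iff)
    then have "1 + e n \<le> (1 + 1 / e k) * e n" using k by (simp add: field_simps)
    then have "(1 + e n) * (norm (P n x))\<^sup>2 \<le> ((1 + 1 / e k) * e n) * (norm (P n x))\<^sup>2"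
      by (rule mult_right_mono) simp
    then show ?thesis using False by (simp add: tail_weight_def mult.assoc)
  qed (simp add: tail_weight_def)
  ultimately show ?thesis by (intro sums_le[OF _ one_plus_e_sums[OF x]])
qed

end

context semilinear_parabolic
begin

text \<open>
  The \<open>\<gamma>\<close> with \<open>u = O(exp (- \<gamma> t))\<close> in the norm of \<open>D(A\<^sup>1\<^sup>/\<^sup>2)\<close>; the factor \<open>2\<close> is due to the squares.
\<close>

definition decay_rates :: "real set" where
  "decay_rates = {\<gamma>. \<gamma> > 0 \<and> (\<exists>C. \<forall>t\<ge>0. y t + z t \<le> C * exp (- (2 * \<gamma> * t)))}"

text \<open>
  If the Dirichlet quotient stays above \<open>kappa\<close>, the forcing term is bounded by a small multiple of
  \<open>z\<close>, so that \<open>z' \<le> - e1 z / 2\<close>, and \<open>y\<close> is bounded by a multiple of \<open>z\<close>.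
\<close>

lemma decay_rates_nonempty:
  assumes T: "small_from T" and big: "\<And>t. t \<ge> T \<Longrightarrow> kappa * y t \<le> z t"
  shows "decay_rates \<noteq> {}"
proof -
  have T0: "T \<ge> 0" using T by (simp add: small_from_def)
  have "z t \<le> z T * exp (- (e1 / 2 * (t - T)))" if t: "t \<ge> T" for t
  proof -
    have "z t + - (z T * exp (- (e1 / 2 * (t - T)))) \<le> 0"
    proof (rule comparison_principle[where a = T and b = t and C = "- (e1 / 2)" and F = "\<lambda>t. z t + - (z T * exp (- (e1 / 2 * (t - T))))"])
      show "continuous_on {T..t} (\<lambda>t. z t + - (z T * exp (- (e1 / 2 * (t - T)))))"
        using T0 by (intro continuous_intros continuous_z) auto
      fix s assume s: "T \<le> s" "s < t"
      have s0: "s \<ge> 0" using s T0 by simp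
      have "(G s)\<^sup>2 \<le> kappa * z s"
      proof -
        have "eta s * (1 + kappa) \<le> kappa\<^sup>2" using T s by (auto simp: small_from_def)
        then have "eta s * (1 + kappa) * z s \<le> kappa\<^sup>2 * z s" using z_nonneg by (rule mult_right_mono)
        moreover have "eta s * (kappa * y s) \<le> eta s * z s" using big[OF s(1)] eta_nonneg by (rule mult_left_mono)
        moreover have "kappa * (G s)\<^sup>2 \<le> kappa * (eta s * (y s + z s))"
          using G_squared_le_eta kappa_pos by (intro mult_left_mono) auto
        ultimately have "kappa * (G s)\<^sup>2 \<le> kappa * (kappa * z s)"
          by (simp add: power2_eq_square algebra_simps)
        then show ?thesis using kappa_pos by simp
      qed
      also have "kappa * z s \<le> e1 / 2 * z s" using kappa_le(1) kappa_pos z_nonneg by (intro mult_right_mono) auto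
      finally have g: "(G s)\<^sup>2 \<le> e1 / 2 * z s" .
      have "((\<lambda>t. - (z T * exp (- (e1 / 2 * (t - T))))) has_real_derivative
          e1 / 2 * (z T * exp (- (e1 / 2 * (s - T))))) (at s)"
        by (auto intro!: derivative_eq_intros)
      from rdini_le_add[OF rdini_z[OF s0] rdini_le_deriv[OF this]]
      show "rdini_le (\<lambda>t. z t + - (z T * exp (- (e1 / 2 * (t - T))))) s
          (- (e1 / 2) * (z s + - (z T * exp (- (e1 / 2 * (s - T))))))"
        by (rule rdini_le_mono) (use g in \<open>simp add: algebra_simps\<close>)
    qed (use t in auto)
    then show ?thesis by simp
  qed
  then have "y t + z t \<le> ((1 + 1 / kappa) * z T * exp (e1 / 2 * T)) * exp (- (e1 / 2 * t))" if t: "t \<ge> T" for t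
  proof -
    have "y t \<le> z t / kappa" using big[OF t] kappa_pos by (simp add: field_simps)
    then have "y t + z t \<le> (1 + 1 / kappa) * z t" by (simp add: algebra_simps)
    also have "\<dots> \<le> (1 + 1 / kappa) * (z T * exp (- (e1 / 2 * (t - T))))"
      using \<open>\<And>t. t \<ge> T \<Longrightarrow> z t \<le> z T * exp (- (e1 / 2 * (t - T)))\<close>[OF t] kappa_pos
      by (intro mult_left_mono) auto
    also have "exp (- (e1 / 2 * (t - T))) = exp (e1 / 2 * T) * exp (- (e1 / 2 * t))"
      by (simp flip: exp_add add: algebra_simps diff_divide_distrib)
    finally show ?thesis by (simp add: mult_ac)
  qed
  moreover have "continuous_on {0..T} (\<lambda>t. y t + z t)"
    by (intro continuous_intros continuous_y continuous_z) auto
  ultimately have "\<exists>C>0. \<forall>t\<ge>0. y t + z t \<le> C * exp (- (e1 / 2 * t))"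
    by (intro exp_bound_extend)
  then have "e1 / 4 \<in> decay_rates" using e1_pos by (auto simp: decay_rates_def)
  then show ?thesis by blast
qed

text \<open>
  A solution decaying at the rate \<open>\<gamma>\<close> has a forcing term decaying at the rate \<open>(1 + excess) \<gamma>\<close>.
\<close>

definition excess :: real where "excess = min p q"

lemma excess_pos: "excess > 0" using p_pos q_pos by (simp add: excess_def)

lemma powr_exponential_bound:
  fixes C x k t a b :: real
  assumes C: "C \<ge> 1" "x \<ge> 0" "x \<le> C * exp (- (k * t))" and k: "k \<ge> 0" "t \<ge> 0" and a: "0 \<le> b" "b \<le> a"
  shows "x powr a \<le> C powr a * exp (- (b * k * t))"
proof -
  have "x powr a \<le> (C * exp (- (k * t))) powr a" using C a by (intro powr_mono2) auto
  also have "\<dots> = C powr a * exp (- (a * k * t))"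
    using C by (simp add: powr_mult exp_powr_real mult_ac)
  also have "\<dots> \<le> C powr a * exp (- (b * k * t))"
    using a k C by (intro mult_left_mono) (auto simp: mult_right_mono)
  finally show ?thesis .
qed

lemma decay_rates_pos: "\<gamma> \<in> decay_rates \<Longrightarrow> \<gamma> > 0"
  by (simp add: decay_rates_def)

lemma decay_rates_bound:
  assumes "\<gamma> \<in> decay_rates"
  shows "\<exists>C\<ge>1. \<forall>t\<ge>0. y t \<le> C * exp (- (2 * \<gamma> * t)) \<and> z t \<le> C * exp (- (2 * \<gamma> * t))"
proof -
  obtain C where C: "\<And>t. t \<ge> 0 \<Longrightarrow> y t + z t \<le> C * exp (- (2 * \<gamma> * t))"
    using assms by (auto simp: decay_rates_def)
  have "y t \<le> max 1 C * exp (- (2 * \<gamma> * t)) \<and> z t \<le> max 1 C * exp (- (2 * \<gamma> * t))" if "t \<ge> 0" for t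
  proof -
    have "C * exp (- (2 * \<gamma> * t)) \<le> max 1 C * exp (- (2 * \<gamma> * t))" by (intro mult_right_mono) auto
    then show ?thesis using C[OF that] y_nonneg[of t] z_nonneg[of t] by linarith
  qed
  then show ?thesis by (intro exI[of _ "max 1 C"]) auto
qed

lemma G_rate:
  assumes "\<gamma> \<in> decay_rates"
  obtains C where "C > 0" "\<And>t. t \<ge> 0 \<Longrightarrow> G t \<le> C * exp (- ((1 + excess) * \<gamma> * t))"
proof -
  obtain C where C1: "C \<ge> 1"
    and C2: "\<forall>t\<ge>0. y t \<le> C * exp (- (2 * \<gamma> * t)) \<and> z t \<le> C * exp (- (2 * \<gamma> * t))"
    using decay_rates_bound[OF assms] by blast
  note C = decay_rates_pos[OF assms] C1 C2[rule_format]
  have norm_eq: "norm x powr a = (norm x)\<^sup>2 powr (a / 2)" for x :: 'a and a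
    by (cases "x = 0") (auto simp: powr_powr simp flip: powr_numeral)
  have Geq: "G t = K * (y t powr ((1 + p) / 2) + z t powr ((1 + q) / 2))" for t
    unfolding G_def y_def z_def by (simp only: norm_eq)
  show ?thesis
  proof (rule that[of "K * (C powr ((1 + p) / 2) + C powr ((1 + q) / 2)) + 1"])
    show "K * (C powr ((1 + p) / 2) + C powr ((1 + q) / 2)) + 1 > 0"
      using K_nonneg by (intro add_nonneg_pos mult_nonneg_nonneg) auto
    fix t :: real assume t: "t \<ge> 0"
    have rate: "exp (- ((1 + excess) / 2 * (2 * \<gamma>) * t)) = exp (- ((1 + excess) * \<gamma> * t))" by simp
    have "y t powr ((1 + p) / 2) \<le> C powr ((1 + p) / 2) * exp (- ((1 + excess) / 2 * (2 * \<gamma>) * t))"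
      using C t excess_pos by (intro powr_exponential_bound) (auto simp: y_nonneg excess_def)
    moreover have "z t powr ((1 + q) / 2) \<le> C powr ((1 + q) / 2) * exp (- ((1 + excess) / 2 * (2 * \<gamma>) * t))"
      using C t excess_pos by (intro powr_exponential_bound) (auto simp: z_nonneg excess_def)
    ultimately have "G t \<le> K * (C powr ((1 + p) / 2) * exp (- ((1 + excess) * \<gamma> * t)) + C powr ((1 + q) / 2) * exp (- ((1 + excess) * \<gamma> * t)))"
      unfolding Geq rate using K_nonneg by (intro mult_left_mono add_mono)
    also have "\<dots> = K * (C powr ((1 + p) / 2) + C powr ((1 + q) / 2)) * exp (- ((1 + excess) * \<gamma> * t))"
      by (simp add: algebra_simps)
    also have "\<dots> \<le> (K * (C powr ((1 + p) / 2) + C powr ((1 + q) / 2)) + 1) * exp (- ((1 + excess) * \<gamma> * t))"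
      by (intro mult_right_mono) auto
    finally show "G t \<le> (K * (C powr ((1 + p) / 2) + C powr ((1 + q) / 2)) + 1) * exp (- ((1 + excess) * \<gamma> * t))" .
  qed
qed

lemma eta_rate:
  assumes "\<gamma> \<in> decay_rates"
  obtains N where "N > 0" "\<And>t. t \<ge> 0 \<Longrightarrow> eta t \<le> N * exp (- (2 * excess * \<gamma> * t))"
proof -
  obtain C where C1: "C \<ge> 1"
    and C2: "\<forall>t\<ge>0. y t \<le> C * exp (- (2 * \<gamma> * t)) \<and> z t \<le> C * exp (- (2 * \<gamma> * t))"
    using decay_rates_bound[OF assms] by blast
  note C = decay_rates_pos[OF assms] C1 C2[rule_format]
  show ?thesis
  proof (rule that[of "2 * K\<^sup>2 * (C powr p + C powr q) + 1"])
    show "2 * K\<^sup>2 * (C powr p + C powr q) + 1 > 0" by (intro add_nonneg_pos mult_nonneg_nonneg) auto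
    fix t :: real assume t: "t \<ge> 0"
    have rate: "exp (- (excess * (2 * \<gamma>) * t)) = exp (- (2 * excess * \<gamma> * t))" by (simp add: mult_ac)
    have "y t powr p \<le> C powr p * exp (- (excess * (2 * \<gamma>) * t))"
      using C t excess_pos by (intro powr_exponential_bound) (auto simp: y_nonneg excess_def)
    moreover have "z t powr q \<le> C powr q * exp (- (excess * (2 * \<gamma>) * t))"
      using C t excess_pos by (intro powr_exponential_bound) (auto simp: z_nonneg excess_def)
    ultimately have "eta t \<le> 2 * K\<^sup>2 * (C powr p * exp (- (2 * excess * \<gamma> * t)) + C powr q * exp (- (2 * excess * \<gamma> * t)))"
      unfolding eta_def rate by (intro mult_left_mono add_mono) auto
    also have "\<dots> = 2 * K\<^sup>2 * (C powr p + C powr q) * exp (- (2 * excess * \<gamma> * t))" by (simp add: algebra_simps)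
    also have "\<dots> \<le> (2 * K\<^sup>2 * (C powr p + C powr q) + 1) * exp (- (2 * excess * \<gamma> * t))"
      by (intro mult_right_mono) auto
    finally show "eta t \<le> (2 * K\<^sup>2 * (C powr p + C powr q) + 1) * exp (- (2 * excess * \<gamma> * t))" .
  qed
qed

text \<open>
  Once the solution decays exponentially, so does the forcing coefficient \<open>eta\<close>, which is
  therefore integrable: the Dirichlet quotient stays bounded, and the solution cannot decay
  faster than all exponentials.
\<close>

lemma decay_rates_bdd_above:
  assumes u0: "u 0 \<noteq> 0"
  shows "bdd_above decay_rates"
proof (cases "decay_rates = {}")
  case False
  then obtain \<gamma> where \<gamma>: "\<gamma> \<in> decay_rates" by blast
  then have \<gamma>0: "\<gamma> > 0" by (simp add: decay_rates_def)
  obtain N where N: "N > 0" "\<And>t. t \<ge> 0 \<Longrightarrow> eta t \<le> N * exp (- (2 * excess * \<gamma> * t))"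
    using eta_rate[OF \<gamma>] by blast
  define k where "k = 2 * excess * \<gamma>"
  have k: "k > 0" using excess_pos \<gamma>0 by (simp add: k_def)
  have NN: "eta t \<le> N * exp (- (k * t))" if "t \<ge> 0" for t using N(2)[OF that] by (simp add: k_def)
  have NN': "eta t \<le> N" if "t \<ge> 0" for t
  proof -
    have "N * exp (- (k * t)) \<le> N * 1" using N(1) k that by (intro mult_left_mono) auto
    then show ?thesis using NN[OF that] by simp
  qed
  have y0: "y 0 > 0" using u0 by (simp add: y_def)
  define m0 where "m0 = z 0 / y 0"
  have m0: "m0 \<ge> 0" using y0 z_nonneg[of 0] by (simp add: m0_def)
  \<comment> \<open>The solution of \<open>m' = (N / 2) exp (- k t) (1 + m)\<close> that starts at the Dirichlet quotient; it is bounded.\<close>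
  define m where "m t = (1 + m0) * exp (N / (2 * k) * (1 - exp (- (k * t)))) - 1" for t
  have m_nn: "m t \<ge> 0" if "t \<ge> 0" for t
  proof -
    have "0 \<le> N / (2 * k) * (1 - exp (- (k * t)))" using N(1) k that by (intro mult_nonneg_nonneg) auto
    then have "1 * 1 \<le> (1 + m0) * exp (N / (2 * k) * (1 - exp (- (k * t))))" using m0 by (intro mult_mono) auto
    then show ?thesis by (simp add: m_def)
  qed
  define M where "M = (1 + m0) * exp (N / (2 * k))"
  have mM: "m t \<le> M" for t
  proof -
    have "N / (2 * k) * (1 - exp (- (k * t))) \<le> N / (2 * k) * 1"
      using N(1) k by (intro mult_left_mono) auto
    then have "(1 + m0) * exp (N / (2 * k) * (1 - exp (- (k * t)))) \<le> (1 + m0) * exp (N / (2 * k))"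
      using m0 by (intro mult_left_mono) auto
    then show ?thesis by (simp add: m_def M_def)
  qed
  have zm: "z t \<le> m t * y t" if t: "t \<ge> 0" for t
  proof (rule dirichlet_quotient_le[where a = 0 and b = t and N = N and m' = "\<lambda>t. (1 + m t) * (N / 2 * exp (- (k * t)))"])
    show "(m has_real_derivative (1 + m t) * (N / 2 * exp (- (k * t)))) (at t)" for t
      unfolding m_def[abs_def] using k by (auto intro!: derivative_eq_intros)
    show "eta s * (1 + m s) / 2 \<le> (1 + m s) * (N / 2 * exp (- (k * s)))" if "s \<in> {0..t}" for s
    proof -
      have "(1 + m s) * eta s \<le> (1 + m s) * (N * exp (- (k * s)))"
        using NN[of s] m_nn[of s] that by (intro mult_left_mono) auto
      then show ?thesis by (simp add: algebra_simps)
    qed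
    show "z 0 \<le> m 0 * y 0" using y0 by (simp add: m_def m0_def)
  qed (use NN' m_nn t in auto)
  have zM: "z t \<le> M * y t" if "t \<ge> 0" for t
    using zm[OF that] mult_right_mono[OF mM y_nonneg, of t t] by linarith
  have M0: "M \<ge> 0" using m0 by (simp add: M_def)
  define C where "C = 1 + 2 * M + N * (1 + M)"
  have low: "y 0 * exp (- (C * t)) \<le> y t" if "t \<ge> 0" for t
    using exponential_lower_bound[of 0 t M N t] zM M0 NN' that by (simp add: C_def)
  have "\<gamma>' \<le> C / 2" if \<gamma>': "\<gamma>' \<in> decay_rates" for \<gamma>'
  proof -
    obtain C' where C': "\<forall>t\<ge>0. y t \<le> C' * exp (- (2 * \<gamma>' * t))"
      using decay_rates_bound[OF \<gamma>'] by blast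
    have "2 * \<gamma>' \<le> C"
    proof (rule exp_le_exp_imp_rate_le[OF y0, of _ C'])
      show "y 0 * exp (- (C * t)) \<le> C' * exp (- (2 * \<gamma>' * t))" if "t \<ge> 0" for t
        by (rule order.trans[OF low[OF that]]) (use C' that in blast)
    qed
    then show ?thesis by simp
  qed
  then show ?thesis by (rule bdd_aboveI)
qed simp

text \<open>
  For a forcing term that decays faster than \<open>exp (- e\<^sub>n t)\<close>, Duhamel's formula shows that
  \<open>exp (e\<^sub>n t) P n (u t)\<close> is Cauchy, with the error bounded by the tail of the integral.
\<close>

lemma mode_limit:
  assumes G: "\<And>t. t \<ge> 0 \<Longrightarrow> G t \<le> C * exp (- (\<rho> * t))" and n: "e n < \<rho>"
  obtains v C' where "v \<in> eigenspace n" "\<And>t. t \<ge> 0 \<Longrightarrow> norm (P n (u t) - exp (- (e n * t)) *\<^sub>R v) \<le> C' * exp (- (\<rho> * t))"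
proof -
  define l where "l = e n"
  define d where "d = \<rho> - l"
  have d: "d > 0" using n by (simp add: d_def l_def)
  define x where "x t = exp (l * t) *\<^sub>R P n (u t)" for t
  have C: "C \<ge> 0" using G[of 0] G_nonneg[of 0] by simp
  have inc: "norm (x t - x s) \<le> C / d * exp (- (d * s))" if st: "0 \<le> s" "s \<le> t" for s t
  proof -
    have "norm (x t - x s) \<le> integral {s..t} (\<lambda>r. exp (l * r) * G r)"
      using mode_increment[OF st, of n] by (simp add: x_def l_def G_def)
    also have "\<dots> \<le> C / d * exp (- (d * s)) - C / d * exp (- (d * t))"
    proof (rule has_integral_le)
      have "continuous_on {s..t} G"
        using continuous_on_G[of "{s..t}"] st unfolding G_def[abs_def] by auto
      then show "((\<lambda>r. exp (l * r) * G r) has_integral integral {s..t} (\<lambda>r. exp (l * r) * G r)) {s..t}"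
        by (intro integrable_integral integrable_continuous_real continuous_intros)
      have "((\<lambda>r. C * exp (- (d * r))) has_integral (- (C / d * exp (- (d * t))) - - (C / d * exp (- (d * s))))) {s..t}"
        using d st
        by (intro fundamental_theorem_of_calculus)
          (auto intro!: derivative_eq_intros simp flip: has_real_derivative_iff_has_vector_derivative)
      then show "((\<lambda>r. C * exp (- (d * r))) has_integral (C / d * exp (- (d * s)) - C / d * exp (- (d * t)))) {s..t}"
        by simp
      fix a assume "a \<in> {s..t}"
      then have "exp (l * a) * G a \<le> exp (l * a) * (C * exp (- (\<rho> * a)))"
        using G[of a] st by (intro mult_left_mono) auto
      also have "\<dots> = C * exp (- (d * a))" by (simp add: d_def algebra_simps flip: exp_add)
      finally show "exp (l * a) * G a \<le> C * exp (- (d * a))" .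
    qed
    also have "\<dots> \<le> C / d * exp (- (d * s))" using C d by simp
    finally show ?thesis .
  qed
  have lim0: "(\<lambda>k. C / d * exp (- (d * real k))) \<longlonglongrightarrow> 0"
    using filterlim_compose[OF exp_decay_tendsto_0[OF d, of "C / d"] filterlim_real_sequentially] .
  have "Cauchy (\<lambda>k. x (real k))"
  proof (rule CauchyI')
    fix \<epsilon> :: real assume "\<epsilon> > 0"
    then obtain M where M: "\<And>k. k \<ge> M \<Longrightarrow> C / d * exp (- (d * real k)) < \<epsilon>"
      using order_tendstoD(2)[OF lim0] unfolding eventually_sequentially by blast
    have "dist (x (real m)) (x (real k)) < \<epsilon>" if "m \<ge> M" "k > m" for m k
      using inc[of "real m" "real k"] M[OF that(1)] that by (simp add: dist_norm norm_minus_commute)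
    then show "\<exists>M. \<forall>m\<ge>M. \<forall>k>m. dist (x (real m)) (x (real k)) < \<epsilon>" by blast
  qed
  then obtain v where v: "(\<lambda>k. x (real k)) \<longlonglongrightarrow> v" using Cauchy_convergent convergent_def by blast
  have "x (real k) \<in> eigenspace n" for k
    unfolding x_def by (intro subspace_scale[OF subspace_eigenspace] P_in_eigenspace)
  then have "v \<in> eigenspace n" using closed_sequentially[OF closed_eigenspace _ v] by blast
  moreover have "norm (P n (u t) - exp (- (e n * t)) *\<^sub>R v) \<le> C / d * exp (- (\<rho> * t))" if t: "t \<ge> 0" for t
  proof -
    have "norm (v - x t) \<le> C / d * exp (- (d * t))"
    proof (rule tendsto_upperbound)
      show "(\<lambda>k. norm (x (real k) - x t)) \<longlonglongrightarrow> norm (v - x t)" by (intro tendsto_intros v)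
      show "\<forall>\<^sub>F k in sequentially. norm (x (real k) - x t) \<le> C / d * exp (- (d * t))"
        using eventually_ge_at_top[of "nat \<lceil>t\<rceil>"] by eventually_elim (use inc t in \<open>simp add: nat_le_iff ceiling_le_iff\<close>)
    qed simp
    then have "exp (- (l * t)) * norm (x t - v) \<le> exp (- (l * t)) * (C / d * exp (- (d * t)))"
      by (intro mult_left_mono) (auto simp: norm_minus_commute)
    also have "\<dots> = C / d * exp (- (\<rho> * t))" by (simp add: d_def algebra_simps flip: exp_add)
    also have "exp (- (l * t)) * norm (x t - v) = norm (exp (- (l * t)) *\<^sub>R (x t - v))" by simp
    also have "exp (- (l * t)) *\<^sub>R (x t - v) = P n (u t) - exp (- (l * t)) *\<^sub>R v"
      by (simp add: x_def scaleR_diff_right flip: exp_add)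
    finally show ?thesis by (simp add: l_def)
  qed
  ultimately show ?thesis by (rule that)
qed

text \<open>
  The high modes by themselves decay at any rate \<open>\<mu> < e k\<close>; a fraction of the dissipation is used to
  absorb the forcing term. The value of \<open>\<theta>\<close> is the one for which the rate becomes \<open>\<mu>\<close>.
\<close>

lemma high_modes:
  assumes G: "\<And>t. t \<ge> 0 \<Longrightarrow> G t \<le> C * exp (- (\<rho> * t))"
    and \<gamma>: "0 < \<gamma>" "\<gamma> \<le> \<rho>" "\<gamma> < e k"
  obtains C' where "C' > 0" "\<And>t. t \<ge> 0 \<Longrightarrow> energy (tail_weight k) (u t) \<le> C' * exp (- (2 * \<gamma> * t))"
proof -
  define \<mu> where "\<mu> = (\<gamma> + e k) / 2"
  have \<mu>: "\<gamma> < \<mu>" "\<mu> < e k" "0 < \<mu>" using \<gamma> by (auto simp: \<mu>_def)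
  define \<theta> where "\<theta> = e k / (2 * (e k - \<mu>))"
  have \<theta>: "\<theta> > 0" using \<mu> by (simp add: \<theta>_def)
  define X where "X t = energy (tail_weight k) (u t)" for t
  have dom: "dominated (tail_weight k)" using dominated_tail_weight[of 1 k] by simp
  have "energy (\<lambda>n. - (2 * \<mu>) * tail_weight k n) (u t) = - (2 * \<mu>) * X t" if "t \<ge> 0" for t
    using sums_unique2[OF energy_sums[OF u_dom[OF that] dominated_tail_weight[of "- (2 * \<mu>)" k]]]
      sums_mult[OF energy_sums[OF u_dom[OF that] dom], of "- (2 * \<mu>)"]
    by (simp only: X_def mult.assoc)
  moreover have "(tail_weight k n)\<^sup>2 / \<theta> - 2 * tail_weight k n * e n \<le> - (2 * \<mu>) * tail_weight k n" for n
  proof (cases "n \<ge> k")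
    case True
    then have kn: "e k \<le> e n" by (simp add: e_le_iff)
    have th: "1 / \<theta> - 2 = - (2 * \<mu> / e k)" using \<mu> by (simp add: \<theta>_def field_simps)
    have "(e n)\<^sup>2 / \<theta> - 2 * e n * e n = (1 / \<theta> - 2) * (e n * e n)"
      by (simp add: power2_eq_square algebra_simps)
    also have "\<dots> = - (2 * \<mu> * e n * (e n / e k))" unfolding th by simp
    also have "\<dots> \<le> - (2 * \<mu> * e n * 1)"
      using kn \<mu> e_nonneg[of n] by (intro le_imp_neg_le mult_left_mono) auto
    finally show ?thesis using True by (simp add: tail_weight_def)
  qed (simp add: tail_weight_def)
  ultimately have rX: "rdini_le X s (- (2 * \<mu>) * X s + \<theta> * (G s)\<^sup>2)" if "s \<ge> 0" for s
    using rdini_energy[OF dom dominated_tail_weight[of "- (2 * \<mu>)" k] \<theta> _ that] that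
    by (simp add: X_def[abs_def] G_def)
  define B where "B = max (X 0) (\<theta> * C\<^sup>2 / (2 * (\<mu> - \<gamma>))) + 1"
  have "\<theta> * C\<^sup>2 / (2 * (\<mu> - \<gamma>)) \<ge> 0" using \<theta> \<mu> by simp
  then have B: "X 0 \<le> B" "\<theta> * C\<^sup>2 / (2 * (\<mu> - \<gamma>)) \<le> B" "B > 0" by (auto simp: B_def max_def)
  have "X t + - (B * exp (- (2 * \<gamma> * t))) \<le> 0" if t: "t \<ge> 0" for t
  proof (rule comparison_principle[where a = 0 and b = t and C = "- (2 * \<mu>)" and F = "\<lambda>t. X t + - (B * exp (- (2 * \<gamma> * t)))"])
    show "continuous_on {0..t} (\<lambda>t. X t + - (B * exp (- (2 * \<gamma> * t))))"
      unfolding X_def by (intro continuous_intros continuous_on_energy_u dom) auto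
    show "X 0 + - (B * exp (- (2 * \<gamma> * 0))) \<le> 0" using B by simp
    fix s assume s: "0 \<le> s" "s < t"
    define E where "E = exp (- (2 * \<gamma> * s))"
    have "(G s)\<^sup>2 \<le> (C * exp (- (\<rho> * s)))\<^sup>2" using G[OF s(1)] G_nonneg by (intro power_mono) auto
    also have "\<dots> = C\<^sup>2 * exp (- (2 * \<rho> * s))"
      by (simp add: power_mult_distrib mult.assoc flip: exp_of_nat_mult)
    also have "\<dots> \<le> C\<^sup>2 * E" using \<gamma> s by (intro mult_left_mono) (auto simp: E_def mult_right_mono)
    finally have "\<theta> * (G s)\<^sup>2 \<le> \<theta> * (C\<^sup>2 * E)" using \<theta> by (intro mult_left_mono) auto
    also have "\<dots> \<le> (2 * (\<mu> - \<gamma>) * B) * E"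
      using B(2) \<mu> by (simp add: divide_le_eq E_def mult_ac)
    finally have g: "\<theta> * (G s)\<^sup>2 \<le> (2 * (\<mu> - \<gamma>) * B) * E" .
    have "((\<lambda>t. - (B * exp (- (2 * \<gamma> * t)))) has_real_derivative 2 * \<gamma> * B * E) (at s)"
      unfolding E_def by (auto intro!: derivative_eq_intros)
    from rdini_le_add[OF rX[OF s(1)] rdini_le_deriv[OF this]]
    show "rdini_le (\<lambda>t. X t + - (B * exp (- (2 * \<gamma> * t)))) s (- (2 * \<mu>) * (X s + - (B * exp (- (2 * \<gamma> * s)))))"
      by (rule rdini_le_mono) (use g in \<open>simp add: E_def algebra_simps\<close>)
  qed (use t in auto)
  then show ?thesis using that[of B] B(3) by (simp add: X_def)
qed

text \<open>
  The difference between the solution and one exponential mode decays at the rate \<open>\<gamma>\<close> if all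
  low modes of the difference do: the high modes are controlled by the forcing term.
\<close>

lemma remainder_rate:
  assumes G: "\<And>t. t \<ge> 0 \<Longrightarrow> G t \<le> C * exp (- (\<rho> * t))"
    and \<gamma>: "0 < \<gamma>" "\<gamma> \<le> \<rho>" "\<gamma> < e k" and v: "v \<in> eigenspace j" "j < k"
    and low: "\<And>n. n < k \<Longrightarrow> \<exists>B. \<forall>t\<ge>0. norm (P n (u t - exp (- (e j * t)) *\<^sub>R v)) \<le> B * exp (- (\<gamma> * t))"
  obtains C' where "\<And>t. t \<ge> 0 \<Longrightarrow> (dom_power_norm D A (1/2) (u t - exp (- (e j * t)) *\<^sub>R v))\<^sup>2 \<le> C' * exp (- (2 * \<gamma> * t))"
proof -
  define w where "w t = u t - exp (- (e j * t)) *\<^sub>R v" for t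
  obtain C1 where C1: "\<And>t. t \<ge> 0 \<Longrightarrow> energy (tail_weight k) (u t) \<le> C1 * exp (- (2 * \<gamma> * t))"
    using high_modes[OF G \<gamma>] by blast
  obtain B where B: "\<And>n t. n < k \<Longrightarrow> t \<ge> 0 \<Longrightarrow> norm (P n (w t)) \<le> B n * exp (- (\<gamma> * t))"
    using low unfolding w_def by metis
  have ek: "e k > 0" using \<gamma> by simp
  define C' where "C' = (\<Sum>n<k. (1 + e n) * (B n)\<^sup>2) + (1 + 1 / e k) * C1"
  have main: "(dom_power_norm D A (1/2) (w t))\<^sup>2 \<le> C' * exp (- (2 * \<gamma> * t))" if t: "t \<ge> 0" for t
  proof -
    define E where "E = exp (- (2 * \<gamma> * t))"
    have EE: "(exp (- (\<gamma> * t)))\<^sup>2 = E" by (simp add: E_def mult.assoc flip: exp_of_nat_mult)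
    have vd: "exp (- (e j * t)) *\<^sub>R v \<in> eigenspace j" using v(1) by (rule subspace_scale[OF subspace_eigenspace])
    have wd: "w t \<in> dom_power D A (1/2)"
      unfolding w_def by (intro dom_diff u_dom t eigenspace_subset_dom[OF vd])
    have "energy (tail_weight k) (w t) = energy (tail_weight k) (u t)"
    proof -
      have "tail_weight k n * (norm (P n (w t)))\<^sup>2 = tail_weight k n * (norm (P n (u t)))\<^sup>2" for n
      proof (cases "n \<ge> k")
        case True
        then have "P n (exp (- (e j * t)) *\<^sub>R v) = 0" using P_P[of n j v] P_fixes[OF v(1)] v(2) by (simp add: P.scaleR)
        then show ?thesis by (simp add: w_def P.diff)
      qed (simp add: tail_weight_def)
      then show ?thesis unfolding energy_def by (rule suminf_cong)
    qed
    then have high: "energy (tail_weight k) (w t) \<le> C1 * E" using C1[OF t] by (simp add: E_def)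
    have "(norm (P n (w t)))\<^sup>2 \<le> (B n)\<^sup>2 * E" if "n < k" for n
    proof -
      have "(norm (P n (w t)))\<^sup>2 \<le> (B n * exp (- (\<gamma> * t)))\<^sup>2" by (intro power_mono B that t) simp
      then show ?thesis by (simp add: power_mult_distrib EE)
    qed
    then have "(\<Sum>n<k. (1 + e n) * (norm (P n (w t)))\<^sup>2) \<le> (\<Sum>n<k. (1 + e n) * ((B n)\<^sup>2 * E))"
      using e_nonneg by (intro sum_mono mult_left_mono) (auto simp: add_nonneg_nonneg)
    moreover have "(1 + 1 / e k) * energy (tail_weight k) (w t) \<le> (1 + 1 / e k) * (C1 * E)"
      using ek by (intro mult_left_mono high) auto
    ultimately have "(norm (w t))\<^sup>2 + (norm (op_power D A (1/2) (w t)))\<^sup>2 \<le> C' * E"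
      using low_and_high_modes[OF wd ek] by (simp add: C'_def distrib_right sum_distrib_right mult.assoc)
    then show ?thesis by (simp add: dom_power_norm_def E_def)
  qed
  show ?thesis by (rule that[of C']) (use main in \<open>simp add: w_def\<close>)
qed

text \<open>
  Let \<open>\<lambda>\<close> be the supremum of the exponential decay rates. The forcing term decays faster than
  \<open>exp (- \<lambda> t)\<close>, so all modes below \<open>\<lambda>\<close> vanish in the limit, and the supremum could be improved
  if \<open>\<lambda>\<close> were not an eigenvalue whose mode has a nonzero limit.
\<close>

lemma spectral_fast:
  assumes ne: "decay_rates \<noteq> {}" and u0: "u 0 \<noteq> 0"
    and next_le: "\<And>lam n. is_eigenvalue D A (e n) \<Longrightarrow> e n > lam \<Longrightarrow> next_eigenvalue D A lam \<le> ereal (e n)"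
  shows "spectral_fast_solution D A p q u"
proof -
  note bdd = decay_rates_bdd_above[OF u0]
  define lam where "lam = Sup decay_rates"
  have le_lam: "\<gamma> \<le> lam" if "\<gamma> \<in> decay_rates" for \<gamma>
    unfolding lam_def using that bdd by (rule cSup_upper)
  have ex_rate: "\<exists>\<gamma>\<in>decay_rates. \<mu> < \<gamma>" if "\<mu> < lam" for \<mu>
    using less_cSup_iff[OF ne bdd] that by (simp add: lam_def)
  have lam0: "lam > 0" using ne le_lam by (force simp: decay_rates_def)
  have better: "\<exists>\<rho> C. \<mu> < \<rho> \<and> (\<forall>t\<ge>0. G t \<le> C * exp (- (\<rho> * t)))" if "\<mu> < (1 + excess) * lam" for \<mu>
  proof -
    have "\<mu> / (1 + excess) < lam" using that excess_pos by (simp add: divide_less_eq mult.commute)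
    then obtain \<gamma> where \<gamma>: "\<gamma> \<in> decay_rates" "\<mu> / (1 + excess) < \<gamma>" using ex_rate by blast
    obtain C where "\<And>t. t \<ge> 0 \<Longrightarrow> G t \<le> C * exp (- ((1 + excess) * \<gamma> * t))" using G_rate[OF \<gamma>(1)] by blast
    moreover have "\<mu> < (1 + excess) * \<gamma>" using \<gamma>(2) excess_pos by (simp add: divide_less_eq mult.commute)
    ultimately show ?thesis by blast
  qed
  \<comment> \<open>A nonzero limit for \<open>e n < lam\<close> would contradict a rate of decay between \<open>e n\<close> and \<open>lam\<close>.\<close>
  have low_zero: "v = 0"
    if n: "e n < lam" "e n < \<rho>" and v: "\<And>t. t \<ge> 0 \<Longrightarrow> norm (P n (u t) - exp (- (e n * t)) *\<^sub>R v) \<le> C * exp (- (\<rho> * t))"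
    for n v C \<rho>
  proof (rule ccontr)
    assume "v \<noteq> 0"
    obtain \<gamma> where \<gamma>: "\<gamma> \<in> decay_rates" "e n < \<gamma>" using ex_rate[OF n(1)] by blast
    obtain C1 where C1: "C1 \<ge> 1" and C2: "\<forall>t\<ge>0. y t \<le> C1 * exp (- (2 * \<gamma> * t)) \<and> z t \<le> C1 * exp (- (2 * \<gamma> * t))"
      using decay_rates_bound[OF \<gamma>(1)] by blast
    define b where "b = min \<gamma> \<rho>"
    have "0 \<le> C * exp (- (\<rho> * 0))" by (rule order.trans[OF norm_ge_zero v]) simp
    then have C: "C \<ge> 0" by simp
    have bnd: "norm v * exp (- (e n * t)) \<le> (sqrt C1 + C) * exp (- (b * t))" if t: "t \<ge> 0" for t
    proof -
      have "(norm (u t))\<^sup>2 \<le> (sqrt C1 * exp (- (\<gamma> * t)))\<^sup>2"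
        using C2[rule_format, OF t] C1(1) by (simp add: y_def power_mult_distrib mult.assoc flip: exp_of_nat_mult)
      then have "norm (u t) \<le> sqrt C1 * exp (- (\<gamma> * t))" by (rule power2_le_imp_le) (use C1(1) in simp)
      also have "\<dots> \<le> sqrt C1 * exp (- (b * t))" using C1(1) t by (intro mult_left_mono) (auto simp: b_def mult_right_mono)
      finally have 1: "norm (P n (u t)) \<le> sqrt C1 * exp (- (b * t))" using norm_P_le[of n "u t"] by linarith
      have "C * exp (- (\<rho> * t)) \<le> C * exp (- (b * t))" using C t by (intro mult_left_mono) (auto simp: b_def mult_right_mono)
      then have 2: "norm (P n (u t) - exp (- (e n * t)) *\<^sub>R v) \<le> C * exp (- (b * t))" using v[OF t] by linarith
      have "norm v * exp (- (e n * t)) = norm (P n (u t) - (P n (u t) - exp (- (e n * t)) *\<^sub>R v))" by simp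
      also have "\<dots> \<le> norm (P n (u t)) + norm (P n (u t) - exp (- (e n * t)) *\<^sub>R v)" by (rule norm_triangle_ineq4)
      finally show ?thesis using 1 2 by (simp add: distrib_right)
    qed
    have "b \<le> e n" by (rule exp_le_exp_imp_rate_le[OF _ bnd]) (use \<open>v \<noteq> 0\<close> in simp)
    then show False using \<gamma>(2) n(2) by (simp add: b_def)
  qed
  have ex_k: "\<exists>k. \<mu> < e k \<and> (\<forall>n<k. e n \<le> \<mu>)" for \<mu>
  proof -
    have "\<exists>k. \<mu> < e k" using e_top unfolding filterlim_at_top_dense eventually_sequentially by blast
    then show ?thesis using LeastI_ex[of "\<lambda>k. \<mu> < e k"] not_less_Least[of _ "\<lambda>k. \<mu> < e k"] by (meson not_le)
  qed
  have ex_j: "\<exists>j. e j = lam \<and> (\<exists>v \<rho> C. v \<in> eigenspace j \<and> v \<noteq> 0 \<and> lam < \<rho> \<and>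
      (\<forall>t\<ge>0. norm (P j (u t) - exp (- (e j * t)) *\<^sub>R v) \<le> C * exp (- (\<rho> * t))))"
  proof (rule ccontr)
    assume none: "\<not> ?thesis"
    have "lam < (1 + excess) * lam" using lam0 excess_pos by simp
    then obtain \<rho> C where \<rho>: "lam < \<rho>" and G: "\<And>t. t \<ge> 0 \<Longrightarrow> G t \<le> C * exp (- (\<rho> * t))" using better by blast
    obtain k where k: "lam < e k" "\<And>n. n < k \<Longrightarrow> e n \<le> lam" using ex_k by blast
    \<comment> \<open>A rate better than \<open>lam\<close> at which all modes decay if the limits of the low modes vanish.\<close>
    define \<gamma> where "\<gamma> = (lam + min \<rho> (e k)) / 2"
    have \<gamma>: "lam < \<gamma>" "\<gamma> \<le> \<rho>" "\<gamma> < e k" "0 < \<gamma>" using \<rho> k lam0 by (auto simp: \<gamma>_def min_def field_simps)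
    have low: "\<exists>B. \<forall>t\<ge>0. norm (P n (u t - exp (- (e 0 * t)) *\<^sub>R 0)) \<le> B * exp (- (\<gamma> * t))" if n: "n < k" for n
    proof -
      have en: "e n < \<rho>" using k(2)[OF n] \<rho> by simp
      obtain v C' where v: "v \<in> eigenspace n"
        "\<And>t. t \<ge> 0 \<Longrightarrow> norm (P n (u t) - exp (- (e n * t)) *\<^sub>R v) \<le> C' * exp (- (\<rho> * t))"
        using mode_limit[OF G en] by blast
      have "v = 0"
      proof (cases "e n = lam")
        case True
        then show ?thesis using none v \<rho> by blast
      next
        case False
        then show ?thesis using low_zero[OF _ en v(2)] k(2)[OF n] by simp
      qed
      have "0 \<le> C' * exp (- (\<rho> * 0))" by (rule order.trans[OF norm_ge_zero v(2)]) simp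
      then have C': "C' \<ge> 0" by simp
      have "norm (P n (u t)) \<le> C' * exp (- (\<gamma> * t))" if t: "t \<ge> 0" for t
      proof -
        have "C' * exp (- (\<rho> * t)) \<le> C' * exp (- (\<gamma> * t))"
          using C' \<gamma> t by (intro mult_left_mono) (auto simp: mult_right_mono)
        then show ?thesis using v(2)[OF t] \<open>v = 0\<close> by simp
      qed
      then show ?thesis by auto
    qed
    have "0 < k"
    proof (rule ccontr)
      assume "\<not> 0 < k"
      then have "e k = 0" using e_0 by simp
      then show False using k(1) lam0 by simp
    qed
    then obtain C' where C': "\<And>t. t \<ge> 0 \<Longrightarrow> (dom_power_norm D A (1/2) (u t - exp (- (e 0 * t)) *\<^sub>R 0))\<^sup>2 \<le> C' * exp (- (2 * \<gamma> * t))"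
      using remainder_rate[OF G \<gamma>(4,2,3) subspace_0[OF subspace_eigenspace] _ low] by blast
    have "y t + z t \<le> C' * exp (- (2 * \<gamma> * t))" if "t \<ge> 0" for t
      using C'[OF that] by (simp add: dom_power_norm_def y_def z_def)
    then have "\<gamma> \<in> decay_rates" using \<gamma>(4) by (auto simp: decay_rates_def)
    then show False using le_lam \<gamma>(1) by force
  qed
  then obtain j v \<rho>0 C0 where ej: "e j = lam" and v: "v \<in> eigenspace j" "v \<noteq> 0" and \<rho>0: "lam < \<rho>0"
    and v_lim: "\<And>t. t \<ge> 0 \<Longrightarrow> norm (P j (u t) - exp (- (e j * t)) *\<^sub>R v) \<le> C0 * exp (- (\<rho>0 * t))" by blast
  have ev: "is_eigenvector D A lam v" using v ej by (auto simp: is_eigenvector_def eigenspace_def)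
  have conv: "((\<lambda>t. dom_power_norm D A (1/2) (u t - exp (- lam * t) *\<^sub>R v) * exp (\<gamma> * t)) \<longlongrightarrow> 0) at_top"
    if \<gamma>: "ereal \<gamma> < min (next_eigenvalue D A lam) (min (ereal ((1 + p) * lam)) (ereal ((1 + q) * lam)))" for \<gamma> :: real
  proof -
    have \<gamma>1: "ereal \<gamma> < next_eigenvalue D A lam" "\<gamma> < (1 + p) * lam" "\<gamma> < (1 + q) * lam" using \<gamma> by auto
    \<comment> \<open>\<open>\<gamma>\<close> may be smaller than \<open>lam\<close>, but the modes up to \<open>lam\<close> have to count as low.\<close>
    define \<mu> where "\<mu> = max \<gamma> lam"
    have "\<mu> < (1 + excess) * lam" using \<gamma>1 lam0 excess_pos by (auto simp: \<mu>_def excess_def min_def)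
    then obtain \<rho> C where \<rho>: "\<mu> < \<rho>" and G: "\<And>t. t \<ge> 0 \<Longrightarrow> G t \<le> C * exp (- (\<rho> * t))" using better by blast
    obtain k where k: "\<mu> < e k" "\<And>n. n < k \<Longrightarrow> e n \<le> \<mu>" using ex_k by blast
    \<comment> \<open>A rate strictly between \<open>max \<gamma> \<lambda>\<close> and both the rate of \<open>g\<close> and the next mode.\<close>
    define \<gamma>' where "\<gamma>' = (\<mu> + min \<rho> (e k)) / 2"
    have \<gamma>': "\<mu> < \<gamma>'" "\<gamma>' \<le> \<rho>" "\<gamma>' < e k" "0 < \<gamma>'"
      using \<rho> k lam0 by (auto simp: \<gamma>'_def \<mu>_def min_def field_simps)
    have jk: "j < k"
    proof (rule ccontr)
      assume "\<not> j < k"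
      then have "e k \<le> e j" by (simp add: e_le_iff)
      then show False using k(1) ej by (simp add: \<mu>_def)
    qed
    have low: "\<exists>B. \<forall>t\<ge>0. norm (P n (u t - exp (- (e j * t)) *\<^sub>R v)) \<le> B * exp (- (\<gamma>' * t))" if n: "n < k" for n
    proof -
      have en: "e n < \<rho>" using k(2)[OF n] \<rho> by simp
      obtain v' C' where v': "v' \<in> eigenspace n"
        "\<And>t. t \<ge> 0 \<Longrightarrow> norm (P n (u t) - exp (- (e n * t)) *\<^sub>R v') \<le> C' * exp (- (\<rho> * t))"
        using mode_limit[OF G en] by blast
      have "0 \<le> C' * exp (- (\<rho> * 0))" by (rule order.trans[OF norm_ge_zero v'(2)]) simp
      then have C': "C' \<ge> 0" by simp
      have "P n (u t - exp (- (e j * t)) *\<^sub>R v) = P n (u t) - exp (- (e n * t)) *\<^sub>R v'" if t: "t \<ge> 0" for t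
      proof (cases "n = j")
        case True
        \<comment> \<open>The limit in the eigenspace for \<open>lam\<close> was obtained with another rate for the error, but is the same.\<close>
        have "v' = v"
        proof (rule ccontr)
          assume "v' \<noteq> v"
          define b where "b = min \<rho> \<rho>0"
          have "0 \<le> C0 * exp (- (\<rho>0 * 0))" by (rule order.trans[OF norm_ge_zero v_lim]) simp
          then have C0: "C0 \<ge> 0" by simp
          have bnd: "norm (v' - v) * exp (- (e j * t)) \<le> (C' + C0) * exp (- (b * t))" if t: "t \<ge> 0" for t
          proof -
            have "norm (v' - v) * exp (- (e j * t)) = norm ((P j (u t) - exp (- (e j * t)) *\<^sub>R v) - (P j (u t) - exp (- (e j * t)) *\<^sub>R v'))"
              by (simp flip: scaleR_diff_right)
            also have "\<dots> \<le> C0 * exp (- (\<rho>0 * t)) + C' * exp (- (\<rho> * t))"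
              using v_lim[OF t] v'(2)[OF t] True norm_triangle_ineq4 by (smt (verit))
            also have "\<dots> \<le> C0 * exp (- (b * t)) + C' * exp (- (b * t))"
              using C0 C' t by (intro add_mono mult_left_mono) (auto simp: b_def mult_right_mono)
            finally show ?thesis by (simp add: distrib_right)
          qed
          have "b \<le> e j" by (rule exp_le_exp_imp_rate_le[OF _ bnd]) (use \<open>v' \<noteq> v\<close> in simp)
          then show False using \<rho> \<rho>0 ej by (auto simp: b_def \<mu>_def min_def split: if_splits)
        qed
        then show ?thesis using True P_fixes[OF v(1)] by (simp add: P.diff P.scaleR)
      next
        case False
        have Pv: "P n v = 0" using P_P[of n j v] P_fixes[OF v(1)] False by simp
        have "v' = 0"
        proof (cases "e n < lam")
          case True
          then show ?thesis using low_zero[OF _ en v'(2)] by simp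
        next
          case nl: False
          then have gt: "e n > lam" using False ej e_inj[of n j] by force
          show ?thesis
          proof (rule ccontr)
            assume "v' \<noteq> 0"
            then have "is_eigenvalue D A (e n)"
              using v'(1) by (auto simp: is_eigenvalue_def is_eigenvector_def eigenspace_def)
            from next_le[OF this gt] \<gamma>1(1) have "\<gamma> < e n" by (metis ereal_less(2) less_ereal.simps(1) order_less_le_trans)
            moreover have "e n \<le> \<gamma>" using k(2)[OF n] gt by (auto simp: \<mu>_def max_def split: if_splits)
            ultimately show False by simp
          qed
        qed
        then show ?thesis by (simp add: P.diff P.scaleR Pv)
      qed
      moreover have "C' * exp (- (\<rho> * t)) \<le> C' * exp (- (\<gamma>' * t))" if "t \<ge> 0" for t
        using C' \<gamma>' that by (intro mult_left_mono) (auto simp: mult_right_mono)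
      ultimately have "\<forall>t\<ge>0. norm (P n (u t - exp (- (e j * t)) *\<^sub>R v)) \<le> C' * exp (- (\<gamma>' * t))"
        using v'(2) by (metis order.trans)
      then show ?thesis by blast
    qed
    obtain C' where C': "\<And>t. t \<ge> 0 \<Longrightarrow> (dom_power_norm D A (1/2) (u t - exp (- (e j * t)) *\<^sub>R v))\<^sup>2 \<le> C' * exp (- (2 * \<gamma>' * t))"
      using remainder_rate[OF G \<gamma>'(4,2,3) v(1) jk low] by blast
    define X where "X t = dom_power_norm D A (1/2) (u t - exp (- lam * t) *\<^sub>R v)" for t
    have X0: "X t \<ge> 0" for t by (simp add: X_def dom_power_norm_def)
    have "X t * exp (\<gamma> * t) \<le> sqrt C' * exp (- ((\<gamma>' - \<gamma>) * t))" if t: "t \<ge> 0" for t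
    proof -
      have "(X t)\<^sup>2 \<le> C' * exp (- (2 * \<gamma>' * t))" using C'[OF t] by (simp add: X_def ej)
      then have "sqrt ((X t)\<^sup>2) \<le> sqrt (C' * exp (- (2 * \<gamma>' * t)))" by (rule real_sqrt_le_mono)
      also have "\<dots> = sqrt C' * sqrt ((exp (- (\<gamma>' * t)))\<^sup>2)"
        by (simp add: real_sqrt_mult mult.assoc flip: exp_of_nat_mult)
      finally have "X t \<le> sqrt C' * exp (- (\<gamma>' * t))" using X0 by simp
      then have "X t * exp (\<gamma> * t) \<le> sqrt C' * exp (- (\<gamma>' * t)) * exp (\<gamma> * t)" by (intro mult_right_mono) auto
      then show ?thesis by (simp add: mult.assoc algebra_simps flip: exp_add)
    qed
    then have up: "\<forall>\<^sub>F t in at_top. X t * exp (\<gamma> * t) \<le> sqrt C' * exp (- ((\<gamma>' - \<gamma>) * t))"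
      by (rule eventually_mono[OF eventually_ge_at_top[of 0]])
    have lo: "\<forall>\<^sub>F t in at_top. 0 \<le> X t * exp (\<gamma> * t)" using X0 by simp
    have "((\<lambda>t. sqrt C' * exp (- ((\<gamma>' - \<gamma>) * t))) \<longlongrightarrow> 0) at_top"
      using \<gamma>' by (intro exp_decay_tendsto_0) (simp add: \<mu>_def)
    from tendsto_sandwich[OF lo up tendsto_const this]
    have "((\<lambda>t. X t * exp (\<gamma> * t)) \<longlongrightarrow> 0) at_top" .
    then show ?thesis by (simp add: X_def)
  qed
  show ?thesis
    unfolding spectral_fast_solution_def using lam0 ev conv by blast
qed

lemma slow_or_fast:
  assumes u0: "u 0 \<noteq> 0" and nz: "\<And>t. t \<ge> 0 \<Longrightarrow> u t \<noteq> 0"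
    and next_le: "\<And>lam n. is_eigenvalue D A (e n) \<Longrightarrow> e n > lam \<Longrightarrow> next_eigenvalue D A lam \<le> ereal (e n)"
  shows "slow_solution D A p u \<or> spectral_fast_solution D A p q u"
proof -
  obtain T where T: "small_from T" using small_from_exists by blast
  show ?thesis
  proof (cases "\<exists>s\<ge>T. z s \<le> kappa * y s")
    case True
    then show ?thesis using small_dirichlet_quotient_imp_slow[OF nz T] by blast
  next
    case False
    then have "decay_rates \<noteq> {}" by (intro decay_rates_nonempty[OF T]) (meson less_imp_le not_le)
    then show ?thesis using spectral_fast[OF _ u0 next_le] by blast
  qed
qed

end


section \<open>Spectrum and eigenvalues\<close>

context self_adjoint
begin

lemma eigenvalue_in_spectrum:
  assumes "is_eigenvalue D A l"
  shows "l \<in> spectrum D A"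
proof (rule ccontr)
  assume "l \<notin> spectrum D A"
  then have "l \<in> resolvent_set D A" by (simp add: spectrum_def)
  from resolvent_set_bounded_below[OF this] obtain d where
    d: "d > 0" "\<And>u. u \<in> D \<Longrightarrow> d * norm u \<le> norm (A u - l *\<^sub>R u)" by blast
  obtain v where v: "v \<in> D" "v \<noteq> 0" "A v = l *\<^sub>R v"
    using assms by (auto simp: is_eigenvalue_def is_eigenvector_def)
  have "d * norm v \<le> 0" using d(2)[OF v(1)] v(3) by simp
  then show False using d(1) v(2) by (simp add: mult_le_0_iff)
qed

lemma spectrum_nonneg:
  assumes nn: "nonnegative_operator D A" and l: "l \<in> spectrum D A"
  shows "l \<ge> 0"
proof (rule ccontr)
  assume "\<not> l \<ge> 0"
  then have l0: "- l > 0" by simp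
  have "l \<in> resolvent_set D A"
  proof (rule bounded_below_imp_resolvent[OF l0])
    fix u assume u: "u \<in> D"
    have "(- l * norm u) * norm u \<le> (A u - l *\<^sub>R u) \<bullet> u"
      using nn u by (simp add: nonnegative_operator_def inner_diff_left dot_square_norm power2_eq_square)
    also have "\<dots> \<le> norm (A u - l *\<^sub>R u) * norm u" by (rule norm_cauchy_schwarz)
    finally have "(- l * norm u) * norm u \<le> norm (A u - l *\<^sub>R u) * norm u" .
    then show "- l * norm u \<le> norm (A u - l *\<^sub>R u)"
      by (cases "u = 0", simp) (erule mult_right_le_imp_le, simp)
  qed
  then show False using l by (simp add: spectrum_def)
qed

text \<open>
  A finite limit would be outside the range of \<open>e\<close>, hence in the resolvent set, where \<open>A - L\<close> is bounded
  below; but eigenvectors for eigenvalues close to \<open>L\<close> violate the bound.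
\<close>

lemma increasing_eigenvalues_tend_to_infinity:
  assumes mono: "strict_mono e" and spec: "spectrum D A = range e"
    and ev: "\<And>n. is_eigenvalue D A (e n)"
  shows "filterlim e at_top sequentially"
proof (cases "\<exists>B. \<forall>n. e n \<le> B")
  case True
  then obtain B where B: "\<And>n. e n \<le> B" by blast
  have inc: "incseq e" using mono by (rule strict_mono_mono)
  obtain L where L: "e \<longlonglongrightarrow> L" "\<forall>n. e n \<le> L" using incseq_convergent[OF inc, of B] B by blast
  have "L \<notin> range e"
  proof
    assume "L \<in> range e"
    then obtain n where "L = e n" by blast
    moreover have "e n < e (Suc n)" using mono by (simp add: strict_mono_Suc_iff)
    ultimately show False using L(2)[rule_format, of "Suc n"] by simp
  qed
  then have "L \<in> resolvent_set D A" using spec by (auto simp: spectrum_def)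
  from resolvent_set_bounded_below[OF this] obtain d where
    d: "d > 0" "\<And>u. u \<in> D \<Longrightarrow> d * norm u \<le> norm (A u - L *\<^sub>R u)" by blast
  have "d \<le> \<bar>e n - L\<bar>" for n
  proof -
    obtain v where v: "v \<in> D" "v \<noteq> 0" "A v = e n *\<^sub>R v"
      using ev[of n] by (auto simp: is_eigenvalue_def is_eigenvector_def)
    have "d * norm v \<le> \<bar>e n - L\<bar> * norm v"
      using d(2)[OF v(1)] v(3) by (simp flip: scaleR_diff_left)
    then show ?thesis using v(2) by simp
  qed
  moreover have "(\<lambda>n. \<bar>e n - L\<bar>) \<longlonglongrightarrow> \<bar>L - L\<bar>" by (intro tendsto_intros L)
  ultimately have "d \<le> 0" using LIMSEQ_le_const[of "\<lambda>n. \<bar>e n - L\<bar>" "\<bar>L - L\<bar>" d] by simp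
  then show ?thesis using d(1) by simp
next
  case False
  show ?thesis unfolding filterlim_at_top
  proof
    fix Z
    obtain N where "Z < e N" using False by (meson not_le)
    then have "Z \<le> e n" if "n \<ge> N" for n
      using monoD[OF strict_mono_mono[OF mono] that] by simp
    then show "\<forall>\<^sub>F n in sequentially. Z \<le> e n" unfolding eventually_sequentially by blast
  qed
qed

end

text \<open>
  The elements of \<open>S \<union> {0}\<close> in increasing order, continued beyond the maximum by steps of \<open>1\<close>.
\<close>

lemma finite_nonneg_subset_range:
  fixes S :: "real set"
  assumes S: "finite S" "\<And>x. x \<in> S \<Longrightarrow> x \<ge> 0"
  shows "\<exists>e :: nat \<Rightarrow> real. strict_mono e \<and> e 0 = 0 \<and> filterlim e at_top sequentially \<and> S \<subseteq> range e"
proof -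
  define xs where "xs = sorted_list_of_set (insert 0 S)"
  have set_xs: "set xs = insert 0 S"
    unfolding xs_def by (rule set_sorted_list_of_set) (use S(1) in simp)
  have ne: "xs \<noteq> []" using set_xs by auto
  have sorted: "sorted_wrt (<) xs" by (simp add: xs_def)
  define e where "e n = (if n < length xs then xs ! n else last xs + real (Suc n - length xs))" for n
  have last: "last xs = xs ! (length xs - 1)" using ne by (rule last_conv_nth)
  have "e n < e (Suc n)" for n
  proof -
    consider "Suc n < length xs" | "Suc n = length xs" | "length xs \<le> n" by linarith
    then show ?thesis
    proof cases
      case 1
      then show ?thesis using sorted_wrt_nth_less[OF sorted, of n "Suc n"] by (simp add: e_def)
    next
      case 2
      then have "n < length xs" "length xs - 1 = n" by auto
      then show ?thesis using 2 last by (simp add: e_def)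
    next
      case 3
      then show ?thesis by (simp add: e_def of_nat_diff)
    qed
  qed
  then have "strict_mono e" by (simp add: strict_mono_Suc_iff)
  moreover have "e 0 = 0"
  proof -
    have "0 \<in> set xs" using set_xs by simp
    then obtain i where i: "i < length xs" "xs ! i = 0" by (auto simp: in_set_conv_nth)
    have "xs ! 0 \<in> insert 0 S" using ne set_xs nth_mem[of 0 xs] by simp
    then have "xs ! 0 \<ge> 0" using S(2) by auto
    moreover have "xs ! 0 \<le> xs ! i"
      using sorted_wrt_nth_less[OF sorted, of 0 i] i(1) by (cases "i = 0") auto
    ultimately show ?thesis using i ne by (simp add: e_def)
  qed
  moreover have "filterlim e at_top sequentially"
  proof (rule filterlim_at_top_mono)
    show "filterlim (\<lambda>n. real n - (real (length xs) - last xs)) at_top sequentially" by real_asymp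
    show "\<forall>\<^sub>F n in sequentially. real n - (real (length xs) - last xs) \<le> e n"
      using eventually_ge_at_top[of "length xs"] by eventually_elim (simp add: e_def of_nat_diff)
  qed
  moreover have "S \<subseteq> range e"
  proof
    fix x assume "x \<in> S"
    then have "x \<in> set xs" using set_xs by simp
    then obtain i where "i < length xs" "xs ! i = x" by (auto simp: in_set_conv_nth)
    then have "e i = x" by (simp add: e_def)
    then show "x \<in> range e" by blast
  qed
  ultimately show ?thesis by blast
qed

lemma (in self_adjoint) discrete_spectrum_enumeration:
  assumes nn: "nonnegative_operator D A"
    and discrete: "finite (spectrum D A) \<or>
       (\<exists>e :: nat \<Rightarrow> real. strict_mono e \<and> spectrum D A = range e \<and> (\<forall>n. is_eigenvalue D A (e n)))"
  shows "\<exists>e :: nat \<Rightarrow> real. strict_mono e \<and> e 0 = 0 \<and> filterlim e at_top sequentially \<and> spectrum D A \<subseteq> range e"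
  using discrete
proof
  assume "finite (spectrum D A)"
  then show ?thesis using finite_nonneg_subset_range spectrum_nonneg[OF nn] by blast
next
  assume "\<exists>e :: nat \<Rightarrow> real. strict_mono e \<and> spectrum D A = range e \<and> (\<forall>n. is_eigenvalue D A (e n))"
  then obtain e :: "nat \<Rightarrow> real" where
    e: "strict_mono e" "spectrum D A = range e" "\<And>n. is_eigenvalue D A (e n)" by blast
  have top: "filterlim e at_top sequentially"
    using increasing_eigenvalues_tend_to_infinity[OF e] .
  have e0: "e 0 \<ge> 0" using spectrum_nonneg[OF nn] e(2) by blast
  show ?thesis
  proof (cases "e 0 = 0")
    case True
    then show ?thesis using e top by blast
  next
    case False
    define e' where "e' n = (case n of 0 \<Rightarrow> 0 | Suc m \<Rightarrow> e m)" for n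
    have "strict_mono e'"
      using e(1) e0 False by (auto simp: strict_mono_Suc_iff e'_def split: nat.split)
    moreover have "filterlim e' at_top sequentially"
      using top by (subst filterlim_sequentially_Suc[symmetric]) (simp add: e'_def)
    moreover have "range e \<subseteq> range e'"
    proof
      fix x assume "x \<in> range e"
      then obtain n where "x = e' (Suc n)" by (auto simp: e'_def)
      then show "x \<in> range e'" by blast
    qed
    ultimately show ?thesis using e(2) by (intro exI[of _ e']) (auto simp: e'_def)
  qed
qed

context discrete_operator
begin

text \<open>
  If the eigenspace for \<open>e n\<close> is trivial, \<open>A - e n\<close> is bounded below by the distance to the other
  values of \<open>e\<close>.
\<close>

lemma spectrum_imp_eigenvalue:
  assumes l: "l \<in> spectrum D A"
  shows "is_eigenvalue D A l"
proof (rule ccontr)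
  assume no: "\<not> is_eigenvalue D A l"
  obtain n where n: "l = e n" using l spectrum_e by blast
  have P0: "P n x = 0" for x
  proof (rule ccontr)
    assume "P n x \<noteq> 0"
    then have "is_eigenvector D A l (P n x)" by (simp add: is_eigenvector_def P_in_D A_P n)
    then show False using no by (auto simp: is_eigenvalue_def)
  qed
  define \<delta> where "\<delta> = min (e (Suc n) - e n) (if n = 0 then 1 else e n - e (n - 1))"
  have \<delta>: "\<delta> > 0" using e_mono by (auto simp: \<delta>_def strict_mono_def)
  have gap: "\<delta> \<le> \<bar>e m - e n\<bar>" if "m \<noteq> n" for m
  proof (cases "m < n")
    case True
    then have "e m \<le> e (n - 1)" "n \<noteq> 0" by (auto simp: e_le_iff)
    then show ?thesis by (auto simp: \<delta>_def)
  next
    case False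
    then have "e (Suc n) \<le> e m" using that by (simp add: e_le_iff)
    then show ?thesis by (auto simp: \<delta>_def)
  qed
  have "l \<in> resolvent_set D A"
  proof (rule bounded_below_imp_resolvent[OF \<delta>])
    fix x assume x: "x \<in> D"
    have "\<delta>\<^sup>2 * (norm x)\<^sup>2 \<le> (norm (A x - l *\<^sub>R x))\<^sup>2"
    proof (rule sums_le[OF _ sums_mult[OF parseval_norm] parseval_norm])
      fix m
      show "\<delta>\<^sup>2 * (norm (P m x))\<^sup>2 \<le> (norm (P m (A x - l *\<^sub>R x)))\<^sup>2"
      proof (cases "m = n")
        case False
        have "\<delta> * norm (P m x) \<le> \<bar>e m - e n\<bar> * norm (P m x)" using gap[OF False] by (intro mult_right_mono) auto
        also have "\<dots> = norm (P m (A x - l *\<^sub>R x))"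
          by (simp add: P.diff P.scaleR P_A[OF x] n flip: scaleR_diff_left)
        finally have "(\<delta> * norm (P m x))\<^sup>2 \<le> (norm (P m (A x - l *\<^sub>R x)))\<^sup>2"
          using \<delta> by (intro power_mono) auto
        then show ?thesis by (simp add: power_mult_distrib)
      qed (simp add: P0)
    qed
    then have "(\<delta> * norm x)\<^sup>2 \<le> (norm (A x - l *\<^sub>R x))\<^sup>2" by (simp add: power_mult_distrib)
    then show "\<delta> * norm x \<le> norm (A x - l *\<^sub>R x)" by (rule power2_le_imp_le) simp
  qed
  then show False using l by (simp add: spectrum_def)
qed

text \<open>
  The least element exists because the eigenvalues are values of the increasing sequence \<open>e\<close>.
\<close>

lemma least_eigenvalue_above:
  assumes "is_eigenvalue D A \<mu>" "\<mu> > lam"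
  shows "is_eigenvalue D A (LEAST \<mu>. is_eigenvalue D A \<mu> \<and> \<mu> > lam)"
    "(LEAST \<mu>. is_eigenvalue D A \<mu> \<and> \<mu> > lam) > lam"
    "(LEAST \<mu>. is_eigenvalue D A \<mu> \<and> \<mu> > lam) \<le> \<mu>"
proof -
  let ?Q = "\<lambda>\<mu>. is_eigenvalue D A \<mu> \<and> \<mu> > lam"
  have range: "\<exists>n. \<nu> = e n" if "is_eigenvalue D A \<nu>" for \<nu>
    using eigenvalue_in_spectrum[OF that] spectrum_e by blast
  define m where "m = (LEAST n. ?Q (e n))"
  obtain n0 where "\<mu> = e n0" using range[OF assms(1)] by blast
  then have m: "?Q (e m)" unfolding m_def using LeastI[of "\<lambda>n. ?Q (e n)" n0] assms by simp
  have least: "e m \<le> \<nu>" if \<nu>: "?Q \<nu>" for \<nu>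
  proof -
    obtain n where n: "\<nu> = e n" using range \<nu> by blast
    then have "m \<le> n" unfolding m_def using \<nu> by (intro Least_le) simp
    then show ?thesis using n by (simp add: e_le_iff)
  qed
  have "(LEAST \<mu>. ?Q \<mu>) = e m" by (rule Least_equality) (use m least in auto)
  then show "is_eigenvalue D A (LEAST \<mu>. ?Q \<mu>)" "(LEAST \<mu>. ?Q \<mu>) > lam" "(LEAST \<mu>. ?Q \<mu>) \<le> \<mu>"
    using m least[of \<mu>] assms by auto
qed

lemma next_eigenvalue_le:
  assumes "is_eigenvalue D A (e n)" "e n > lam"
  shows "next_eigenvalue D A lam \<le> ereal (e n)"
proof (cases "finite (spectrum D A) \<and> lam = Max (spectrum D A)")
  case True
  then have "e n \<le> lam" using eigenvalue_in_spectrum[OF assms(1)] by simp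
  then show ?thesis using assms(2) by simp
next
  case False
  then show ?thesis unfolding next_eigenvalue_def using least_eigenvalue_above(3)[OF assms] by simp
qed

lemma next_eigenvalue_gt:
  assumes lam: "is_eigenvalue D A lam"
    and discrete: "finite (spectrum D A) \<or>
       (\<exists>e :: nat \<Rightarrow> real. strict_mono e \<and> spectrum D A = range e \<and> (\<forall>n. is_eigenvalue D A (e n)))"
  shows "ereal lam < next_eigenvalue D A lam"
proof (cases "finite (spectrum D A) \<and> lam = Max (spectrum D A)")
  case False
  have "\<exists>\<mu>. is_eigenvalue D A \<mu> \<and> \<mu> > lam"
    using discrete
  proof
    assume fin: "finite (spectrum D A)"
    have "lam \<in> spectrum D A" using lam by (rule eigenvalue_in_spectrum)
    then have "lam \<le> Max (spectrum D A)" "Max (spectrum D A) \<in> spectrum D A"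
      using fin by (auto intro: Max_in)
    then show ?thesis using False fin spectrum_imp_eigenvalue by (intro exI[of _ "Max (spectrum D A)"]) auto
  next
    assume "\<exists>e :: nat \<Rightarrow> real. strict_mono e \<and> spectrum D A = range e \<and> (\<forall>n. is_eigenvalue D A (e n))"
    then obtain f :: "nat \<Rightarrow> real" where
      f: "strict_mono f" "spectrum D A = range f" "\<And>n. is_eigenvalue D A (f n)" by blast
    obtain n where "lam = f n" using eigenvalue_in_spectrum[OF lam] f(2) by blast
    then show ?thesis using f(1) f(3)[of "Suc n"] by (auto simp: strict_mono_Suc_iff)
  qed
  then show ?thesis using least_eigenvalue_above(2) False by (auto simp: next_eigenvalue_def)
qed (simp add: next_eigenvalue_def)

end

section \<open>The alternatives exclude each other\<close>

lemma slow_not_null: "slow_solution D A p u \<Longrightarrow> \<not> null_solution u"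
proof
  assume "slow_solution D A p u" "null_solution u"
  then obtain M where "M > 0" "norm (u 0) \<ge> M / (1 + 0) powr (1 / p)" "u 0 = 0"
    unfolding slow_solution_def null_solution_def by (metis order_refl)
  then show False by simp
qed

text \<open>
  The rate \<open>\<gamma> = \<lambda>\<close> is admissible because the next eigenvalue is strictly larger.
\<close>

lemma fast_limit:
  assumes fast: "spectral_fast_solution D A p q u" and pq: "p > 0" "q > 0"
    and next_gt: "\<And>lam. is_eigenvalue D A lam \<Longrightarrow> ereal lam < next_eigenvalue D A lam"
  shows "\<exists>lam>0. \<exists>v. v \<noteq> 0 \<and> ((\<lambda>t. exp (lam * t) *\<^sub>R u t) \<longlongrightarrow> v) at_top"
proof -
  obtain lam v where lam: "lam > 0" and v: "is_eigenvector D A lam v"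
    and conv: "\<And>\<gamma>::real. ereal \<gamma> < min (next_eigenvalue D A lam) (min (ereal ((1 + p) * lam)) (ereal ((1 + q) * lam))) \<Longrightarrow>
           ((\<lambda>t. dom_power_norm D A (1/2) (u t - exp (- lam * t) *\<^sub>R v) * exp (\<gamma> * t)) \<longlongrightarrow> 0) at_top"
    using fast unfolding spectral_fast_solution_def by blast
  have "ereal lam < next_eigenvalue D A lam" using v by (intro next_gt) (auto simp: is_eigenvalue_def)
  then have "ereal lam < min (next_eigenvalue D A lam) (min (ereal ((1 + p) * lam)) (ereal ((1 + q) * lam)))"
    using lam pq by simp
  note lim = conv[OF this]
  have "((\<lambda>t. exp (lam * t) *\<^sub>R u t - v) \<longlongrightarrow> 0) at_top"
  proof (rule Lim_null_comparison[OF always_eventually lim], rule allI)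
    fix t
    define x where "x = u t - exp (- lam * t) *\<^sub>R v"
    have "exp (lam * t) *\<^sub>R u t - v = exp (lam * t) *\<^sub>R x"
      by (simp add: x_def scaleR_diff_right flip: exp_add)
    then have "norm (exp (lam * t) *\<^sub>R u t - v) = norm x * exp (lam * t)" by simp
    also have "\<dots> \<le> dom_power_norm D A (1/2) x * exp (lam * t)"
      by (intro mult_right_mono) (auto simp: dom_power_norm_def real_le_rsqrt)
    finally show "norm (exp (lam * t) *\<^sub>R u t - v) \<le> dom_power_norm D A (1/2) (u t - exp (- lam * t) *\<^sub>R v) * exp (lam * t)"
      by (simp add: x_def)
  qed
  then have "((\<lambda>t. exp (lam * t) *\<^sub>R u t) \<longlongrightarrow> v) at_top" by (rule LIM_zero_cancel)
  then show ?thesis using lam v by (auto simp: is_eigenvector_def)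
qed

lemma fast_not_null:
  assumes "spectral_fast_solution D A p q u" "p > 0" "q > 0"
    "\<And>lam. is_eigenvalue D A lam \<Longrightarrow> ereal lam < next_eigenvalue D A lam"
  shows "\<not> null_solution u"
proof
  assume null: "null_solution u"
  obtain lam v where v: "v \<noteq> 0" and lim: "((\<lambda>t. exp (lam * t) *\<^sub>R u t) \<longlongrightarrow> v) at_top"
    using fast_limit[OF assms] by blast
  have "\<forall>\<^sub>F t in at_top. exp (lam * t) *\<^sub>R u t = 0"
    using eventually_ge_at_top[of 0] by eventually_elim (use null in \<open>simp add: null_solution_def\<close>)
  then have "((\<lambda>t. exp (lam * t) *\<^sub>R u t) \<longlongrightarrow> 0) at_top" by (rule tendsto_eventually)
  then show False using lim v tendsto_unique[OF trivial_limit_at_top_linorder] by blast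
qed

lemma fast_not_slow:
  assumes "spectral_fast_solution D A p q u" and pq: "p > 0" "q > 0"
    and "\<And>lam. is_eigenvalue D A lam \<Longrightarrow> ereal lam < next_eigenvalue D A lam"
  shows "\<not> slow_solution D A p u"
proof
  assume "slow_solution D A p u"
  then obtain M where M: "M > 0" "\<And>t. t \<ge> 0 \<Longrightarrow> norm (u t) \<ge> M / (1 + t) powr (1 / p)"
    unfolding slow_solution_def by blast
  obtain lam v where lam: "lam > 0" and lim: "((\<lambda>t. exp (lam * t) *\<^sub>R u t) \<longlongrightarrow> v) at_top"
    using fast_limit[OF assms] by blast
  have "1 / p > 0" using pq by simp
  then have "filterlim (\<lambda>t. exp (lam * t) * (M / (1 + t) powr (1 / p))) at_top at_top"
    using lam M(1) by real_asymp
  then have "filterlim (\<lambda>t. norm (exp (lam * t) *\<^sub>R u t)) at_top at_top"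
  proof (rule filterlim_at_top_mono)
    show "\<forall>\<^sub>F t in at_top. exp (lam * t) * (M / (1 + t) powr (1 / p)) \<le> norm (exp (lam * t) *\<^sub>R u t)"
      using eventually_ge_at_top[of 0]
      by eventually_elim (use M(2) in \<open>simp only: norm_scaleR abs_exp_cancel mult_left_mono exp_ge_zero\<close>)
  qed
  moreover have "((\<lambda>t. norm (exp (lam * t) *\<^sub>R u t)) \<longlongrightarrow> norm v) at_top" by (intro tendsto_norm lim)
  ultimately show False using not_tendsto_and_filterlim_at_infinity[OF trivial_limit_at_top_linorder]
    filterlim_at_top_imp_at_infinity by blast
qed

section \<open>Classification of solutions\<close>

theorem theorem2p1:
  fixes D :: "'h::{real_inner, complete_space} set"
    and A :: "'h \<Rightarrow> 'h"
    and g u :: "real \<Rightarrow> 'h"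
    and p q K\<^sub>0 :: real
  assumes self_adjoint: "self_adjoint_operator D A"
    and nonnegative: "nonnegative_operator D A"
    and g_L2: "\<And>T. T > 0 \<Longrightarrow> L2_on {0<..<T} g"
    and u_continuous: "continuous_into_dom_power D A (1/2) {0..} u"
    and u_solution: "strong_solution D A g u"
    and spectrum_discrete:
      "finite (spectrum D A) \<or>
       (\<exists>e :: nat \<Rightarrow> real. strict_mono e \<and> spectrum D A = range e \<and> (\<forall>n. is_eigenvalue D A (e n)))"
    and u_decay: "((\<lambda>t. dom_power_norm D A (1/2) (u t)) \<longlongrightarrow> 0) at_top"
    and p_pos: "p > 0" and q_pos: "q > 0" and K_nonneg: "K\<^sub>0 \<ge> 0"
    and g_bound: "\<And>t. t \<ge> 0 \<Longrightarrow>
      norm (g t) \<le> K\<^sub>0 * (norm (u t) powr (1 + p) + norm (op_power D A (1/2) (u t)) powr (1 + q))"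
  shows
    "(null_solution u \<and> \<not> slow_solution D A p u \<and> \<not> spectral_fast_solution D A p q u) \<or>
     (\<not> null_solution u \<and> slow_solution D A p u \<and> \<not> spectral_fast_solution D A p q u) \<or>
     (\<not> null_solution u \<and> \<not> slow_solution D A p u \<and> spectral_fast_solution D A p q u)"
proof -
  interpret self_adjoint D A by unfold_locales (rule self_adjoint)
  obtain e :: "nat \<Rightarrow> real" where e: "strict_mono e" "e 0 = 0" "filterlim e at_top sequentially"
    "spectrum D A \<subseteq> range e"
    using discrete_spectrum_enumeration[OF nonnegative spectrum_discrete] by blast
  have cont: "continuous_on {0..} u" "continuous_on {0..} (\<lambda>t. op_power D A (1/2) (u t))"
  proof -
    have *: "continuous_on {0..} (\<lambda>t. (u t, op_power D A (1/2) (u t)))"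
      using u_continuous by (simp add: continuous_into_dom_power_def)
    show "continuous_on {0..} u" "continuous_on {0..} (\<lambda>t. op_power D A (1/2) (u t))"
      using continuous_on_fst[OF *] continuous_on_snd[OF *] by simp_all
  qed
  have G_cont: "continuous_on {0..} (\<lambda>t. K\<^sub>0 * (norm (u t) powr (1 + p) + norm (op_power D A (1/2) (u t)) powr (1 + q)))"
    using p_pos q_pos by (intro continuous_intros continuous_on_powr' cont) auto
  interpret semilinear_parabolic D A e g u p q K\<^sub>0
    by unfold_locales (fact nonnegative e u_continuous u_solution G_cont g_bound p_pos q_pos K_nonneg u_decay)+
  have next_gt: "ereal lam < next_eigenvalue D A lam" if "is_eigenvalue D A lam" for lam
    using that spectrum_discrete by (rule next_eigenvalue_gt)
  note excl = slow_not_null[of D A p u] fast_not_null[OF _ p_pos q_pos next_gt, of u]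
    fast_not_slow[OF _ p_pos q_pos next_gt, of u]
  show ?thesis
  proof (cases "null_solution u")
    case False
    then have nz: "u t \<noteq> 0" if "t \<ge> 0" for t using null_or_nowhere_zero that by blast
    have "slow_solution D A p u \<or> spectral_fast_solution D A p q u"
      by (rule slow_or_fast) (use nz next_eigenvalue_le in auto)
    then show ?thesis using excl False by blast
  qed (use excl in blast)
qed

end
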